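(* Let $k\ge 3$ be a fixed integer, and consider the $(1:b)$ $k$-star Avoider-Enforcer game played on the edge set of $K_n$ (Avoider loses if and only if his graph at the end of the game contains a copy of $K_{1,k}$, i.e. a vertex of degree at least $k$). Let $f^{mon}=f^{mon}(n)$, $f^-=f^-(n)$, $f^+=f^+(n)$ denote the monotone, lower and upper threshold biases of this game, and let $e^+_{n,k}, e^-_{n,k}$ be as defined in the context. Then, with asymptotic notation referring to $n\to\infty$ (with $k$ fixed): (i) $f^{mon}=\Theta(n^{\frac{k}{k-1}})$; (ii) $e^+_{n,k}\le f^+ = O(n^{\frac{k}{k-1}})$ holds for all values of $n$, and $f^+=\Theta(n^{\frac{k}{k-1}})$ holds for infinitely many values of $n$; (iii) $\Omega(n^{\frac{k+1}{k}}) = e^-_{n,k}\le f^- = O(n^{\frac{k+1}{k}}\log n)$ holds for all values of $n$, and $f^-=\Theta(n^{\frac{k+1}{k}})$ holds for infinitely many values of $n$.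
   Context: Avoider-Enforcer games on $K_n$: the board is $X=E(K_n)$, the target family $\mathcal{F}$ consists of the edge sets of all copies of the star $K_{1,k}$ in $K_n$. Avoider and Enforcer alternately claim previously unclaimed edges, Avoider moving first. In the strict $(1:b)$ game, Avoider claims exactly $1$ and Enforcer exactly $b$ unclaimed edges per move (if fewer unclaimed edges remain than the required number, the player claims all of them). In the monotone $(1:b)$ game, Avoider claims at least $1$ and Enforcer at least $b$ unclaimed edges per move (with the same rule when too few remain). The game ends when all edges are claimed; Avoider loses iff he has claimed all elements of some target set, otherwise he wins. The monotone threshold bias $f^{mon}$ is the largest non-negative integer such that Enforcer wins the monotone $(1:b)$ game if and only if $b\le f^{mon}$. The lower threshold bias $f^-$ is the largest integer such that Enforcer wins the strict $(1:b)$ game for every $b\le f^-$; the upper threshold bias $f^+$ is the smallest integer such that Avoider wins the strict $(1:b)$ game for every $b>f^+$. For positive integers $n,b$, let $r=r(n,b)$ be the integer with $1\le r\le b+1$ and $\binom{n}{2}\equiv r \pmod{b+1}$. Define $e^+_{n,k}=\max\{b\le 0.4n^{\frac{k}{k-1}} : r(n,b)<\frac{n^{k+1}}{(2b)^{k-1}}\}$ and $e^-_{n,k}=\max\{b\le 0.4n^{\frac{k}{k-1}} : r(n,b')<\frac{n^{k+1}}{(2b')^{k-1}} \text{ for every } 1\le b'\le b\}$, where $b,b'$ range over positive integers.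
   Formalization: The inequalities e^+ ≤ f^+ and e^- ≤ f^- are stated for all sufficiently large n (k fixed) rather than for all n, since they fail for small n: for k = n = 3 no K_{1,3} exists, so f^+ = f^- = 0, while e^+, e^- ≥ 1. *)

theory Defs
  imports Complex_Main "HOL-Library.Landau_Symbols" "HOL-Number_Theory.Cong"
begin

datatype player = Avoider | Enforcer

text \<open>A move rule maps a bias and the set of unclaimed elements to the set of legal moves.\<close>

type_synonym 'a move_rule = "nat \<Rightarrow> 'a set \<Rightarrow> 'a set set"

definition strict_moves :: "'a move_rule" where
  "strict_moves q U = {S. S \<subseteq> U \<and> card S = min q (card U)}"

definition monotone_moves :: "'a move_rule" where
  "monotone_moves q U = {S. S \<subseteq> U \<and> card S \<ge> min q (card U)}"

text \<open>A history is the list of all moves made so far, in chronological order. Avoider moves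
  first, so his moves are those at even positions.\<close>

definition turn :: "'a set list \<Rightarrow> player" where
  "turn h = (if even (length h) then Avoider else Enforcer)"

definition avoider_claimed :: "'a set list \<Rightarrow> 'a set" where
  "avoider_claimed h = \<Union> {h ! i | i. i < length h \<and> even i}"

definition unclaimed :: "'a set \<Rightarrow> 'a set list \<Rightarrow> 'a set" where
  "unclaimed X h = X - \<Union> (set h)"

fun bias :: "nat \<Rightarrow> player \<Rightarrow> nat" where
  "bias b Avoider = 1"
| "bias b Enforcer = b"

definition legal_moves :: "'a move_rule \<Rightarrow> nat \<Rightarrow> 'a set \<Rightarrow> 'a set list \<Rightarrow> 'a set set" where
  "legal_moves R b X h = R (bias b (turn h)) (unclaimed X h)"

text \<open>The histories that can arise when player \<open>P\<close> follows the strategy \<open>\<sigma>\<close> and the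
  opponent makes arbitrary legal moves.\<close>

inductive consistent_history ::
    "'a move_rule \<Rightarrow> nat \<Rightarrow> 'a set \<Rightarrow> player \<Rightarrow> ('a set list \<Rightarrow> 'a set) \<Rightarrow> 'a set list \<Rightarrow> bool"
  for R b X P \<sigma> where
  start: "consistent_history R b X P \<sigma> []"
| own_move: "consistent_history R b X P \<sigma> h \<Longrightarrow> unclaimed X h \<noteq> {} \<Longrightarrow> turn h = P \<Longrightarrow>
    consistent_history R b X P \<sigma> (h @ [\<sigma> h])"
| opponent_move: "consistent_history R b X P \<sigma> h \<Longrightarrow> unclaimed X h \<noteq> {} \<Longrightarrow> turn h \<noteq> P \<Longrightarrow>
    S \<in> legal_moves R b X h \<Longrightarrow> consistent_history R b X P \<sigma> (h @ [S])"

definition avoider_loses :: "'a set set \<Rightarrow> 'a set list \<Rightarrow> bool" where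
  "avoider_loses F h \<longleftrightarrow> (\<exists>T\<in>F. T \<subseteq> avoider_claimed h)"

fun won_by :: "player \<Rightarrow> 'a set set \<Rightarrow> 'a set list \<Rightarrow> bool" where
  "won_by Avoider F h \<longleftrightarrow> \<not> avoider_loses F h"
| "won_by Enforcer F h \<longleftrightarrow> avoider_loses F h"

definition winning_strategy ::
    "'a move_rule \<Rightarrow> nat \<Rightarrow> 'a set \<Rightarrow> 'a set set \<Rightarrow> player \<Rightarrow> ('a set list \<Rightarrow> 'a set) \<Rightarrow> bool" where
  "winning_strategy R b X F P \<sigma> \<longleftrightarrow> (\<forall>h. consistent_history R b X P \<sigma> h \<longrightarrow>
     (unclaimed X h \<noteq> {} \<and> turn h = P \<longrightarrow> \<sigma> h \<in> legal_moves R b X h) \<and>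
     (unclaimed X h = {} \<longrightarrow> won_by P F h))"

definition wins_game :: "player \<Rightarrow> 'a move_rule \<Rightarrow> nat \<Rightarrow> 'a set \<Rightarrow> 'a set set \<Rightarrow> bool" where
  "wins_game P R b X F \<longleftrightarrow> (\<exists>\<sigma>. winning_strategy R b X F P \<sigma>)"

definition complete_edges :: "nat \<Rightarrow> nat set set" where
  "complete_edges n = {e. e \<subseteq> {..<n} \<and> card e = 2}"

definition star_copies :: "nat \<Rightarrow> nat \<Rightarrow> nat set set set" where
  "star_copies k n = {(\<lambda>v. {c, v}) ` L | c L. c < n \<and> L \<subseteq> {..<n} - {c} \<and> card L = k}"

definition wins_star_game :: "player \<Rightarrow> nat set move_rule \<Rightarrow> nat \<Rightarrow> nat \<Rightarrow> nat \<Rightarrow> bool" where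
  "wins_star_game P R k n b \<longleftrightarrow> wins_game P R b (complete_edges n) (star_copies k n)"

text \<open>Biases are positive integers; a threshold bias may be 0.\<close>

definition f_mon :: "nat \<Rightarrow> nat \<Rightarrow> nat" where
  "f_mon k n = (GREATEST f. \<forall>b\<ge>1. wins_star_game Enforcer monotone_moves k n b \<longleftrightarrow> b \<le> f)"

definition f_minus :: "nat \<Rightarrow> nat \<Rightarrow> nat" where
  "f_minus k n = (GREATEST f. \<forall>b\<ge>1. b \<le> f \<longrightarrow> wins_star_game Enforcer strict_moves k n b)"

definition f_plus :: "nat \<Rightarrow> nat \<Rightarrow> nat" where
  "f_plus k n = (LEAST f. \<forall>b>f. wins_star_game Avoider strict_moves k n b)"

definition star_rem :: "nat \<Rightarrow> nat \<Rightarrow> nat" where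
  "star_rem n b = (THE r. 1 \<le> r \<and> r \<le> b + 1 \<and> [n choose 2 = r] (mod (b + 1)))"

definition small_remainder :: "nat \<Rightarrow> nat \<Rightarrow> nat \<Rightarrow> bool" where
  "small_remainder k n b \<longleftrightarrow> real (star_rem n b) < real n ^ (k + 1) / (2 * real b) ^ (k - 1)"

text \<open>The sets below can be empty for finitely many small \<open>n\<close>; the value of \<open>Max\<close> is then
  irrelevant.\<close>

definition e_plus :: "nat \<Rightarrow> nat \<Rightarrow> nat" where
  "e_plus k n = Max {b. 1 \<le> b \<and> real b \<le> 0.4 * real n powr (real k / (real k - 1)) \<and>
     small_remainder k n b}"

definition e_minus :: "nat \<Rightarrow> nat \<Rightarrow> nat" where
  "e_minus k n = Max {b. 1 \<le> b \<and> real b \<le> 0.4 * real n powr (real k / (real k - 1)) \<and>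
     (\<forall>b'. 1 \<le> b' \<and> b' \<le> b \<longrightarrow> small_remainder k n b')}"

text \<open>\<open>f = \<Theta>(g)\<close> for infinitely many values of the argument: there is one infinite set of
  arguments, enumerated by \<open>s\<close>, along which the bounds hold with fixed constants.\<close>

definition theta_infinitely_often :: "(nat \<Rightarrow> real) \<Rightarrow> (nat \<Rightarrow> real) \<Rightarrow> bool" where
  "theta_infinitely_often f g \<longleftrightarrow>
     (\<exists>s :: nat \<Rightarrow> nat. strict_mono s \<and> (\<lambda>i. f (s i)) \<in> \<Theta>(\<lambda>i. g (s i)))"

end

theory Submission
  imports Defs "HOL-Real_Asymp.Real_Asymp"
begin

text \<open>
  Write \<open>N = n choose 2\<close>, and call the degree of a vertex in Avoider's graph its level.

  Avoider always claims an edge whose larger endpoint level is as small as possible. When this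
  minimum is \<open>j\<close>, all unclaimed edges meet the vertices of level at least \<open>j\<close>; if there are \<open>a j\<close>
  of them, at most \<open>a j * n / (b + 1)\<close> rounds are left, and each creates at most two vertices of
  level \<open>j + 1\<close>. So \<open>a j \<le> n * (2 * n / (b + 1)) ^ j\<close>, and level \<open>k\<close> is never reached if
  \<open>b + 1 \<ge> 2 * n powr (k / (k - 1))\<close>, or, in the strict game, if the remainder \<open>r\<close>, which is the
  number of edges from which Avoider chooses last, exceeds \<open>n * a (k - 1)\<close>.

  Enforcer reverses this. He declares vertices of the lowest level dead one after another by
  claiming their edges to the vertices already dead, so that every edge Avoider claims raises a
  vertex that is still alive. The potential that weighs an unclaimed edge between a dead vertex
  and a living one of level \<open>d\<close> by \<open>\<rho> ^ d\<close>, where \<open>\<rho>\<close> is about \<open>b / n\<close>, does not drop as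
  long as the lowest level stays the same, and drops by at most \<open>b * \<rho> ^ j\<close> when it rises to \<open>j\<close>.
  Hence about \<open>n ^ (k + 1) / (2 * b ^ (k - 1))\<close> unclaimed edges are left when all living vertices
  have level \<open>k - 1\<close>, and Enforcer wins if the last edge that Avoider must claim is among them.

  It remains to choose \<open>b\<close>: rounding a quotient of \<open>N\<close> up or down makes the remainder of \<open>N\<close>
  modulo \<open>b + 1\<close> almost maximal or very small, with \<open>b\<close> determined up to a constant factor.
\<close>

section \<open>Games and invariants\<close>

text \<open>Two obstacles shape the proof. First, the comparisons with \<open>e_plus\<close> and
  \<open>e_minus\<close> prescribe the factor 0.4, so Enforcer's count of surviving edges must be
  right up to lower order terms once \<open>b\<close> exceeds a large multiple of \<open>n\<close>.
  Playing between two vertex sets fixed in advance loses a constant factor. That suffices for the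
  monotone game and for \<open>b\<close> linear in \<open>n\<close>; in the main range the two sides
  must come out of an opening on the whole graph, and the living side consists of vertices that
  Avoider himself has touched. Second, one edge of Avoider must pay for a whole move of Enforcer. A
  raised vertex keeps at least \<open>\<mu>\<close> unclaimed edges with
  \<open>(\<rho> - 1) * \<mu> \<ge> b + 1\<close>, so raising it by one level makes up for Avoider's
  edge and for \<open>b\<close> others; this dictates \<open>\<rho>\<close>. Rounding yields a
  suitable bias for every large \<open>n\<close>, so the orders of \<open>f_plus\<close> and
  \<open>f_minus\<close> are found along all \<open>n\<close>; the claims about infinitely many
  \<open>n\<close> and the bound with the logarithm follow.\<close>

definition proper_rule :: "'a move_rule \<Rightarrow> bool" where
  "proper_rule R \<longleftrightarrow> (\<forall>q U S. S \<in> R q U \<longrightarrow> S \<subseteq> U \<and> min q (card U) \<le> card S)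
     \<and> (\<forall>q U S. S \<subseteq> U \<and> card S = min q (card U) \<longrightarrow> S \<in> R q U)"

lemma proper_rule_strict: "proper_rule strict_moves"
  by (auto simp: proper_rule_def strict_moves_def)

lemma proper_rule_monotone: "proper_rule monotone_moves"
  by (auto simp: proper_rule_def monotone_moves_def)

lemma proper_rule_subset: "proper_rule R \<Longrightarrow> S \<in> R q U \<Longrightarrow> S \<subseteq> U"
  by (auto simp: proper_rule_def)

lemma proper_rule_card: "proper_rule R \<Longrightarrow> S \<in> R q U \<Longrightarrow> min q (card U) \<le> card S"
  by (auto simp: proper_rule_def)

lemma proper_rule_intro: "proper_rule R \<Longrightarrow> S \<subseteq> U \<Longrightarrow> card S = min q (card U) \<Longrightarrow> S \<in> R q U"
  by (auto simp: proper_rule_def)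

lemma proper_rule_empty: "proper_rule R \<Longrightarrow> R q {} = {{}}"
  by (auto dest: proper_rule_subset intro: proper_rule_intro)

lemma unclaimed_Nil [simp]: "unclaimed X [] = X"
  by (simp add: unclaimed_def)

lemma unclaimed_snoc [simp]: "unclaimed X (h @ [S]) = unclaimed X h - S"
  by (auto simp: unclaimed_def)

lemma avoider_claimed_Nil [simp]: "avoider_claimed [] = {}"
  by (simp add: avoider_claimed_def)

lemma avoider_claimed_snoc [simp]:
  "avoider_claimed (h @ [S]) = avoider_claimed h \<union> (if even (length h) then S else {})"
proof -
  have *: "avoider_claimed g = (\<Union>i\<in>{i. i < length g \<and> even i}. g ! i)" for g :: "'a set list"
    by (auto simp: avoider_claimed_def)
  have "{i. i < length (h @ [S]) \<and> even i}
      = {i. i < length h \<and> even i} \<union> (if even (length h) then {length h} else {})"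
    by (auto simp: less_Suc_eq)
  then have "avoider_claimed (h @ [S]) = (\<Union>i\<in>{i. i < length h \<and> even i}. (h @ [S]) ! i)
      \<union> (if even (length h) then S else {})"
    unfolding * by (simp add: Un_commute)
  also have "(\<Union>i\<in>{i. i < length h \<and> even i}. (h @ [S]) ! i) = avoider_claimed h"
    unfolding * by (intro SUP_cong) (auto simp: nth_append)
  finally show ?thesis .
qed

section \<open>Strategies from invariants of positions\<close>

definition position :: "'a set \<Rightarrow> 'a set \<Rightarrow> 'a set \<Rightarrow> bool" where
  "position X G U \<longleftrightarrow> G \<subseteq> X \<and> U \<subseteq> X \<and> G \<inter> U = {}"

text \<open>The strategy selects by \<open>SOME\<close> a move after which every reply restores
  \<open>I\<close>, so strategies on histories reduce to an invariant of positions at Avoider's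
  turns. \<open>proper_rule\<close> collects what the strict and the monotone rule share, which lets
  one analysis serve both.\<close>

lemma avoider_wins_by_invariant:
  assumes R: "proper_rule R"
    and init: "I {} X"
    and final: "\<And>G. I G {} \<Longrightarrow> position X G {} \<Longrightarrow> \<not> (\<exists>T\<in>F. T \<subseteq> G)"
    and step: "\<And>G U. I G U \<Longrightarrow> position X G U \<Longrightarrow> U \<noteq> {} \<Longrightarrow>
      \<exists>S\<in>R 1 U. \<forall>T\<in>R b (U - S). I (G \<union> S) (U - S - T)"
  shows "wins_game Avoider R b X F"
proof -
  define I' where "I' G U \<longleftrightarrow> I G U \<and> position X G U" for G U
  have step': "\<exists>S\<in>R 1 U. \<forall>T\<in>R b (U - S). I' (G \<union> S) (U - S - T)"
    if *: "I' G U" "U \<noteq> {}" for G U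
  proof -
    from step[of G U] * obtain S where S: "S \<in> R 1 U" "\<forall>T\<in>R b (U - S). I (G \<union> S) (U - S - T)"
      by (auto simp: I'_def)
    show ?thesis
      using S * proper_rule_subset[OF R S(1)] by (intro bexI[of _ S]) (auto simp: I'_def position_def)
  qed
  define \<sigma> where "\<sigma> h = (SOME S. S \<in> R 1 (unclaimed X h) \<and>
     (\<forall>T\<in>R b (unclaimed X h - S). I' (avoider_claimed h \<union> S) (unclaimed X h - S - T)))" for h
  have \<sigma>: "\<sigma> h \<in> R 1 (unclaimed X h) \<and>
     (\<forall>T\<in>R b (unclaimed X h - \<sigma> h). I' (avoider_claimed h \<union> \<sigma> h) (unclaimed X h - \<sigma> h - T))"
    if "I' (avoider_claimed h) (unclaimed X h)" "unclaimed X h \<noteq> {}" for h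
  proof -
    have "\<exists>S. S \<in> R 1 (unclaimed X h) \<and> (\<forall>T\<in>R b (unclaimed X h - S).
        I' (avoider_claimed h \<union> S) (unclaimed X h - S - T))"
      using step'[OF that] by blast
    from someI_ex[OF this] show ?thesis unfolding \<sigma>_def .
  qed
  have inv: "(even (length h) \<longrightarrow> I' (avoider_claimed h) (unclaimed X h)) \<and>
     (odd (length h) \<longrightarrow> (\<forall>T\<in>R b (unclaimed X h). I' (avoider_claimed h) (unclaimed X h - T)))"
    if "consistent_history R b X Avoider \<sigma> h" for h
    using that
  proof induction
    case start
    then show ?case using init by (auto simp: I'_def position_def)
  next
    case (own_move h)
    then show ?case using \<sigma>[of h] by (auto simp: turn_def split: if_splits)
  next
    case (opponent_move h S)
    then show ?case by (auto simp: turn_def legal_moves_def split: if_splits)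
  qed
  have "winning_strategy R b X F Avoider \<sigma>"
    unfolding winning_strategy_def
  proof (intro allI impI conjI)
    fix h assume h: "consistent_history R b X Avoider \<sigma> h"
    { assume "unclaimed X h \<noteq> {} \<and> turn h = Avoider"
      then show "\<sigma> h \<in> legal_moves R b X h"
        using inv[OF h] \<sigma>[of h] by (auto simp: legal_moves_def turn_def split: if_splits) }
    { assume e: "unclaimed X h = {}"
      \<comment> \<open>The game can also end right after Avoider's own move; the empty set is then
        a legal reply and carries the invariant to this position.\<close>
      have "I' (avoider_claimed h) {}"
        using inv[OF h] e proper_rule_empty[OF R, of b] by (cases "even (length h)") auto
      then show "won_by Avoider F h"
        using final by (auto simp: avoider_loses_def I'_def) }
  qed
  then show ?thesis by (auto simp: wins_game_def)
qed

lemma enforcer_wins_by_invariant: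
  assumes R: "proper_rule R"
    and init: "J {} X"
    and final: "\<And>G. J G {} \<Longrightarrow> position X G {} \<Longrightarrow> \<exists>T\<in>F. T \<subseteq> G"
    and step: "\<And>G U S. J G U \<Longrightarrow> position X G U \<Longrightarrow> U \<noteq> {} \<Longrightarrow> S \<in> R 1 U \<Longrightarrow>
      \<exists>T\<in>R b (U - S). J (G \<union> S) (U - S - T)"
  shows "wins_game Enforcer R b X F"
proof -
  define J' where "J' G U \<longleftrightarrow> J G U \<and> position X G U" for G U
  have step': "\<exists>T\<in>R b (U - S). J' (G \<union> S) (U - S - T)"
    if *: "J' G U" "U \<noteq> {}" "S \<in> R 1 U" for G U S
  proof -
    from step[of G U S] * obtain T where T: "T \<in> R b (U - S)" "J (G \<union> S) (U - S - T)"
      by (auto simp: J'_def)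
    show ?thesis
      using T * proper_rule_subset[OF R *(3)]
      by (intro bexI[of _ T]) (auto simp: J'_def position_def)
  qed
  define \<sigma> where "\<sigma> h = (SOME T. T \<in> R b (unclaimed X h) \<and>
     J' (avoider_claimed h) (unclaimed X h - T))" for h
  have \<sigma>: "\<sigma> h \<in> R b (unclaimed X h) \<and> J' (avoider_claimed h) (unclaimed X h - \<sigma> h)"
    if "\<exists>T\<in>R b (unclaimed X h). J' (avoider_claimed h) (unclaimed X h - T)" for h
  proof -
    have "\<exists>T. T \<in> R b (unclaimed X h) \<and> J' (avoider_claimed h) (unclaimed X h - T)"
      using that by blast
    from someI_ex[OF this] show ?thesis unfolding \<sigma>_def .
  qed
  have inv: "(even (length h) \<longrightarrow> J' (avoider_claimed h) (unclaimed X h)) \<and>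
     (odd (length h) \<longrightarrow> (\<exists>T\<in>R b (unclaimed X h). J' (avoider_claimed h) (unclaimed X h - T)))"
    if "consistent_history R b X Enforcer \<sigma> h" for h
    using that
  proof induction
    case start
    then show ?case using init by (auto simp: J'_def position_def)
  next
    case (own_move h)
    then show ?case using \<sigma>[of h] by (auto simp: turn_def split: if_splits)
  next
    case (opponent_move h S)
    then show ?case using step' by (auto simp: turn_def legal_moves_def split: if_splits)
  qed
  have "winning_strategy R b X F Enforcer \<sigma>"
    unfolding winning_strategy_def
  proof (intro allI impI conjI)
    fix h assume h: "consistent_history R b X Enforcer \<sigma> h"
    { assume "unclaimed X h \<noteq> {} \<and> turn h = Enforcer"
      then show "\<sigma> h \<in> legal_moves R b X h"
        using inv[OF h] \<sigma>[of h] by (auto simp: legal_moves_def turn_def split: if_splits) }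
    { assume e: "unclaimed X h = {}"
      have "J' (avoider_claimed h) {}"
        using inv[OF h] e proper_rule_empty[OF R, of b] by (cases "even (length h)") auto
      then show "won_by Enforcer F h"
        using final by (auto simp: avoider_loses_def J'_def) }
  qed
  then show ?thesis by (auto simp: wins_game_def)
qed

text \<open>Let the two strategies play against each other: the history stays consistent with both,
  and the unclaimed set shrinks because both biases are positive, so some finished game would be won
  by both players.\<close>

lemma not_both_win:
  assumes R: "proper_rule R" and X: "finite X" and b: "b \<ge> 1"
    and A: "wins_game Avoider R b X F" and E: "wins_game Enforcer R b X F"
  shows False
proof -
  obtain \<sigma> \<tau> where \<sigma>: "winning_strategy R b X F Avoider \<sigma>" and \<tau>: "winning_strategy R b X F Enforcer \<tau>"
    using A E by (auto simp: wins_game_def)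
  have "False" if "consistent_history R b X Avoider \<sigma> h" "consistent_history R b X Enforcer \<tau> h" for h
    using that
  proof (induction "card (unclaimed X h)" arbitrary: h rule: less_induct)
    case less
    show False
    proof (cases "unclaimed X h = {}")
      case True
      with less.prems \<sigma> \<tau> show False by (auto simp: winning_strategy_def)
    next
      case False
      have fin: "finite (unclaimed X h)" using X by (simp add: unclaimed_def)
      have decr: "card (unclaimed X h - S) < card (unclaimed X h)"
        if "S \<in> legal_moves R b X h" for S
      proof -
        have "S \<subseteq> unclaimed X h" "min (bias b (turn h)) (card (unclaimed X h)) \<le> card S"
          using that R by (auto simp: legal_moves_def proper_rule_def)
        moreover have "bias b (turn h) \<ge> 1" using b by (cases "turn h") auto
        moreover have "card (unclaimed X h) > 0" using False fin by (simp add: card_gt_0_iff)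
        ultimately have "S \<noteq> {}" "S \<subseteq> unclaimed X h" by auto
        then show ?thesis using fin by (intro psubset_card_mono) auto
      qed
      show False
      proof (cases "turn h")
        case Avoider
        have l: "\<sigma> h \<in> legal_moves R b X h"
          using \<sigma> less.prems False Avoider by (auto simp: winning_strategy_def)
        have "consistent_history R b X Avoider \<sigma> (h @ [\<sigma> h])"
          "consistent_history R b X Enforcer \<tau> (h @ [\<sigma> h])"
          using less.prems False Avoider l
          by (auto intro: consistent_history.intros)
        then show False using less.hyps[of "h @ [\<sigma> h]"] decr[OF l] by simp
      next
        case Enforcer
        have l: "\<tau> h \<in> legal_moves R b X h"
          using \<tau> less.prems False Enforcer by (auto simp: winning_strategy_def)
        have "consistent_history R b X Avoider \<sigma> (h @ [\<tau> h])"
          "consistent_history R b X Enforcer \<tau> (h @ [\<tau> h])"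
          using less.prems False Enforcer l
          by (auto intro: consistent_history.intros)
        then show False using less.hyps[of "h @ [\<tau> h]"] decr[OF l] by simp
      qed
    qed
  qed
  from this[of "[]"] show False by (auto intro: consistent_history.intros)
qed

text \<open>The same strategy works: a monotone move that is legal for \<open>b\<close> is legal for
  \<open>b'\<close>, and Avoider's options do not depend on the bias.\<close>

lemma enforcer_monotone_bias_mono:
  assumes "wins_game Enforcer monotone_moves b X F" and "b' \<le> b"
  shows "wins_game Enforcer monotone_moves b' X F"
proof -
  obtain \<tau> where \<tau>: "winning_strategy monotone_moves b X F Enforcer \<tau>"
    using assms by (auto simp: wins_game_def)
  have c: "consistent_history monotone_moves b X Enforcer \<tau> h"
    if "consistent_history monotone_moves b' X Enforcer \<tau> h" for h
    using that
  proof induction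
    case (opponent_move h S)
    then have "turn h = Avoider" by (cases "turn h") auto
    with opponent_move show ?case
      by (intro consistent_history.intros) (auto simp: legal_moves_def)
  qed (auto intro: consistent_history.intros)
  have "winning_strategy monotone_moves b' X F Enforcer \<tau>"
    unfolding winning_strategy_def
  proof (intro allI impI)
    fix h assume "consistent_history monotone_moves b' X Enforcer \<tau> h"
    from c[OF this] \<tau> have "(unclaimed X h \<noteq> {} \<and> turn h = Enforcer \<longrightarrow> \<tau> h \<in> legal_moves monotone_moves b X h) \<and>
        (unclaimed X h = {} \<longrightarrow> won_by Enforcer F h)" by (simp add: winning_strategy_def)
    with \<open>b' \<le> b\<close> show "(unclaimed X h \<noteq> {} \<and> turn h = Enforcer \<longrightarrow> \<tau> h \<in> legal_moves monotone_moves b' X h) \<and>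
        (unclaimed X h = {} \<longrightarrow> won_by Enforcer F h)"
      by (auto simp: legal_moves_def monotone_moves_def min_def split: if_splits)
  qed
  then show ?thesis by (auto simp: wins_game_def)
qed

section \<open>Degrees and stars in Avoider's graph\<close>

definition deg :: "nat set set \<Rightarrow> nat \<Rightarrow> nat" where
  "deg G v = card {e \<in> G. v \<in> e}"

lemma finite_complete_edges [simp]: "finite (complete_edges n)"
  by (rule finite_subset[of _ "Pow {..<n}"]) (auto simp: complete_edges_def)

lemma card_complete_edges: "card (complete_edges n) = n choose 2"
  unfolding complete_edges_def by (subst n_subsets) auto

lemma complete_edge_cases:
  assumes "e \<in> complete_edges n"
  obtains x y where "e = {x, y}" "x \<noteq> y" "x < n" "y < n"
  using assms by (auto simp: complete_edges_def card_2_iff)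

lemma deg_mono: "finite G' \<Longrightarrow> G \<subseteq> G' \<Longrightarrow> deg G v \<le> deg G' v"
  unfolding deg_def by (intro card_mono) auto

lemma deg_empty [simp]: "deg {} v = 0"
  by (simp add: deg_def)

lemma deg_Un_disjoint:
  assumes "finite G" "finite H" "G \<inter> H = {}"
  shows "deg (G \<union> H) v = deg G v + deg H v"
proof -
  have "{e \<in> G \<union> H. v \<in> e} = {e \<in> G. v \<in> e} \<union> {e \<in> H. v \<in> e}" by auto
  then show ?thesis unfolding deg_def using assms by (simp add: card_Un_disjoint disjoint_iff)
qed

lemma deg_eq_neighbours:
  assumes "G \<subseteq> complete_edges n"
  shows "deg G v = card {x. {v, x} \<in> G}"
proof -
  have "{e \<in> G. v \<in> e} = (\<lambda>x. {v, x}) ` {x. {v, x} \<in> G}"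
  proof (intro equalityI subsetI)
    fix e assume e: "e \<in> {e \<in> G. v \<in> e}"
    then have "e \<in> complete_edges n" using assms by blast
    then obtain x y where "e = {x, y}" by (rule complete_edge_cases)
    with e have "e = {v, x} \<or> e = {v, y}" by (auto simp: insert_commute)
    with e show "e \<in> (\<lambda>x. {v, x}) ` {x. {v, x} \<in> G}" by auto
  qed auto
  moreover have "inj_on (\<lambda>x. {v, x}) {x. {v, x} \<in> G}"
    by (auto simp: inj_on_def doubleton_eq_iff)
  ultimately show ?thesis by (simp add: deg_def card_image)
qed

lemma contains_star_iff:
  assumes G: "G \<subseteq> complete_edges n" and k: "k \<ge> 1"
  shows "(\<exists>T\<in>star_copies k n. T \<subseteq> G) \<longleftrightarrow> (\<exists>v. deg G v \<ge> k)"
proof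
  assume "\<exists>T\<in>star_copies k n. T \<subseteq> G"
  then obtain c L where L: "L \<subseteq> {..<n} - {c}" "card L = k" "(\<lambda>v. {c, v}) ` L \<subseteq> G"
    by (auto simp: star_copies_def)
  have "finite {x. {c, x} \<in> G}"
  proof (rule finite_subset[of _ "{..<n}"])
    show "{x. {c, x} \<in> G} \<subseteq> {..<n}" using G unfolding complete_edges_def by blast
  qed simp
  then have "card L \<le> card {x. {c, x} \<in> G}" using L by (intro card_mono) auto
  then show "\<exists>v. deg G v \<ge> k" using L deg_eq_neighbours[OF G] by metis
next
  assume "\<exists>v. deg G v \<ge> k"
  then obtain c where c: "card {x. {c, x} \<in> G} \<ge> k" using deg_eq_neighbours[OF G] by metis
  then obtain L where L: "L \<subseteq> {x. {c, x} \<in> G}" "card L = k"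
    by (meson obtain_subset_with_card_n)
  then have "L \<noteq> {}" using k by auto
  then obtain x where "x \<in> L" by blast
  then have "{c, x} \<in> complete_edges n" using L G by blast
  then have "c < n" by (simp add: complete_edges_def)
  moreover have "L \<subseteq> {..<n} - {c}"
  proof
    fix x assume "x \<in> L"
    then have "{c, x} \<in> complete_edges n" using L G by blast
    then show "x \<in> {..<n} - {c}" by (cases "x = c") (auto simp: complete_edges_def)
  qed
  ultimately show "\<exists>T\<in>star_copies k n. T \<subseteq> G"
    using L by (intro bexI[of _ "(\<lambda>v. {c, v}) ` L"]) (auto simp: star_copies_def)
qed

section \<open>Avoider's strategy\<close>

text \<open>These are the numbers \<open>a i\<close> of the overview.\<close>

definition high_count :: "nat \<Rightarrow> nat set set \<Rightarrow> nat \<Rightarrow> nat" where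
  "high_count n G i = card {v \<in> {..<n}. deg G v \<ge> i}"

lemma high_count_antimono: "i \<le> j \<Longrightarrow> high_count n G j \<le> high_count n G i"
  unfolding high_count_def by (intro card_mono) auto

lemma high_count_le: "high_count n G i \<le> n"
  unfolding high_count_def using card_mono[of "{..<n}" "{v \<in> {..<n}. deg G v \<ge> i}"] by auto

lemma card_edges_touching:
  assumes U: "U \<subseteq> complete_edges n" and W: "finite W" and touch: "\<And>e. e \<in> U \<Longrightarrow> e \<inter> W \<noteq> {}"
  shows "card U \<le> card W * n"
proof -
  have "U \<subseteq> (\<Union>v\<in>W. (\<lambda>x. {v, x}) ` {..<n})"
  proof
    fix e assume e: "e \<in> U"
    then have "e \<in> complete_edges n" using U by blast
    then obtain x y where xy: "e = {x, y}" "x < n" "y < n" by (rule complete_edge_cases)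
    moreover have "{y, x} = {x, y}" by auto
    ultimately show "e \<in> (\<Union>v\<in>W. (\<lambda>x. {v, x}) ` {..<n})" using touch[OF e] by fastforce
  qed
  then have "card U \<le> card (\<Union>v\<in>W. (\<lambda>x. {v, x}) ` {..<n})"
    using W by (intro card_mono) auto
  also have "\<dots> \<le> (\<Sum>v\<in>W. card ((\<lambda>x. {v, x}) ` {..<n}))" using W by (rule card_UN_le)
  also have "\<dots> \<le> (\<Sum>v\<in>W. n)"
    by (intro sum_mono) (use card_image_le[of "{..<n}"] in auto)
  finally show ?thesis by simp
qed

lemma deg_insert:
  assumes "finite G" "e \<notin> G"
  shows "deg (insert e G) v = deg G v + (if v \<in> e then 1 else 0)"
proof -
  have "deg (G \<union> {e}) v = deg G v + deg {e} v" using assms by (intro deg_Un_disjoint) auto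
  moreover have "{a. a = e \<and> v \<in> a} = (if v \<in> e then {e} else {})" by auto
  then have "deg {e} v = (if v \<in> e then 1 else 0)" unfolding deg_def by auto
  ultimately show ?thesis by simp
qed

lemma high_count_insert:
  assumes "finite G" "e \<notin> G" "e \<in> complete_edges n" and le: "\<And>v. v \<in> e \<Longrightarrow> deg G v \<le> j"
  shows "high_count n (insert e G) (Suc i) \<le> high_count n G (Suc i) + (if i \<le> j then 2 else 0)"
proof -
  have sub: "{v \<in> {..<n}. deg (insert e G) v \<ge> Suc i}
      \<subseteq> {v \<in> {..<n}. deg G v \<ge> Suc i} \<union> (if i \<le> j then e else {})"
    using le deg_insert[OF assms(1,2)] by (force split: if_splits)
  have e: "finite e" "card e = 2" using assms(3) by (auto simp: complete_edges_def card_2_iff)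
  have "high_count n (insert e G) (Suc i)
      \<le> card ({v \<in> {..<n}. deg G v \<ge> Suc i} \<union> (if i \<le> j then e else {}))"
    unfolding high_count_def using e sub by (intro card_mono) auto
  also have "\<dots> \<le> high_count n G (Suc i) + card (if i \<le> j then e else {})"
    unfolding high_count_def by (rule card_Un_le)
  finally show ?thesis using e by (auto split: if_splits)
qed

text \<open>\<open>Q\<close> carries what is known about the unclaimed set at Avoider's turns:
  nothing for large biases, the residue of its size in the strict game. \<open>key\<close> says that
  Avoider is never forced to touch a vertex of level \<open>k - 1\<close>.\<close>

lemma avoider_wins_star:
  fixes k n b :: nat and Q :: "nat set set \<Rightarrow> bool"
  defines "y \<equiv> \<lambda>i. real n * (2 * real n / real (b + 1)) ^ i"
  assumes R: "proper_rule R" and k: "k \<ge> 2"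
    and Q0: "Q (complete_edges n)"
    and Qstep: "\<And>U e T. Q U \<Longrightarrow> U \<subseteq> complete_edges n \<Longrightarrow> e \<in> U \<Longrightarrow> T \<in> R b (U - {e}) \<Longrightarrow> Q (U - {e} - T)"
    and key: "\<And>U. Q U \<Longrightarrow> U \<noteq> {} \<Longrightarrow> U \<subseteq> complete_edges n \<Longrightarrow>
      real n * y (k - 1) < real (card U) \<or> 2 * real n * y (k - 2) \<le> real (b + 1)"
  shows "wins_star_game Avoider R k n b"
proof -
  \<comment> \<open>A round that is not the last lowers \<open>2 * card U\<close> by at least
    \<open>2 * (b + 1)\<close> and creates at most two vertices of level \<open>i + 1\<close>, so
    the left side never grows. Zero is a separate case because nothing bounds \<open>card U\<close>
    before the first such vertex appears.\<close>
  define inv where "inv G U \<longleftrightarrow> Q U \<and> (\<forall>v. deg G v < k) \<and> (U \<noteq> {} \<longrightarrow> (\<forall>i. high_count n G (Suc i) = 0 \<or>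
     real (high_count n G (Suc i)) * real (b + 1) + 2 * real (card U) \<le> 2 * real n * y i))"
    for G U
  have y0: "y i \<ge> 0" for i unfolding y_def by simp
  have ySuc: "2 * real n * y i = real (b + 1) * y (Suc i)" for i
    unfolding y_def by simp
  show ?thesis
    unfolding wins_star_game_def
  proof (rule avoider_wins_by_invariant[OF R, where I = inv])
    show "inv {} (complete_edges n)" using Q0 k by (auto simp: inv_def high_count_def)
  next
    fix G assume "inv G {}" "position (complete_edges n) G {}"
    then show "\<not> (\<exists>T\<in>star_copies k n. T \<subseteq> G)"
      using contains_star_iff[of G n k] k by (auto simp: inv_def position_def not_le)
  next
    fix G U assume inv: "inv G U" and pos: "position (complete_edges n) G U" and ne: "U \<noteq> {}"
    have fG: "finite G" and fU: "finite U" and GX: "G \<subseteq> complete_edges n" and UX: "U \<subseteq> complete_edges n"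
      and disj: "G \<inter> U = {}"
      using pos by (auto simp: position_def intro: finite_subset[OF _ finite_complete_edges])
    have bound: "high_count n G (Suc i) = 0 \<or>
        real (high_count n G (Suc i)) * real (b + 1) + 2 * real (card U) \<le> 2 * real n * y i" for i
      using inv ne by (auto simp: inv_def)
    have cnt: "real (high_count n G i) \<le> y i" for i
    proof (cases i)
      case 0
      then show ?thesis using high_count_le[of n G 0] by (simp add: y_def)
    next
      case (Suc i')
      show ?thesis
      proof (cases "high_count n G (Suc i') = 0")
        case True
        then show ?thesis using y0 Suc by simp
      next
        case False
        then have "real (high_count n G (Suc i')) * real (b + 1) + 2 * real (card U) \<le> 2 * real n * y i'"
          using bound[of i'] by (elim disjE) (erule notE)
        also have "\<dots> = y (Suc i') * real (b + 1)" using ySuc[of i'] by (simp only: mult.commute)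
        finally have "real (high_count n G (Suc i')) * real (b + 1) \<le> y (Suc i') * real (b + 1)"
          by linarith
        then have "real (high_count n G (Suc i')) \<le> y (Suc i')" by (rule mult_right_le_imp_le) simp
        then show ?thesis using Suc by simp
      qed
    qed
    define M where "M e = Max (deg G ` e)" for e
    obtain e where e: "e \<in> U" and emin: "\<And>f. f \<in> U \<Longrightarrow> M e \<le> M f"
      using ex_min_if_finite[of "M ` U"] fU ne by (metis arg_min_if_finite(1) arg_min_least)
    define j where "j = M e"
    have edge: "finite f \<and> f \<noteq> {} \<and> f \<subseteq> {..<n}" if "f \<in> U" for f
      using that UX by (auto simp: complete_edges_def card_2_iff subset_iff)
    have ej: "deg G v \<le> j" if "v \<in> e" for v
      using that edge[OF e] by (auto simp: j_def M_def)
    have touch: "f \<inter> {v \<in> {..<n}. deg G v \<ge> j} \<noteq> {}" if f: "f \<in> U" for f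
    proof -
      have "M f \<in> deg G ` f" unfolding M_def using edge[OF f] by (intro Max_in) auto
      then show ?thesis using emin[OF f] edge[OF f] by (auto simp: j_def)
    qed
    have Uj: "card U \<le> high_count n G j * n"
      unfolding high_count_def using touch by (intro card_edges_touching[OF UX]) auto
    have Upos: "card U \<ge> 1" using fU ne by (simp add: Suc_leI card_gt_0_iff)
    have jk: "j \<le> k - 2"
    proof (rule ccontr)
      \<comment> \<open>Both alternatives of \<open>key\<close> fail: all unclaimed edges meet the
        at most \<open>y (k - 1)\<close> vertices of level \<open>k - 1\<close>, and as there is
        such a vertex, the invariant makes \<open>b + 1\<close> smaller than
        \<open>2 * n * y (k - 2)\<close>.\<close>
      assume "\<not> j \<le> k - 2"
      then have j: "k - 1 \<le> j" using k by simp
      have U1: "card U \<le> high_count n G (k - 1) * n"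
        using Uj high_count_antimono[OF j, of n G] by (meson le_trans mult_le_mono1)
      have pos: "high_count n G (k - 1) \<noteq> 0"
        using U1 Upos by (metis le_zero_eq mult_0 not_one_le_zero)
      have Sk: "Suc (k - 2) = k - 1" using k by simp
      have "real (high_count n G (k - 1)) * real (b + 1) + 2 * real (card U) \<le> 2 * real n * y (k - 2)"
        using bound[of "k - 2"] pos unfolding Sk by blast
      moreover have "real (b + 1) \<le> real (high_count n G (k - 1)) * real (b + 1)"
        using mult_right_mono[of 1 "real (high_count n G (k - 1))" "real (b + 1)"] pos by simp
      moreover have "1 \<le> real (card U)" using Upos by simp
      ultimately have 1: "\<not> 2 * real n * y (k - 2) \<le> real (b + 1)" by linarith
      have "real (card U) \<le> real (high_count n G (k - 1)) * real n"
        using U1 by (metis of_nat_le_iff of_nat_mult)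
      also have "\<dots> \<le> y (k - 1) * real n" using cnt by (intro mult_right_mono) auto
      finally have "\<not> real n * y (k - 1) < real (card U)" by (simp add: mult.commute)
      with 1 key[of U] inv ne UX show False by (auto simp: inv_def)
    qed
    have eG: "e \<notin> G" using e disj by auto
    have eX: "e \<in> complete_edges n" using e UX by auto
    have "inv (G \<union> {e}) (U - {e} - T)" if T: "T \<in> R b (U - {e})" for T
      unfolding inv_def
    proof (intro conjI allI impI)
      show "Q (U - {e} - T)" using Qstep[OF _ UX e T] inv by (auto simp: inv_def)
    next
      fix v
      have "deg G v < k" using inv by (auto simp: inv_def)
      then show "deg (G \<union> {e}) v < k"
        using deg_insert[OF fG eG, of v] ej[of v] jk k by auto
    next
      fix i assume ne': "U - {e} - T \<noteq> {}"
      have TU: "T \<subseteq> U - {e}" "min b (card (U - {e})) \<le> card T"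
        using T R by (auto simp: proper_rule_def)
      have "card (U - {e} - T) > 0" using ne' fU by (simp add: card_gt_0_iff)
      moreover have "card (U - {e} - T) = card U - 1 - card T"
        using TU fU e by (simp add: card_Diff_subset finite_subset)
      ultimately have cU: "card (U - {e} - T) + (b + 1) \<le> card U"
        using TU(2) e fU by (simp add: min_def split: if_splits)
      have cU': "real (card (U - {e} - T)) + real (b + 1) \<le> real (card U)"
        using cU by (metis of_nat_add of_nat_le_iff)
      have hi: "high_count n (G \<union> {e}) (Suc i) \<le> high_count n G (Suc i) + (if i \<le> j then 2 else 0)"
        using high_count_insert[OF fG eG eX ej] by simp
      show "high_count n (G \<union> {e}) (Suc i) = 0 \<or>
         real (high_count n (G \<union> {e}) (Suc i)) * real (b + 1) + 2 * real (card (U - {e} - T)) \<le> 2 * real n * y i"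
      proof (cases "i \<le> j")
        case False
        then have le: "high_count n (G \<union> {e}) (Suc i) \<le> high_count n G (Suc i)" using hi by simp
        then have le': "real (high_count n (G \<union> {e}) (Suc i)) * real (b + 1)
            \<le> real (high_count n G (Suc i)) * real (b + 1)"
          by (intro mult_right_mono) auto
        show ?thesis
        proof (cases "high_count n G (Suc i) = 0")
          case True
          then show ?thesis using le by simp
        next
          case False
          then have "real (high_count n G (Suc i)) * real (b + 1) + 2 * real (card U) \<le> 2 * real n * y i"
            using bound[of i] by (elim disjE) (erule notE)
          moreover have "0 \<le> real (b + 1)" by simp
          ultimately show ?thesis using le' cU' by linarith
        qed
      next
        case True
        then have "real (high_count n (G \<union> {e}) (Suc i)) \<le> real (high_count n G (Suc i)) + 2" using hi by simp
        then have h2: "real (high_count n (G \<union> {e}) (Suc i)) * real (b + 1)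
            \<le> (real (high_count n G (Suc i)) + 2) * real (b + 1)"
          by (intro mult_right_mono) auto
        show ?thesis
        proof (cases "high_count n G (Suc i) = 0")
          case False
          then show ?thesis using bound[of i] cU' h2 by (simp add: algebra_simps)
        next
          \<comment> \<open>The first vertices of level \<open>i + 1\<close> appear. The best edge
            has an end of level \<open>j \<ge> i\<close>, so every unclaimed edge meets a vertex of
            level at least \<open>i\<close>, and \<open>card U \<le> n * y i\<close> starts the
            inequality.\<close>
          case 0: True
          have "real (card U) \<le> real (high_count n G j) * real n"
            using Uj by (metis of_nat_le_iff of_nat_mult)
          also have "\<dots> \<le> y i * real n"
            using cnt[of i] high_count_antimono[OF True, of n G] by (intro mult_right_mono) linarith+
          finally have "2 * real (card U) \<le> 2 * real n * y i" by (simp add: mult.commute)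
          then show ?thesis using cU' h2 0 by (simp add: algebra_simps)
        qed
      qed
    qed
    moreover have "{e} \<in> R 1 U"
      using e Upos by (intro proper_rule_intro[OF R]) auto
    ultimately show "\<exists>S\<in>R 1 U. \<forall>T\<in>R b (U - S). inv (G \<union> S) (U - S - T)" by blast
  qed
qed

section \<open>The remainder of the number of edges, and Avoider's two winning conditions\<close>

lemma star_rem_props:
  assumes "n \<ge> 2"
  shows "1 \<le> star_rem n b" "star_rem n b \<le> b + 1" "[n choose 2 = star_rem n b] (mod (b + 1))"
proof -
  define N where "N = n choose 2"
  have "\<exists>!r. 1 \<le> r \<and> r \<le> b + 1 \<and> [N = r] (mod (b + 1))"
  proof
    show "1 \<le> (if N mod (b + 1) = 0 then b + 1 else N mod (b + 1)) \<and>
      (if N mod (b + 1) = 0 then b + 1 else N mod (b + 1)) \<le> b + 1 \<and>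
      [N = (if N mod (b + 1) = 0 then b + 1 else N mod (b + 1))] (mod (b + 1))"
    proof (cases "N mod (b + 1) = 0")
      case True
      then have "N mod (b + 1) = (b + 1) mod (b + 1)" by (metis mod_self)
      with True show ?thesis unfolding Cong.cong_def by (simp only: if_True) simp
    next
      case False
      then show ?thesis using mod_less_divisor[of "b + 1" N] unfolding Cong.cong_def
        by (simp only: if_False mod_mod_trivial) linarith
    qed
  next
    fix r assume r: "1 \<le> r \<and> r \<le> b + 1 \<and> [N = r] (mod (b + 1))"
    then show "r = (if N mod (b + 1) = 0 then b + 1 else N mod (b + 1))"
      by (cases "r = b + 1") (auto simp: Cong.cong_def)
  qed
  from theI'[OF this] show "1 \<le> star_rem n b" "star_rem n b \<le> b + 1"
    "[n choose 2 = star_rem n b] (mod (b + 1))"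
    unfolding star_rem_def N_def by auto
qed

lemma star_rem_eqI:
  assumes "1 \<le> r" "r \<le> b + 1" "n choose 2 = t * (b + 1) + r"
  shows "star_rem n b = r"
  unfolding star_rem_def
proof (rule the_equality)
  have "(t * (b + 1) + r) mod (b + 1) = r mod (b + 1)" by (metis mod_mult_self3)
  then show "1 \<le> r \<and> r \<le> b + 1 \<and> [n choose 2 = r] (mod (b + 1))"
    using assms unfolding Cong.cong_def by metis
  fix r' assume r': "1 \<le> r' \<and> r' \<le> b + 1 \<and> [n choose 2 = r'] (mod (b + 1))"
  then have "r' mod (b + 1) = r mod (b + 1)"
    using \<open>(t * (b + 1) + r) mod (b + 1) = r mod (b + 1)\<close> assms(3) unfolding Cong.cong_def by metis
  then show "r' = r" using r' assms(1,2) by (cases "r' = b + 1"; cases "r = b + 1") auto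
qed

text \<open>\<open>star_rem\<close> is the least positive representative of its class;
  \<open>u\<close> will be the number of unclaimed edges at a turn of Avoider.\<close>

lemma star_rem_le:
  assumes "n \<ge> 2" "u \<ge> 1" "n choose 2 = t * (b + 1) + u"
  shows "star_rem n b \<le> u"
proof (rule ccontr)
  assume *: "\<not> star_rem n b \<le> u"
  then have "u < star_rem n b" by simp
  moreover have "star_rem n b \<le> b + 1" using star_rem_props assms by blast
  ultimately have "u \<le> b + 1" by simp
  from star_rem_eqI[OF assms(2) this assms(3)] * show False by simp
qed

lemma avoider_wins_large_bias:
  assumes R: "proper_rule R" and k: "k \<ge> 2"
    and big: "2 * real n * (real n * (2 * real n / real (b + 1)) ^ (k - 2)) \<le> real (b + 1)"
  shows "wins_star_game Avoider R k n b"
  by (rule avoider_wins_star[OF R k, where Q = "\<lambda>_. True"]) (use big in auto)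

text \<open>A complete round removes exactly \<open>b + 1\<close> edges, so at each turn of Avoider
  at least \<open>star_rem n b\<close> edges are unclaimed, more than can meet the vertices of level
  \<open>k - 1\<close>. The alternative \<open>U = {}\<close> in \<open>Q\<close> absorbs a
  shortened last move of Enforcer.\<close>

lemma avoider_wins_strict_remainder:
  assumes k: "k \<ge> 2" and n: "n \<ge> 2"
    and big: "real n * (real n * (2 * real n / real (b + 1)) ^ (k - 1)) < real (star_rem n b)"
  shows "wins_star_game Avoider strict_moves k n b"
proof (rule avoider_wins_star[OF proper_rule_strict k, where Q = "\<lambda>U. U = {} \<or> (\<exists>t. n choose 2 = t * (b + 1) + card U)"])
  show "complete_edges n = {} \<or> (\<exists>t. n choose 2 = t * (b + 1) + card (complete_edges n))"
    by (intro disjI2 exI[of _ 0]) (simp add: card_complete_edges)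
next
  fix U e T
  assume Q: "U = {} \<or> (\<exists>t. n choose 2 = t * (b + 1) + card U)" and U: "U \<subseteq> complete_edges n"
    and e: "e \<in> U" and T: "T \<in> strict_moves b (U - {e})"
  have fU: "finite U" using U finite_complete_edges by (rule finite_subset)
  have T': "T \<subseteq> U - {e}" "card T = min b (card (U - {e}))" using T by (auto simp: strict_moves_def)
  show "U - {e} - T = {} \<or> (\<exists>t. n choose 2 = t * (b + 1) + card (U - {e} - T))"
  proof (cases "card (U - {e}) \<le> b")
    case True
    then have "T = U - {e}" using T' fU by (intro card_subset_eq) auto
    then show ?thesis by simp
  next
    case False
    then have "card (U - {e} - T) = card (U - {e}) - b"
      using T' fU by (subst card_Diff_subset) (auto intro: finite_subset)
    then have "card U = (b + 1) + card (U - {e} - T)" using e fU False by simp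
    moreover obtain t where "n choose 2 = t * (b + 1) + card U" using Q e by auto
    ultimately have "n choose 2 = Suc t * (b + 1) + card (U - {e} - T)" by simp
    then show ?thesis by blast
  qed
next
  fix U assume "U = {} \<or> (\<exists>t. n choose 2 = t * (b + 1) + card U)" "U \<noteq> {}" "U \<subseteq> complete_edges n"
  moreover then have "card U \<ge> 1" by (metis Suc_leI card_gt_0_iff finite_complete_edges finite_subset One_nat_def)
  ultimately have "star_rem n b \<le> card U" using star_rem_le[OF n] by blast
  then show "real n * (real n * (2 * real n / real (b + 1)) ^ (k - 1)) < real (card U)
     \<or> 2 * real n * (real n * (2 * real n / real (b + 1)) ^ (k - 2)) \<le> real (b + 1)"
    using big by linarith
qed

section \<open>Enforcer's strategy between two sets of vertices\<close>

lemma ex_bounded_distribution: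
  assumes "finite K" "\<beta> \<le> card K * c"
  shows "\<exists>t :: 'a \<Rightarrow> nat. (\<forall>v\<in>K. t v \<le> c) \<and> (\<Sum>v\<in>K. t v) = \<beta>"
  using assms
proof (induction arbitrary: \<beta> rule: finite_induct)
  case empty
  then show ?case by auto
next
  case (insert x K)
  define a where "a = min c \<beta>"
  have "\<beta> - a \<le> card K * c" using insert by (auto simp: a_def)
  then obtain t :: "'a \<Rightarrow> nat" where t: "\<forall>v\<in>K. t v \<le> c" "(\<Sum>v\<in>K. t v) = \<beta> - a" using insert.IH by blast
  have "(\<Sum>v\<in>K. (t(x := a)) v) = (\<Sum>v\<in>K. t v)" using insert.hyps by (intro sum.cong) auto
  then show ?case
    using t insert.hyps by (intro exI[of _ "t(x := a)"]) (auto simp: a_def)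
qed

text \<open>A vertex of the side \<open>A\<close> is represented by the number \<open>u\<close> of its unclaimed edges to the
  other side and by its level \<open>d\<close>; it is alive if \<open>u > 0\<close>. It is \<^emph>\<open>sound\<close> if Enforcer has claimed at
  most \<open>\<Delta>\<close> of its edges per unit of level. Since \<open>b\<close> edges rarely kill a whole number of vertices,
  a move leaves a set \<open>K\<close> of vertices of the lowest level \<open>j\<close> that are partly damaged. In a healthy
  state each of them becomes sound again as soon as Avoider raises it. In a remnant state \<open>K\<close>
  consists of the last vertices of level \<open>j\<close>, is written off in the potential, and is killed next.\<close>

definition sound :: "nat \<Rightarrow> nat \<Rightarrow> nat \<Rightarrow> nat \<Rightarrow> bool" where
  "sound M \<Delta> u d \<longleftrightarrow> M \<le> u + d * (\<Delta> + 1)"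

definition pot :: "real \<Rightarrow> 'a set \<Rightarrow> ('a \<Rightarrow> nat) \<Rightarrow> ('a \<Rightarrow> nat) \<Rightarrow> real" where
  "pot \<rho> A u d = (\<Sum>v\<in>A. \<rho> ^ d v * real (u v))"

definition healthy :: "nat \<Rightarrow> nat \<Rightarrow> nat \<Rightarrow> 'a set \<Rightarrow> nat \<Rightarrow> ('a \<Rightarrow> nat) \<Rightarrow> ('a \<Rightarrow> nat) \<Rightarrow> 'a set \<Rightarrow> bool" where
  "healthy M \<Delta> s A j u d K \<longleftrightarrow> K \<subseteq> A \<and> card K \<le> s \<and>
     (\<forall>v\<in>A - K. u v > 0 \<longrightarrow> sound M \<Delta> (u v) (d v) \<and> j \<le> d v) \<and>
     (\<forall>v\<in>K. u v > 0 \<longrightarrow> sound M \<Delta> (u v + \<Delta>) (d v) \<and> d v = j)"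

definition remnant :: "nat \<Rightarrow> nat \<Rightarrow> nat \<Rightarrow> 'a set \<Rightarrow> nat \<Rightarrow> ('a \<Rightarrow> nat) \<Rightarrow> ('a \<Rightarrow> nat) \<Rightarrow> 'a set \<Rightarrow> bool" where
  "remnant M \<Delta> s A j u d K \<longleftrightarrow> K \<subseteq> A \<and> card K \<le> s \<and>
     (\<forall>v\<in>A - K. u v > 0 \<longrightarrow> sound M \<Delta> (u v) (d v) \<and> Suc j \<le> d v)"

lemma pot_fun_upd:
  assumes "finite A" "v \<in> A" "c \<le> u v"
  shows "pot \<rho> A u d = pot \<rho> A (u(v := c)) d + \<rho> ^ d v * real (u v - c)"
proof -
  have "pot \<rho> A u d = \<rho> ^ d v * real (u v) + (\<Sum>x\<in>A - {v}. \<rho> ^ d x * real (u x))"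
    unfolding pot_def using assms by (simp add: sum.remove)
  moreover have "pot \<rho> A (u(v := c)) d = \<rho> ^ d v * real c + (\<Sum>x\<in>A - {v}. \<rho> ^ d x * real (u x))"
    unfolding pot_def using assms by (simp add: sum.remove)
  ultimately show ?thesis using assms by (simp add: of_nat_diff algebra_simps)
qed

text \<open>Enforcer kills vertices of the lowest level as long as his budget \<open>\<beta>\<close> allows. The rest is
  spread over \<open>s\<close> vertices, so that the vertex which Avoider raises next is only slightly damaged.\<close>

lemma spend_budget:
  fixes u d :: "'a \<Rightarrow> nat" and \<rho> :: real
  assumes A: "finite A" and \<rho>: "\<rho> \<ge> 1" and m: "\<And>v. v \<in> A \<Longrightarrow> u v \<le> m" and s: "m \<le> s * \<Delta>"
    and alive: "\<And>v. v \<in> A \<Longrightarrow> u v > 0 \<Longrightarrow> sound M \<Delta> (u v) (d v) \<and> i \<le> d v"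
  shows "\<exists>u'. (\<forall>v\<in>A. u' v \<le> u v) \<and>
    ((sum u A = sum u' A + \<beta> \<and> (\<exists>j K. i \<le> j \<and> j + 2 \<le> k \<and>
        (healthy M \<Delta> s A j u' d K \<and> pot \<rho> A u d \<le> pot \<rho> A u' d + real \<beta> * \<rho> ^ j \<or>
         remnant M \<Delta> s A j u' d K \<and> pot \<rho> A u d \<le> pot \<rho> (A - K) u' d + real (\<beta> + s * m) * \<rho> ^ j)))
     \<or> (sum u A \<le> sum u' A + \<beta> \<and> (\<forall>v\<in>A. u' v > 0 \<longrightarrow> k \<le> Suc (d v)) \<and>
        (if k \<le> Suc i then u' = u else pot \<rho> A u d \<le> pot \<rho> A u' d + real \<beta> * \<rho> ^ (k - 2))))"
  (is "\<exists>u'. ?P u i \<beta> u'")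
  using m alive
proof (induction "card {v \<in> A. u v > 0}" arbitrary: u i \<beta> rule: less_induct)
  case less
  define Al where "Al = {v \<in> A. u v > 0 \<and> Suc (d v) < k}"
  show ?case
  proof (cases "Al = {}")
    case True
    \<comment> \<open>All living vertices have level at least \<open>k - 1\<close>: Enforcer stops
      with budget left over, since every remaining edge is now a trap.\<close>
    have "?P u i \<beta> u" using True \<rho> by (auto simp: Al_def not_less)
    then show ?thesis by blast
  next
    case False
    have finAl: "finite Al" using A by (simp add: Al_def)
    define j where "j = Min (d ` Al)"
    have "j \<in> d ` Al" unfolding j_def using finAl False by (intro Min_in) auto
    then obtain v0 where v0: "v0 \<in> Al" "d v0 = j" by auto
    have ij: "i \<le> j" using v0 less.prems(2)[of v0] by (auto simp: Al_def)
    have jk: "j + 2 \<le> k" using v0 by (auto simp: Al_def)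
    have jmin: "j \<le> d v" if "v \<in> A" "u v > 0" for v
    proof (cases "v \<in> Al")
      case True
      then show ?thesis using finAl by (simp add: j_def)
    next
      case False
      then show ?thesis using that jk by (auto simp: Al_def)
    qed
    define L where "L = {v \<in> A. u v > 0 \<and> d v = j}"
    have v0L: "v0 \<in> L" using v0 by (auto simp: L_def Al_def)
    have finL: "finite L" using A by (simp add: L_def)
    show ?thesis
    proof (cases "\<exists>v\<in>L. u v \<le> \<beta>")
      case True
      then obtain v where v: "v \<in> A" "u v > 0" "d v = j" "u v \<le> \<beta>" by (auto simp: L_def)
      define u1 where "u1 = u(v := 0)"
      have c: "card {v \<in> A. u1 v > 0} < card {v \<in> A. u v > 0}"
        using A v by (intro psubset_card_mono) (auto simp: u1_def)
      have "\<exists>u'. ?P u1 j (\<beta> - u v) u'"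
      proof (rule less.hyps[OF c])
        show "u1 x \<le> m" if "x \<in> A" for x using less.prems(1)[OF that] by (simp add: u1_def)
        show "sound M \<Delta> (u1 x) (d x) \<and> j \<le> d x" if "x \<in> A" "u1 x > 0" for x
          using that less.prems(2)[of x] jmin[of x] by (auto simp: u1_def split: if_splits)
      qed
      then obtain u' where u': "?P u1 j (\<beta> - u v) u'" by blast
      have le: "\<forall>x\<in>A. u' x \<le> u x"
      proof
        fix x assume "x \<in> A"
        then have "u' x \<le> u1 x" using u' by blast
        then show "u' x \<le> u x" by (auto simp: u1_def split: if_splits)
      qed
      have sumu: "sum u A = sum u1 A + u v"
        using A v(1) by (simp add: u1_def sum.remove)
      have potu: "pot \<rho> A u d = pot \<rho> A u1 d + \<rho> ^ j * real (u v)"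
        using pot_fun_upd[OF A v(1), of 0 u \<rho> d] v(3) by (simp add: u1_def)
      \<comment> \<open>The whole move is priced at the level \<open>j'\<close> where it ends; edges
        taken earlier at lower levels weigh less because \<open>\<rho> \<ge> 1\<close>.\<close>
      have kill: "\<rho> ^ j * real (u v) \<le> \<rho> ^ j' * real (u v)" if "j \<le> j'" for j'
        using that \<rho> by (intro mult_right_mono power_increasing) auto
      have bu: "real (\<beta> - u v) = real \<beta> - real (u v)" using v(4) by (simp add: of_nat_diff)
      from u' consider
        (a) j' K where "sum u1 A = sum u' A + (\<beta> - u v)" "j \<le> j'" "j' + 2 \<le> k"
          "healthy M \<Delta> s A j' u' d K" "pot \<rho> A u1 d \<le> pot \<rho> A u' d + real (\<beta> - u v) * \<rho> ^ j'"
        | (b) j' K where "sum u1 A = sum u' A + (\<beta> - u v)" "j \<le> j'" "j' + 2 \<le> k"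
          "remnant M \<Delta> s A j' u' d K" "pot \<rho> A u1 d \<le> pot \<rho> (A - K) u' d + real (\<beta> - u v + s * m) * \<rho> ^ j'"
        | (c) "sum u1 A \<le> sum u' A + (\<beta> - u v)" "\<forall>x\<in>A. u' x > 0 \<longrightarrow> k \<le> Suc (d x)"
          "if k \<le> Suc j then u' = u1 else pot \<rho> A u1 d \<le> pot \<rho> A u' d + real (\<beta> - u v) * \<rho> ^ (k - 2)"
        by blast
      then have "?P u i \<beta> u'"
      proof cases
        case a
        have "pot \<rho> A u d \<le> pot \<rho> A u' d + real \<beta> * \<rho> ^ j'"
          using a(5) potu kill[OF a(2)] unfolding bu by (simp add: algebra_simps)
        moreover have "sum u A = sum u' A + \<beta>" using a(1) sumu v(4) by simp
        ultimately show ?thesis using a le ij by (meson le_trans)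
      next
        case b
        have "real (\<beta> - u v + s * m) = real \<beta> - real (u v) + real (s * m)" using bu by simp
        then have "pot \<rho> A u d \<le> pot \<rho> (A - K) u' d + real (\<beta> + s * m) * \<rho> ^ j'"
          using b(5) potu kill[OF b(2)] by (simp add: algebra_simps)
        moreover have "sum u A = sum u' A + \<beta>" using b(1) sumu v(4) by simp
        ultimately show ?thesis using b le ij by (meson le_trans)
      next
        case c
        have "\<not> k \<le> Suc j" using jk by simp
        moreover have "j \<le> k - 2" using jk by simp
        ultimately have "pot \<rho> A u d \<le> pot \<rho> A u' d + real \<beta> * \<rho> ^ (k - 2)"
          using c(3) potu kill[of "k - 2"] unfolding bu by (simp add: algebra_simps)
        moreover have "sum u A \<le> sum u' A + \<beta>" using c(1) sumu v(4) by simp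
        moreover have "\<not> k \<le> Suc i" using jk ij by simp
        ultimately show ?thesis using c(2) le by simp
      qed
      then show ?thesis by blast
    next
      case False
      then have big: "\<beta> < u v" if "v \<in> L" for v using that by (auto simp: not_le)
      show ?thesis
      proof (cases "card L \<le> s")
        case True
        \<comment> \<open>All of \<open>L\<close> becomes the remnant. As it is written off at the
          price \<open>s * m * \<rho> ^ j\<close>, any one of its vertices may absorb the rest of
          the budget.\<close>
        define u' where "u' = u(v0 := u v0 - \<beta>)"
        have v0A: "v0 \<in> A" using v0 by (simp add: Al_def)
        have "sum u A = u v0 + sum u (A - {v0})" "sum u' A = u v0 - \<beta> + sum u (A - {v0})"
          using A v0A by (simp_all add: u'_def sum.remove)
        then have "sum u A = sum u' A + \<beta>" using big[OF v0L] by simp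
        moreover have "\<forall>v\<in>A. u' v \<le> u v" by (simp add: u'_def)
        moreover have "remnant M \<Delta> s A j u' d L"
          unfolding remnant_def
        proof (intro conjI ballI impI)
          fix v assume v: "v \<in> A - L" "0 < u' v"
          then have "u' v = u v" using v0L by (auto simp: u'_def)
          with v less.prems(2)[of v] jmin[of v] show "sound M \<Delta> (u' v) (d v)" "Suc j \<le> d v"
            by (auto simp: L_def)
        qed (use True L_def in auto)
        moreover have "pot \<rho> A u d \<le> pot \<rho> (A - L) u' d + real (\<beta> + s * m) * \<rho> ^ j"
        proof -
          have "pot \<rho> A u d = pot \<rho> L u d + pot \<rho> (A - L) u d"
            unfolding pot_def using A by (subst sum.subset_diff[of L]) (auto simp: L_def)
          moreover have "pot \<rho> (A - L) u' d = pot \<rho> (A - L) u d"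
            unfolding pot_def using v0L by (intro sum.cong) (auto simp: u'_def)
          moreover have "pot \<rho> L u d \<le> (\<Sum>v\<in>L. \<rho> ^ j * real m)"
            unfolding pot_def using less.prems(1) \<rho> by (intro sum_mono mult_mono) (auto simp: L_def)
          moreover have "(\<Sum>v\<in>L. \<rho> ^ j * real m) = real (card L) * (real m * \<rho> ^ j)" by simp
          moreover have "real (card L) * (real m * \<rho> ^ j) \<le> real s * (real m * \<rho> ^ j)"
            using True \<rho> by (intro mult_right_mono) auto
          moreover have "0 \<le> real \<beta> * \<rho> ^ j" using \<rho> by simp
          ultimately show ?thesis by (simp add: algebra_simps)
        qed
        ultimately have "?P u i \<beta> u'" using ij jk by blast
        then show ?thesis by blast
      next
        case False
        then obtain K where K: "K \<subseteq> L" "card K = s" by (meson le_cases obtain_subset_with_card_n)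
        have finK: "finite K" using K finL finite_subset by auto
        \<comment> \<open>No vertex of \<open>L\<close> can be killed, so \<open>\<beta>\<close> is
          below \<open>m \<le> s * \<Delta>\<close>, and each vertex of \<open>K\<close> loses at
          most \<open>\<Delta>\<close> edges, a damage that one level repays.\<close>
        have "\<beta> \<le> card K * \<Delta>" using big[OF v0L] less.prems(1)[of v0] v0 s K by (auto simp: Al_def)
        then obtain t where t: "\<forall>v\<in>K. t v \<le> \<Delta>" "(\<Sum>v\<in>K. t v) = \<beta>"
          using ex_bounded_distribution[OF finK] by blast
        have tb: "t v \<le> u v" if "v \<in> K" for v
        proof -
          have "t v \<le> (\<Sum>v\<in>K. t v)" using that finK by (intro member_le_sum) auto
          then show ?thesis using t(2) big[of v] that K by auto
        qed
        define u' where "u' v = (if v \<in> K then u v - t v else u v)" for v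
        have KA: "K \<subseteq> A" using K by (auto simp: L_def)
        have uu: "u v = u' v + (if v \<in> K then t v else 0)" for v
          using tb by (auto simp: u'_def)
        have sK: "(\<Sum>v\<in>A. if v \<in> K then f v else 0) = (\<Sum>v\<in>K. f v)" for f :: "'a \<Rightarrow> 'b :: comm_monoid_add"
          using KA A by (simp add: sum.inter_restrict[symmetric] Int_absorb1)
        have "sum u A = sum u' A + \<beta>"
          unfolding uu[abs_def] sum.distrib sK t(2) ..
        moreover have "\<forall>v\<in>A. u' v \<le> u v" by (simp add: u'_def)
        moreover have "healthy M \<Delta> s A j u' d K"
          unfolding healthy_def
        proof (intro conjI ballI impI)
          fix v assume v: "v \<in> A - K" "0 < u' v"
          then have "u' v = u v" by (auto simp: u'_def)
          with v less.prems(2)[of v] jmin[of v] show "sound M \<Delta> (u' v) (d v)" "j \<le> d v" by auto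
        next
          fix v assume v: "v \<in> K" "0 < u' v"
          then have "v \<in> L" using K by auto
          then show "d v = j" by (simp add: L_def)
          have "sound M \<Delta> (u v) (d v)" using less.prems(2)[of v] \<open>v \<in> L\<close> by (auto simp: L_def)
          moreover have "u v \<le> u' v + \<Delta>" using uu[of v] t v by simp
          ultimately show "sound M \<Delta> (u' v + \<Delta>) (d v)" by (simp add: sound_def)
        qed (use K KA in auto)
        moreover have "pot \<rho> A u d \<le> pot \<rho> A u' d + real \<beta> * \<rho> ^ j"
        proof -
          have "pot \<rho> A u d = (\<Sum>v\<in>A. \<rho> ^ d v * real (u' v) + (if v \<in> K then \<rho> ^ j * real (t v) else 0))"
            unfolding pot_def
          proof (intro sum.cong refl)
            fix v assume "v \<in> A"
            show "\<rho> ^ d v * real (u v) = \<rho> ^ d v * real (u' v) + (if v \<in> K then \<rho> ^ j * real (t v) else 0)"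
              using uu[of v] K by (auto simp: L_def algebra_simps)
          qed
          also have "\<dots> = pot \<rho> A u' d + (\<Sum>v\<in>K. \<rho> ^ j * real (t v))"
            by (simp only: sum.distrib sK pot_def)
          also have "(\<Sum>v\<in>K. \<rho> ^ j * real (t v)) = \<rho> ^ j * real \<beta>"
            by (simp add: sum_distrib_left[symmetric] of_nat_sum[symmetric] t(2) del: of_nat_sum)
          finally show ?thesis by (simp add: mult.commute)
        qed
        ultimately have "?P u i \<beta> u'" using ij jk by blast
        then show ?thesis by blast
      qed
    qed
  qed
qed

text \<open>\<open>A\<close> is the living and \<open>D\<close> the dead side. With \<open>M\<close>
  unclaimed edges a vertex of level 0 is sound; \<open>k - 1\<close> levels at
  \<open>\<Delta> + 1\<close> edges each still leave it \<open>\<mu>\<close>. By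
  \<open>s * m \<le> b\<close> a single move can kill all partly damaged vertices.\<close>

locale two_sided =
  fixes n k b :: nat and A D :: "nat set" and M \<Delta> s m \<mu> :: nat and \<rho> P0 :: real
  assumes k: "k \<ge> 2"
    and A: "A \<subseteq> {..<n}" and D: "D \<subseteq> {..<n}" and AD: "A \<inter> D = {}"
    and cardD: "card D \<le> m" and spread: "m \<le> s * \<Delta>" and sm: "s * m \<le> b"
    and M: "(k - 1) * (\<Delta> + 1) + \<mu> \<le> M" and \<rho>1: "\<rho> \<ge> 1" and \<rho>\<mu>: "real b + 1 \<le> (\<rho> - 1) * real \<mu>"
begin

definition cross :: "nat \<Rightarrow> nat set set" where
  "cross v = (\<lambda>x. {v, x}) ` D"

definition free :: "nat set set \<Rightarrow> nat \<Rightarrow> nat" where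
  "free U v = card (U \<inter> cross v)"

text \<open>The potential guaranteed while the lowest level is \<open>j\<close>: each level up to
  \<open>j\<close> is charged one whole move and one written-off remnant.\<close>

definition threshold :: "nat \<Rightarrow> real" where
  "threshold j = P0 - real (b + s * m) * (\<Sum>l\<le>j. \<rho> ^ l)"

text \<open>The final guarantee, below all thresholds; the second \<open>s * m\<close> leaves room
  for the remnant at level \<open>k - 2\<close>, whose write-off is not yet contained in
  \<open>threshold (k - 2)\<close>.\<close>

definition Pmin :: real where
  "Pmin = P0 - real (b + 2 * s * m) * (\<Sum>l\<le>k - 2. \<rho> ^ l)"

text \<open>No level has been charged yet. Unclaimed edges outside the crossing pairs may still
  exist here, unlike in the states of \<open>safe\<close> that demand
  \<open>all_cross\<close>.\<close>

definition pre_safe :: "nat set set \<Rightarrow> nat set set \<Rightarrow> bool" where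
  "pre_safe G U \<longleftrightarrow> (\<forall>v\<in>A. free U v > 0 \<longrightarrow> sound M \<Delta> (free U v) (deg G v)) \<and> P0 \<le> pot \<rho> A (free U) (deg G)"

definition all_cross :: "nat set set \<Rightarrow> bool" where
  "all_cross U \<longleftrightarrow> U \<subseteq> (\<Union>v\<in>A. cross v)"

definition safe :: "nat set set \<Rightarrow> nat set set \<Rightarrow> bool" where
  "safe G U \<longleftrightarrow> pre_safe G U \<or> (all_cross U \<and> (\<exists>j K. j + 2 \<le> k \<and>
     (healthy M \<Delta> s A j (free U) (deg G) K \<and> threshold j \<le> pot \<rho> A (free U) (deg G) \<or>
      remnant M \<Delta> s A j (free U) (deg G) K \<and>
        threshold j - real (s * m) * \<rho> ^ j \<le> pot \<rho> (A - K) (free U) (deg G))))"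

definition doomed :: "nat set set \<Rightarrow> nat set set \<Rightarrow> bool" where
  "doomed G U \<longleftrightarrow> (\<forall>e\<in>U. \<exists>v\<in>e. k \<le> Suc (deg G v))"

text \<open>In the second alternative Enforcer stops early. Since \<open>doomed\<close> survives the
  removal of edges, the rest of the budget can be spent afterwards on arbitrary edges.
  \<open>\<beta>\<close> can be less than \<open>b\<close> because part of a move may already have
  been used elsewhere.\<close>

definition good_reply :: "nat set set \<Rightarrow> nat set set \<Rightarrow> nat \<Rightarrow> nat set set \<Rightarrow> bool" where
  "good_reply G U \<beta> T \<longleftrightarrow> T \<subseteq> U \<and> (card T = \<beta> \<and> safe G (U - T) \<or>
     card T \<le> \<beta> \<and> doomed G (U - T) \<and> Pmin \<le> \<rho> ^ (k - 1) * real (card (U - T)))"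

lemma finA [simp]: "finite A" and finD [simp]: "finite D"
  using A D finite_subset by blast+

lemma cross_disjoint: "v \<in> A \<Longrightarrow> w \<in> A \<Longrightarrow> v \<noteq> w \<Longrightarrow> cross v \<inter> cross w = {}"
  using AD by (auto simp: cross_def doubleton_eq_iff)

lemma finite_cross [simp]: "finite (cross v)"
  by (simp add: cross_def)

lemma free_le: "free U v \<le> m"
proof -
  have "free U v \<le> card (cross v)" unfolding free_def by (intro card_mono) auto
  also have "\<dots> \<le> card D" unfolding cross_def by (rule card_image_le) simp
  finally show ?thesis using cardD by simp
qed

lemma card_cross_part: "B \<subseteq> A \<Longrightarrow> card (U \<inter> (\<Union>v\<in>B. cross v)) = sum (free U) B"
proof -
  assume B: "B \<subseteq> A"
  then have fB: "finite B" using finA by (rule finite_subset)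
  have "U \<inter> (\<Union>v\<in>B. cross v) = (\<Union>v\<in>B. U \<inter> cross v)" by auto
  moreover have "card (\<Union>v\<in>B. U \<inter> cross v) = (\<Sum>v\<in>B. card (U \<inter> cross v))"
  proof (rule card_UN_disjoint[OF fB])
    show "\<forall>i\<in>B. finite (U \<inter> cross i)" by simp
    show "\<forall>i\<in>B. \<forall>j\<in>B. i \<noteq> j \<longrightarrow> (U \<inter> cross i) \<inter> (U \<inter> cross j) = {}"
      using cross_disjoint B by blast
  qed
  ultimately show ?thesis by (simp add: free_def)
qed

lemma card_all_cross: "all_cross U \<Longrightarrow> card U = sum (free U) A"
  using card_cross_part[of A U] by (simp add: all_cross_def Int_absorb2)

lemma sum_free_le: "finite U \<Longrightarrow> sum (free U) A \<le> card U"
  using card_cross_part[of A U] card_mono[of U "U \<inter> (\<Union>v\<in>A. cross v)"] by simp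

text \<open>The stars \<open>cross v\<close> with \<open>v \<in> A\<close> are pairwise disjoint, so
  edge counts can be prescribed independently; hence \<open>spend_budget\<close> may work with
  numbers only.\<close>

lemma realize:
  assumes "\<And>v. v \<in> A \<Longrightarrow> u' v \<le> free U v"
  shows "\<exists>T. T \<subseteq> U \<and> T \<subseteq> (\<Union>v\<in>A. cross v) \<and> (\<forall>v\<in>A. free (U - T) v = u' v) \<and> card T + sum u' A = sum (free U) A"
proof -
  have "\<forall>v\<in>A. \<exists>T. T \<subseteq> U \<inter> cross v \<and> card T = free U v - u' v"
    using obtain_subset_with_card_n[of _ "U \<inter> cross _"] by (metis diff_le_self free_def)
  then obtain t where t: "\<And>v. v \<in> A \<Longrightarrow> t v \<subseteq> U \<inter> cross v \<and> card (t v) = free U v - u' v" by metis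
  define T where "T = (\<Union>v\<in>A. t v)"
  have Tv: "T \<inter> cross v = t v" if "v \<in> A" for v
    using that t cross_disjoint unfolding T_def by blast
  have TU: "T \<subseteq> U" "T \<subseteq> (\<Union>v\<in>A. cross v)" using t by (auto simp: T_def)
  have free: "free (U - T) v = u' v" if "v \<in> A" for v
  proof -
    have "(U - T) \<inter> cross v = (U \<inter> cross v) - t v" using Tv[OF that] by auto
    then have "free (U - T) v = free U v - card (t v)"
      using t[OF that] by (simp add: free_def card_Diff_subset finite_subset[of "t v" "U \<inter> cross v"])
    then show ?thesis using t[OF that] assms[OF that] by simp
  qed
  have "card T = sum (free T) A" using TU by (intro card_all_cross) (simp add: all_cross_def)
  also have "\<dots> = (\<Sum>v\<in>A. free U v - u' v)"
    using Tv t by (intro sum.cong) (auto simp: free_def)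
  finally have "card T + sum u' A = (\<Sum>v\<in>A. (free U v - u' v) + u' v)" by (simp add: sum.distrib)
  also have "\<dots> = sum (free U) A" using assms by (intro sum.cong) auto
  finally show ?thesis using TU free by blast
qed

lemma pot_cong: "(\<And>v. v \<in> B \<Longrightarrow> u v = u' v) \<Longrightarrow> pot \<rho> B u d = pot \<rho> B u' d"
  unfolding pot_def by (intro sum.cong) auto

lemma healthy_cong:
  "(\<And>v. v \<in> A \<Longrightarrow> u v = u' v) \<Longrightarrow> healthy M \<Delta> s A j u' d K \<Longrightarrow> healthy M \<Delta> s A j u d K"
  by (auto simp: healthy_def subset_iff)

lemma remnant_cong:
  "(\<And>v. v \<in> A \<Longrightarrow> u v = u' v) \<Longrightarrow> remnant M \<Delta> s A j u' d K \<Longrightarrow> remnant M \<Delta> s A j u d K"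
  by (auto simp: remnant_def)

lemma pot_le_card:
  assumes "all_cross U" "\<And>v. deg G v < k"
  shows "pot \<rho> A (free U) (deg G) \<le> \<rho> ^ (k - 1) * real (card U)"
proof -
  have "pot \<rho> A (free U) (deg G) \<le> (\<Sum>v\<in>A. \<rho> ^ (k - 1) * real (free U v))"
    unfolding pot_def
  proof (intro sum_mono mult_right_mono power_increasing)
    show "deg G v \<le> k - 1" for v using assms(2)[of v] by simp
  qed (use \<rho>1 in auto)
  also have "\<dots> = \<rho> ^ (k - 1) * real (card U)"
    using card_all_cross[OF assms(1)] by (simp add: sum_distrib_left)
  finally show ?thesis .
qed

text \<open>\<open>K\<close> is left over from the previous move and is killed first;
  \<open>spend_budget\<close> then uses the rest on the other vertices. \<open>W\<close> is
  potential available without \<open>K\<close>, and \<open>Wj\<close> and \<open>Wk\<close> say that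
  it pays for this rest at whatever level the move ends.\<close>

lemma spend_on_edges:
  assumes cr: "all_cross U" and degk: "\<And>v. deg G v < k"
    and K: "K \<subseteq> A" and c: "sum (free U) K \<le> \<beta>"
    and alive: "\<And>v. v \<in> A - K \<Longrightarrow> free U v > 0 \<Longrightarrow> sound M \<Delta> (free U v) (deg G v) \<and> i \<le> deg G v"
    and W: "W \<le> pot \<rho> (A - K) (free U) (deg G)"
    and Wj: "\<And>j. i \<le> j \<Longrightarrow> j + 2 \<le> k \<Longrightarrow> threshold j + real (\<beta> - sum (free U) K) * \<rho> ^ j \<le> W"
    and Wk: "if k \<le> Suc i then Pmin \<le> W else Pmin + real (\<beta> - sum (free U) K) * \<rho> ^ (k - 2) \<le> W"
  shows "\<exists>T. good_reply G U \<beta> T"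
proof -
  define c where "c = sum (free U) K"
  define u where "u v = (if v \<in> K then 0 else free U v)" for v
  have sumu: "sum (free U) A = sum u A + c"
  proof -
    have "sum (free U) A = sum (free U) (A - K) + c"
      unfolding c_def using K by (intro sum.subset_diff) auto
    also have "sum (free U) (A - K) = sum u (A - K)" by (intro sum.cong) (auto simp: u_def)
    also have "\<dots> = sum u A" by (intro sum.mono_neutral_left) (auto simp: u_def)
    finally show ?thesis .
  qed
  have potu: "pot \<rho> A u (deg G) = pot \<rho> (A - K) (free U) (deg G)"
  proof -
    have "pot \<rho> (A - K) (free U) (deg G) = pot \<rho> (A - K) u (deg G)" by (intro pot_cong) (auto simp: u_def)
    also have "\<dots> = pot \<rho> A u (deg G)"
      unfolding pot_def by (intro sum.mono_neutral_left) (auto simp: u_def)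
    finally show ?thesis by simp
  qed
  have h1: "u v \<le> m" if "v \<in> A" for v using free_le by (auto simp: u_def)
  have h2: "sound M \<Delta> (u v) (deg G v) \<and> i \<le> deg G v" if "v \<in> A" "u v > 0" for v
    using alive[of v] that by (auto simp: u_def split: if_splits)
  define Q where "Q u' \<longleftrightarrow> (\<forall>v\<in>A. u' v \<le> u v) \<and> ((sum u A = sum u' A + (\<beta> - c) \<and> (\<exists>j K. i \<le> j \<and> j + 2 \<le> k \<and>
        (healthy M \<Delta> s A j u' (deg G) K \<and> pot \<rho> A u (deg G) \<le> pot \<rho> A u' (deg G) + real (\<beta> - c) * \<rho> ^ j \<or>
         remnant M \<Delta> s A j u' (deg G) K \<and> pot \<rho> A u (deg G) \<le> pot \<rho> (A - K) u' (deg G) + real (\<beta> - c + s * m) * \<rho> ^ j)))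
     \<or> (sum u A \<le> sum u' A + (\<beta> - c) \<and> (\<forall>v\<in>A. u' v > 0 \<longrightarrow> k \<le> Suc (deg G v)) \<and>
        (if k \<le> Suc i then u' = u else pot \<rho> A u (deg G) \<le> pot \<rho> A u' (deg G) + real (\<beta> - c) * \<rho> ^ (k - 2))))" for u'
  have "\<exists>u'. Q u'"
    unfolding Q_def by (rule spend_budget[OF finA \<rho>1 _ spread]) (use h1 h2 in auto)
  then obtain u' where Q: "Q u'" by blast
  then have le: "\<forall>v\<in>A. u' v \<le> u v" by (simp add: Q_def)
  have "u' v \<le> free U v" if "v \<in> A" for v
    using le that by (auto simp: u_def split: if_splits)
  then obtain T where T: "T \<subseteq> U" "T \<subseteq> (\<Union>v\<in>A. cross v)" "\<forall>v\<in>A. free (U - T) v = u' v"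
    "card T + sum u' A = sum (free U) A" using realize[of u' U] by blast
  have cr': "all_cross (U - T)" using cr by (auto simp: all_cross_def)
  have potT: "pot \<rho> B (free (U - T)) (deg G) = pot \<rho> B u' (deg G)" if "B \<subseteq> A" for B
    using T(3) that by (intro pot_cong) auto
  have W': "W \<le> pot \<rho> A u (deg G)" using W potu by simp
  have cb: "c \<le> \<beta>" using c by (simp add: c_def)
  from Q[unfolded Q_def] consider
    (a) j K' where "sum u A = sum u' A + (\<beta> - c)" "i \<le> j" "j + 2 \<le> k" "healthy M \<Delta> s A j u' (deg G) K'"
      "pot \<rho> A u (deg G) \<le> pot \<rho> A u' (deg G) + real (\<beta> - c) * \<rho> ^ j"
    | (b) j K' where "sum u A = sum u' A + (\<beta> - c)" "i \<le> j" "j + 2 \<le> k" "remnant M \<Delta> s A j u' (deg G) K'"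
      "pot \<rho> A u (deg G) \<le> pot \<rho> (A - K') u' (deg G) + real (\<beta> - c + s * m) * \<rho> ^ j"
    | (c) "sum u A \<le> sum u' A + (\<beta> - c)" "\<forall>v\<in>A. u' v > 0 \<longrightarrow> k \<le> Suc (deg G v)"
       "if k \<le> Suc i then u' = u else pot \<rho> A u (deg G) \<le> pot \<rho> A u' (deg G) + real (\<beta> - c) * \<rho> ^ (k - 2)"
    by blast
  then have "good_reply G U \<beta> T"
  proof cases
    case a
    have "card T = \<beta>" using a(1) T(4) sumu cb by simp
    moreover have "healthy M \<Delta> s A j (free (U - T)) (deg G) K'"
      using a(4) T(3) healthy_cong[of "free (U - T)" u'] by blast
    moreover have "threshold j \<le> pot \<rho> A (free (U - T)) (deg G)"
      using Wj[OF a(2,3)] a(5) W' potT[of A] by (simp add: c_def)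
    ultimately show ?thesis using T(1) cr' a(3) unfolding good_reply_def safe_def by blast
  next
    case b
    have "card T = \<beta>" using b(1) T(4) sumu cb by simp
    moreover have "remnant M \<Delta> s A j (free (U - T)) (deg G) K'"
      using b(4) T(3) remnant_cong[of "free (U - T)" u'] by blast
    moreover have "real (\<beta> - c + s * m) * \<rho> ^ j = real (\<beta> - c) * \<rho> ^ j + real (s * m) * \<rho> ^ j"
      by (simp add: distrib_right)
    then have "threshold j - real (s * m) * \<rho> ^ j \<le> pot \<rho> (A - K') (free (U - T)) (deg G)"
      using Wj[OF b(2,3)] b(5) W' potT[of "A - K'"] unfolding c_def by (smt (verit) Diff_subset)
    ultimately show ?thesis using T(1) cr' b(3) unfolding good_reply_def safe_def by blast
  next
    case c
    have "card T \<le> \<beta>" using c(1) T(4) sumu cb by simp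
    moreover have "doomed G (U - T)"
      unfolding doomed_def
    proof
      fix e assume e: "e \<in> U - T"
      then obtain v where v: "v \<in> A" "e \<in> cross v" using cr by (auto simp: all_cross_def)
      then have "free (U - T) v > 0" using e unfolding free_def by (auto simp: card_gt_0_iff)
      then have "k \<le> Suc (deg G v)" using c(2) T(3) v by auto
      moreover have "v \<in> e" using v by (auto simp: cross_def)
      ultimately show "\<exists>v\<in>e. k \<le> Suc (deg G v)" by blast
    qed
    moreover have "Pmin \<le> pot \<rho> A (free (U - T)) (deg G)"
    proof (cases "k \<le> Suc i")
      case True
      then show ?thesis using c(3) Wk W' potT[of A] by simp
    next
      case False
      then show ?thesis using c(3) Wk W' potT[of A] unfolding c_def by simp
    qed
    then have "Pmin \<le> \<rho> ^ (k - 1) * real (card (U - T))"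
      using pot_le_card[OF cr' degk] by linarith
    ultimately show ?thesis using T(1) unfolding good_reply_def by blast
  qed
  then show ?thesis by blast
qed

lemma threshold_0: "threshold j + real b * \<rho> ^ j \<le> P0"
proof -
  have "\<rho> ^ j \<le> (\<Sum>l\<le>j. \<rho> ^ l)" using \<rho>1 by (intro member_le_sum) auto
  then have "real b * \<rho> ^ j \<le> real (b + s * m) * (\<Sum>l\<le>j. \<rho> ^ l)" using \<rho>1 by (intro mult_mono) auto
  then show ?thesis by (simp add: threshold_def)
qed

text \<open>The gap pays, at the new level \<open>j\<close>, for a whole move and for one write-off
  of \<open>s\<close> vertices.\<close>

lemma threshold_less:
  assumes "i < j"
  shows "threshold j + real (b + s * m) * \<rho> ^ j \<le> threshold i"
proof -
  have "(\<Sum>l\<le>i. \<rho> ^ l) + \<rho> ^ j = (\<Sum>l\<in>insert j {..i}. \<rho> ^ l)" using assms by simp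
  also have "\<dots> \<le> (\<Sum>l\<le>j. \<rho> ^ l)" using assms \<rho>1 by (intro sum_mono2) auto
  finally have "real (b + s * m) * ((\<Sum>l\<le>i. \<rho> ^ l) + \<rho> ^ j) \<le> real (b + s * m) * (\<Sum>l\<le>j. \<rho> ^ l)"
    by (intro mult_left_mono) auto
  then show ?thesis by (simp add: threshold_def algebra_simps)
qed

lemma Pmin_le_threshold: "Pmin + real (s * m) * \<rho> ^ (k - 2) \<le> threshold (k - 2)"
proof -
  have "\<rho> ^ (k - 2) \<le> (\<Sum>l\<le>k - 2. \<rho> ^ l)" using \<rho>1 by (intro member_le_sum) auto
  then have "real (s * m) * \<rho> ^ (k - 2) \<le> real (s * m) * (\<Sum>l\<le>k - 2. \<rho> ^ l)" by (intro mult_left_mono) auto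
  then show ?thesis by (simp add: threshold_def Pmin_def algebra_simps)
qed

text \<open>Edges that do not join \<open>A\<close> to \<open>D\<close> carry no potential, so
  Enforcer uses them up first. When they run out, the crossing game starts with
  \<open>K = {}\<close>, and \<open>P0\<close> covers the first charge at any level.\<close>

lemma pre_safe_reply:
  assumes pos: "position (complete_edges n) G U" and pre: "pre_safe G U" and degk: "\<And>v. deg G v < k" and \<beta>: "\<beta> \<le> b"
  shows "\<exists>T. good_reply G U \<beta> T"
proof -
  have fU: "finite U" using pos by (auto simp: position_def intro: finite_subset[OF _ finite_complete_edges])
  define Q where "Q = U - (\<Union>v\<in>A. cross v)"
  have finQ: "finite Q" using fU by (simp add: Q_def)
  have freeQ: "free (U - Q') v = free U v" if "v \<in> A" "Q' \<subseteq> Q" for v Q'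
  proof -
    have "(U - Q') \<inter> cross v = U \<inter> cross v" using that by (auto simp: Q_def)
    then show ?thesis by (simp add: free_def)
  qed
  have preQ: "pre_safe G (U - Q')" if "Q' \<subseteq> Q" for Q'
    using pre freeQ[OF _ that] pot_cong[of A "free (U - Q')" "free U"] by (simp add: pre_safe_def)
  show ?thesis
  proof (cases "\<beta> \<le> card Q")
    case True
    then obtain T where "T \<subseteq> Q" "card T = \<beta>" by (meson obtain_subset_with_card_n)
    moreover then have "T \<subseteq> U" by (auto simp: Q_def)
    ultimately have "good_reply G U \<beta> T" using preQ[of T] by (auto simp: good_reply_def safe_def)
    then show ?thesis by blast
  next
    case False
    have pre': "pre_safe G (U - Q)" using preQ by simp
    have "\<exists>T. good_reply G (U - Q) (\<beta> - card Q) T"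
    proof (rule spend_on_edges[where K = "{}" and i = 0 and W = P0])
      show "all_cross (U - Q)" by (auto simp: all_cross_def Q_def)
      show "sound M \<Delta> (free (U - Q) v) (deg G v) \<and> 0 \<le> deg G v" if "v \<in> A - {}" "0 < free (U - Q) v" for v
        using pre' that by (auto simp: pre_safe_def)
      show "P0 \<le> pot \<rho> (A - {}) (free (U - Q)) (deg G)" using pre' by (simp add: pre_safe_def)
      have le: "real (\<beta> - card Q - sum (free (U - Q)) {}) * \<rho> ^ j \<le> real b * \<rho> ^ j" for j
        using \<beta> \<rho>1 by (intro mult_right_mono) auto
      show "threshold j + real (\<beta> - card Q - sum (free (U - Q)) {}) * \<rho> ^ j \<le> P0" for j
        using threshold_0[of j] le[of j] by linarith
      have "0 \<le> real (s * m) * \<rho> ^ (k - 2)" using \<rho>1 by simp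
      then show "if k \<le> Suc 0 then Pmin \<le> P0 else Pmin + real (\<beta> - card Q - sum (free (U - Q)) {}) * \<rho> ^ (k - 2) \<le> P0"
        using k threshold_0[of "k - 2"] le[of "k - 2"] Pmin_le_threshold by auto
    qed (use degk in auto)
    then obtain T where T: "good_reply G (U - Q) (\<beta> - card Q) T" by blast
    have "T \<subseteq> U - Q" using T by (simp add: good_reply_def)
    then have "card (T \<union> Q) = card T + card Q"
      using fU finQ by (intro card_Un_disjoint) (auto intro: finite_subset)
    moreover have "U - Q - T = U - (T \<union> Q)" by auto
    moreover have "Q \<subseteq> U" by (auto simp: Q_def)
    ultimately have "good_reply G U \<beta> (T \<union> Q)"
      using T False by (auto simp: good_reply_def)
    then show ?thesis by blast
  qed
qed

section \<open>Avoider's moves: soundness and gain of potential\<close>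

lemma sound_raise: "sound M \<Delta> u d \<Longrightarrow> x \<le> u \<Longrightarrow> d + x \<le> d' \<Longrightarrow> sound M \<Delta> (u - x) d'"
proof -
  assume a: "sound M \<Delta> u d" "x \<le> u" "d + x \<le> d'"
  have "(d + x) * (\<Delta> + 1) \<le> d' * (\<Delta> + 1)" using a(3) by (rule mult_le_mono1)
  moreover have "(d + x) * (\<Delta> + 1) = d * (\<Delta> + 1) + x * \<Delta> + x" by (simp add: algebra_simps)
  ultimately show ?thesis using a unfolding sound_def by linarith
qed

text \<open>A level credits \<open>\<Delta> + 1\<close> edges: one for the edge that Avoider claimed
  and \<open>\<Delta>\<close> for Enforcer's damage. So a single raise repairs a damaged
  vertex.\<close>

lemma sound_raise_damaged:
  "sound M \<Delta> (u + \<Delta>) d \<Longrightarrow> 1 \<le> x \<Longrightarrow> x \<le> u \<Longrightarrow> d + x \<le> d' \<Longrightarrow> sound M \<Delta> (u - x) d'"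
proof -
  assume a: "sound M \<Delta> (u + \<Delta>) d" "1 \<le> x" "x \<le> u" "d + x \<le> d'"
  have "(d + x) * (\<Delta> + 1) \<le> d' * (\<Delta> + 1)" using a(4) by (rule mult_le_mono1)
  moreover have "(d + x) * (\<Delta> + 1) = d * (\<Delta> + 1) + x * \<Delta> + x" by (simp add: algebra_simps)
  moreover have "1 * \<Delta> \<le> x * \<Delta>" using a(2) by (rule mult_le_mono1)
  ultimately show ?thesis using a unfolding sound_def by linarith
qed

lemma sound_ge: "sound M \<Delta> u d \<Longrightarrow> d < k \<Longrightarrow> \<mu> \<le> u"
proof -
  assume a: "sound M \<Delta> u d" "d < k"
  have "d * (\<Delta> + 1) \<le> (k - 1) * (\<Delta> + 1)" using a(2) by (intro mult_le_mono1) simp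
  then show ?thesis using a M unfolding sound_def by linarith
qed

text \<open>By Bernoulli \<open>\<rho> ^ x \<ge> 1 + x * (\<rho> - 1)\<close>, and
  \<open>\<rho> - 1\<close> times the at least \<open>\<mu>\<close> edges left is at least
  \<open>b + 1\<close>. So each claimed edge is replaced and \<open>b\<close> further edges of
  weight \<open>\<rho> ^ d\<close> are gained.\<close>

lemma raise_gain:
  assumes "sound M \<Delta> (u - x) d'" "d' < k" "x \<le> u" "d + x \<le> d'"
  shows "\<rho> ^ d * (real u + real x * real b) \<le> \<rho> ^ d' * real (u - x)"
proof -
  have "\<mu> \<le> u - x" using assms sound_ge by blast
  then have "(\<rho> - 1) * real \<mu> \<le> (\<rho> - 1) * real (u - x)" using \<rho>1 by (intro mult_left_mono) auto
  then have g: "real b + 1 \<le> (\<rho> - 1) * real (u - x)" using \<rho>\<mu> by linarith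
  have "real u + real x * real b = real (u - x) + real x * (real b + 1)"
    using assms by (simp add: of_nat_diff algebra_simps)
  also have "\<dots> \<le> real (u - x) + real x * ((\<rho> - 1) * real (u - x))"
    by (intro add_left_mono mult_left_mono g) simp
  also have "\<dots> = (1 + real x * (\<rho> - 1)) * real (u - x)" by (simp add: algebra_simps)
  also have "\<dots> \<le> \<rho> ^ x * real (u - x)"
    using Bernoulli_inequality[of "\<rho> - 1" x] \<rho>1 by (intro mult_right_mono) auto
  finally have "\<rho> ^ d * (real u + real x * real b) \<le> \<rho> ^ d * (\<rho> ^ x * real (u - x))"
    using \<rho>1 by (intro mult_left_mono) auto
  also have "\<dots> = \<rho> ^ (d + x) * real (u - x)" by (simp add: power_add)
  also have "\<dots> \<le> \<rho> ^ d' * real (u - x)"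
    using assms \<rho>1 by (intro mult_right_mono power_increasing) auto
  finally show ?thesis .
qed

text \<open>The state decides who pays for Enforcer's move: in a healthy state the gain from
  Avoider's raise pays at the unchanged level, in a remnant state the passage to a higher threshold
  does, and in a pre-safe state the uncharged part of \<open>P0\<close>.\<close>

lemma safe_reply:
  assumes pos: "position (complete_edges n) G U" and safe: "safe G U"
    and S: "S \<subseteq> U" "S \<noteq> {}" and degk: "\<And>v. deg (G \<union> S) v < k"
  shows "\<exists>T. good_reply (G \<union> S) (U - S) b T"
proof -
  have fU: "finite U" and fG: "finite G"
    using pos by (auto simp: position_def intro: finite_subset[OF _ finite_complete_edges])
  have fS: "finite S" using S fU finite_subset by blast
  define x where "x v = card (S \<inter> cross v)" for v
  have xle: "x v \<le> free U v" for v unfolding x_def free_def using S by (intro card_mono) auto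
  have freeS: "free (U - S) v = free U v - x v" for v
  proof -
    have "(U - S) \<inter> cross v = U \<inter> cross v - S \<inter> cross v" by auto
    then show ?thesis using S unfolding free_def x_def by (subst card_Diff_subset[symmetric]) auto
  qed
  have degS: "deg (G \<union> S) v = deg G v + deg S v" for v
    using pos S by (intro deg_Un_disjoint[OF fG fS]) (auto simp: position_def)
  have "x v \<le> deg S v" for v
    unfolding x_def deg_def using fS by (intro card_mono) (auto simp: cross_def)
  then have degx: "deg G v + x v \<le> deg (G \<union> S) v" for v using degS by simp
  have pos': "position (complete_edges n) (G \<union> S) (U - S)" using pos S by (auto simp: position_def)
  have keep: "\<rho> ^ deg G v * real (free U v) \<le> \<rho> ^ deg (G \<union> S) v * real (free (U - S) v)
        \<and> (free (U - S) v > 0 \<longrightarrow> sound M \<Delta> (free (U - S) v) (deg (G \<union> S) v))"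
    if "free U v > 0 \<longrightarrow> sound M \<Delta> (free U v) (deg G v)" for v
  proof (cases "free U v > 0")
    case True
    then have so: "sound M \<Delta> (free U v - x v) (deg (G \<union> S) v)" using that sound_raise xle degx by blast
    have "\<rho> ^ deg G v * real (free U v) \<le> \<rho> ^ deg G v * (real (free U v) + real (x v) * real b)"
      using \<rho>1 by (intro mult_left_mono) auto
    also have "\<dots> \<le> \<rho> ^ deg (G \<union> S) v * real (free (U - S) v)"
      using raise_gain[OF so degk xle degx] by (simp add: freeS)
    finally show ?thesis using so by (simp add: freeS)
  next
    case False
    then show ?thesis by (simp add: freeS)
  qed
  from safe consider (pre) "pre_safe G U"
    | (hea) j K where "all_cross U" "j + 2 \<le> k" "healthy M \<Delta> s A j (free U) (deg G) K" "threshold j \<le> pot \<rho> A (free U) (deg G)"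
    | (rem) j K where "all_cross U" "j + 2 \<le> k" "remnant M \<Delta> s A j (free U) (deg G) K"
        "threshold j - real (s * m) * \<rho> ^ j \<le> pot \<rho> (A - K) (free U) (deg G)"
    unfolding safe_def by blast
  then show ?thesis
  proof cases
    case pre
    have so: "free U v > 0 \<longrightarrow> sound M \<Delta> (free U v) (deg G v)" if "v \<in> A" for v
      using pre that by (auto simp: pre_safe_def)
    have "pot \<rho> A (free U) (deg G) \<le> pot \<rho> A (free (U - S)) (deg (G \<union> S))"
      unfolding pot_def using keep[OF so] by (intro sum_mono) auto
    then have "pre_safe (G \<union> S) (U - S)" using pre keep[OF so] by (auto simp: pre_safe_def)
    then show ?thesis using pre_safe_reply[OF pos' _ degk] by blast
  next
    case hea
    have K: "K \<subseteq> A" "card K \<le> s" using hea(3) by (auto simp: healthy_def)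
    have fK: "finite K" using K(1) finA by (rule finite_subset)
    \<comment> \<open>Damaged vertices that Avoider did not raise; those that he raised are sound
      again. Their at most \<open>s * m\<close> edges weigh \<open>\<rho> ^ j\<close> each, so the
      gain \<open>b * \<rho> ^ j\<close> pays for killing them and for the rest of the move.\<close>
    define K' where "K' = {v \<in> K. x v = 0}"
    define c where "c = sum (free (U - S)) K'"
    have cle: "c \<le> s * m"
    proof -
      have "c \<le> (\<Sum>v\<in>K'. m)" unfolding c_def by (intro sum_mono free_le)
      also have "\<dots> = card K' * m" by simp
      also have "\<dots> \<le> s * m"
        using K card_mono[OF fK, of K'] by (intro mult_le_mono1) (auto simp: K'_def)
      finally show ?thesis .
    qed
    have newsound: "sound M \<Delta> (free U v - x v) (deg (G \<union> S) v) \<and> j \<le> deg G v"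
      if "v \<in> A" "v \<notin> K'" "free U v > 0" for v
    proof (cases "v \<in> K")
      case True
      then have "x v \<ge> 1" using that by (auto simp: K'_def)
      moreover have "sound M \<Delta> (free U v + \<Delta>) (deg G v)" "deg G v = j"
        using True that hea(3) by (auto simp: healthy_def)
      ultimately show ?thesis using sound_raise_damaged xle degx by auto
    next
      case False
      then have "sound M \<Delta> (free U v) (deg G v)" "j \<le> deg G v"
        using that hea(3) by (auto simp: healthy_def)
      then show ?thesis using sound_raise xle degx by auto
    qed
    have term_gain: "\<rho> ^ deg G v * real (free U v) + real (x v) * real b * \<rho> ^ j
        \<le> (if v \<in> K' then \<rho> ^ j * real (free (U - S) v) else \<rho> ^ deg (G \<union> S) v * real (free (U - S) v))"
      if v: "v \<in> A" for v
    proof (cases "v \<in> K'")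
      case True
      then have "x v = 0" "v \<in> K" by (auto simp: K'_def)
      moreover have "deg G v = j" if "free U v > 0" using hea(3) \<open>v \<in> K\<close> that by (auto simp: healthy_def)
      ultimately show ?thesis using True by (cases "free U v > 0") (auto simp: freeS)
    next
      case False
      show ?thesis
      proof (cases "free U v > 0")
        case True
        have "real (x v) * real b * \<rho> ^ j \<le> real (x v) * real b * \<rho> ^ deg G v"
          using newsound[OF v False True] \<rho>1 by (intro mult_left_mono power_increasing) auto
        then have "\<rho> ^ deg G v * real (free U v) + real (x v) * real b * \<rho> ^ j
            \<le> \<rho> ^ deg G v * (real (free U v) + real (x v) * real b)" by (simp add: algebra_simps)
        also have "\<dots> \<le> \<rho> ^ deg (G \<union> S) v * real (free U v - x v)"
          using raise_gain newsound[OF v False True] degk xle degx by blast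
        finally show ?thesis using False by (simp add: freeS)
      next
        case f0: False
        then have "x v = 0" using xle[of v] by simp
        then show ?thesis using f0 False by (simp add: freeS)
      qed
    qed
    have x1: "1 \<le> (\<Sum>v\<in>A. real (x v))"
    proof -
      obtain e where e: "e \<in> S" using S by auto
      then obtain w where w: "w \<in> A" "e \<in> cross w" using S hea(1) by (auto simp: all_cross_def)
      then have "e \<in> S \<inter> cross w" using e by auto
      then have "x w \<noteq> 0" using fS by (auto simp: x_def)
      moreover have "real (x w) \<le> (\<Sum>v\<in>A. real (x v))" using w by (intro member_le_sum) auto
      ultimately show ?thesis by linarith
    qed
    have potgain: "pot \<rho> A (free U) (deg G) + real b * \<rho> ^ j
        \<le> pot \<rho> (A - K') (free (U - S)) (deg (G \<union> S)) + real c * \<rho> ^ j"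
    proof -
      have "1 * (real b * \<rho> ^ j) \<le> (\<Sum>v\<in>A. real (x v)) * (real b * \<rho> ^ j)"
        using x1 \<rho>1 by (intro mult_right_mono) auto
      then have "pot \<rho> A (free U) (deg G) + real b * \<rho> ^ j
          \<le> pot \<rho> A (free U) (deg G) + (\<Sum>v\<in>A. real (x v)) * (real b * \<rho> ^ j)" by linarith
      also have "\<dots> = (\<Sum>v\<in>A. \<rho> ^ deg G v * real (free U v) + real (x v) * real b * \<rho> ^ j)"
        unfolding pot_def by (simp add: sum.distrib sum_distrib_right mult.assoc)
      also have "\<dots> \<le> (\<Sum>v\<in>A. if v \<in> K' then \<rho> ^ j * real (free (U - S) v) else \<rho> ^ deg (G \<union> S) v * real (free (U - S) v))"
        by (intro sum_mono term_gain)
      also have "\<dots> = (\<Sum>v\<in>A - K'. if v \<in> K' then \<rho> ^ j * real (free (U - S) v) else \<rho> ^ deg (G \<union> S) v * real (free (U - S) v))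
          + (\<Sum>v\<in>K'. if v \<in> K' then \<rho> ^ j * real (free (U - S) v) else \<rho> ^ deg (G \<union> S) v * real (free (U - S) v))"
        using K by (intro sum.subset_diff) (auto simp: K'_def)
      also have "\<dots> = pot \<rho> (A - K') (free (U - S)) (deg (G \<union> S)) + (\<Sum>v\<in>K'. \<rho> ^ j * real (free (U - S) v))"
        unfolding pot_def by (intro arg_cong2[where f = "(+)"] sum.cong) auto
      also have "(\<Sum>v\<in>K'. \<rho> ^ j * real (free (U - S) v)) = real c * \<rho> ^ j"
        unfolding c_def by (simp add: sum_distrib_left mult.commute[of _ "\<rho> ^ j"])
      finally show ?thesis .
    qed
    define \<beta> where "\<beta> = b - c"
    have bc: "real \<beta> = real b - real c" using cle sm by (simp add: \<beta>_def of_nat_diff)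
    have W: "threshold j + real \<beta> * \<rho> ^ j \<le> pot \<rho> (A - K') (free (U - S)) (deg (G \<union> S))"
      using potgain hea(4) unfolding bc by (simp add: algebra_simps)
    have later: "threshold j' + real \<beta> * \<rho> ^ j' \<le> threshold j + real \<beta> * \<rho> ^ j" if "j \<le> j'" for j'
    proof (cases "j = j'")
      case False
      then have "threshold j' + real (b + s * m) * \<rho> ^ j' \<le> threshold j" using that by (intro threshold_less) simp
      moreover have "real \<beta> * \<rho> ^ j' \<le> real (b + s * m) * \<rho> ^ j'"
      proof (intro mult_right_mono)
        show "real \<beta> \<le> real (b + s * m)" by (simp only: of_nat_le_iff) (simp add: \<beta>_def)
      qed (use \<rho>1 in simp)
      moreover have "0 \<le> real \<beta> * \<rho> ^ j" using \<rho>1 by simp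
      ultimately show ?thesis by linarith
    qed simp
    show ?thesis
    proof (rule spend_on_edges[where K = K' and i = j and W = "threshold j + real \<beta> * \<rho> ^ j"])
      show "all_cross (U - S)" using hea(1) by (auto simp: all_cross_def)
      show "K' \<subseteq> A" using K by (auto simp: K'_def)
      show "sum (free (U - S)) K' \<le> b" using cle sm by (simp add: c_def)
      show "sound M \<Delta> (free (U - S) v) (deg (G \<union> S) v) \<and> j \<le> deg (G \<union> S) v"
        if "v \<in> A - K'" "0 < free (U - S) v" for v
        using newsound[of v] that degx[of v] by (auto simp: freeS)
      show "threshold j' + real (b - sum (free (U - S)) K') * \<rho> ^ j' \<le> threshold j + real \<beta> * \<rho> ^ j"
        if "j \<le> j'" for j' using later[OF that] by (simp add: \<beta>_def c_def)
      have "j \<le> k - 2" using hea(2) by simp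
      moreover have "0 \<le> real (s * m) * \<rho> ^ (k - 2)" using \<rho>1 by simp
      ultimately show "if k \<le> Suc j then Pmin \<le> threshold j + real \<beta> * \<rho> ^ j
          else Pmin + real (b - sum (free (U - S)) K') * \<rho> ^ (k - 2) \<le> threshold j + real \<beta> * \<rho> ^ j"
        using later[of "k - 2"] Pmin_le_threshold hea(2) by (auto simp: \<beta>_def c_def)
    qed (use degk W in auto)
  next
    case rem
    have K: "K \<subseteq> A" "card K \<le> s" using rem(3) by (auto simp: remnant_def)
    have so: "free U v > 0 \<longrightarrow> sound M \<Delta> (free U v) (deg G v)" if "v \<in> A - K" for v
      using rem(3) that by (auto simp: remnant_def)
    have "pot \<rho> (A - K) (free U) (deg G) \<le> pot \<rho> (A - K) (free (U - S)) (deg (G \<union> S))"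
      unfolding pot_def using keep[OF so] by (intro sum_mono) auto
    then have W: "threshold j - real (s * m) * \<rho> ^ j \<le> pot \<rho> (A - K) (free (U - S)) (deg (G \<union> S))"
      using rem(4) by linarith
    have c: "sum (free (U - S)) K \<le> b"
    proof -
      have "sum (free (U - S)) K \<le> (\<Sum>v\<in>K. m)" by (intro sum_mono free_le)
      also have "\<dots> = card K * m" by simp
      also have "\<dots> \<le> s * m" using K by (intro mult_le_mono1) simp
      finally show ?thesis using sm by simp
    qed
    \<comment> \<open>Killing the remnant costs no potential because it is already deducted. All
      other living vertices lie above level \<open>j\<close>, so the remaining edges are paid for by
      the step from \<open>threshold j\<close> to \<open>threshold j'\<close>.\<close>
    have later: "threshold j' + real (b - sum (free (U - S)) K) * \<rho> ^ j' \<le> threshold j - real (s * m) * \<rho> ^ j"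
      if "j < j'" for j'
    proof -
      have "threshold j' + real (b + s * m) * \<rho> ^ j' \<le> threshold j" using that by (intro threshold_less) simp
      moreover have "real (b - sum (free (U - S)) K) * \<rho> ^ j' \<le> real b * \<rho> ^ j'"
        using \<rho>1 by (intro mult_right_mono) auto
      moreover have "real (s * m) * \<rho> ^ j \<le> real (s * m) * \<rho> ^ j'"
        using \<rho>1 that by (intro mult_left_mono power_increasing) auto
      moreover have "real (b + s * m) * \<rho> ^ j' = real b * \<rho> ^ j' + real (s * m) * \<rho> ^ j'"
        by (simp add: distrib_right)
      ultimately show ?thesis by linarith
    qed
    show ?thesis
    proof (rule spend_on_edges[where K = K and i = "Suc j" and W = "threshold j - real (s * m) * \<rho> ^ j"])
      show "all_cross (U - S)" using rem(1) by (auto simp: all_cross_def)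
      show "sound M \<Delta> (free (U - S) v) (deg (G \<union> S) v) \<and> Suc j \<le> deg (G \<union> S) v"
        if "v \<in> A - K" "0 < free (U - S) v" for v
      proof -
        have "free U v > 0" using that(2) by (simp add: freeS)
        then have "Suc j \<le> deg G v" using that(1) rem(3) by (auto simp: remnant_def)
        then show ?thesis using keep[OF so[OF that(1)]] that degx[of v] by auto
      qed
      show "threshold j' + real (b - sum (free (U - S)) K) * \<rho> ^ j' \<le> threshold j - real (s * m) * \<rho> ^ j"
        if "Suc j \<le> j'" for j' using later that by simp
      show "if k \<le> Suc (Suc j) then Pmin \<le> threshold j - real (s * m) * \<rho> ^ j
          else Pmin + real (b - sum (free (U - S)) K) * \<rho> ^ (k - 2) \<le> threshold j - real (s * m) * \<rho> ^ j"
      proof (cases "k \<le> Suc (Suc j)")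
        case True
        then have "j = k - 2" using rem(2) by simp
        then show ?thesis using True Pmin_le_threshold by simp
      next
        case False
        have "0 \<le> real (s * m) * \<rho> ^ (k - 2)" using \<rho>1 by simp
        moreover have "j < k - 2" using False by simp
        ultimately show ?thesis using False later Pmin_le_threshold by (simp only: if_False) (smt (verit))
      qed
    qed (use degk W c K in auto)
  qed
qed

lemma safe_Pmin:
  assumes "safe G U"
  shows "Pmin \<le> pot \<rho> A (free U) (deg G)"
proof -
  have sub: "pot \<rho> B (free U) (deg G) \<le> pot \<rho> A (free U) (deg G)" if "B \<subseteq> A" for B
    unfolding pot_def using that \<rho>1 by (intro sum_mono2) auto
  have t: "Pmin + real (s * m) * \<rho> ^ j \<le> threshold j" if "j + 2 \<le> k" for j
  proof (cases "j = k - 2")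
    case True
    then show ?thesis using Pmin_le_threshold by simp
  next
    case False
    then have j: "j < k - 2" using that by simp
    have "real (s * m) * \<rho> ^ j \<le> real (b + s * m) * \<rho> ^ (k - 2)"
      using \<rho>1 j by (intro mult_mono power_increasing) auto
    moreover have "0 \<le> real (s * m) * \<rho> ^ (k - 2)" using \<rho>1 by simp
    ultimately show ?thesis using threshold_less[OF j] Pmin_le_threshold by linarith
  qed
  have nn: "0 \<le> real (s * m) * \<rho> ^ j" for j using \<rho>1 by simp
  have p0: "Pmin \<le> P0" unfolding Pmin_def using \<rho>1 by (simp add: sum_nonneg)
  from assms show ?thesis
    unfolding safe_def pre_safe_def
    using p0 t nn sub[OF Diff_subset] by (smt (verit, best))
qed

end

section \<open>Small biases by counting edges\<close>

lemma sum_deg: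
  assumes "G \<subseteq> complete_edges n"
  shows "(\<Sum>v<n. deg G v) = 2 * card G"
proof -
  have fG: "finite G" using assms finite_complete_edges by (rule finite_subset)
  have "(\<Sum>v<n. deg G v) = (\<Sum>v<n. \<Sum>e\<in>G. if v \<in> e then 1 else 0)"
    unfolding deg_def using fG by (intro sum.cong) (auto simp: sum.If_cases Int_def)
  also have "\<dots> = (\<Sum>e\<in>G. \<Sum>v<n. if v \<in> e then 1 else 0)" by (rule sum.swap)
  also have "\<dots> = (\<Sum>e\<in>G. 2)"
  proof (intro sum.cong refl)
    fix e assume "e \<in> G"
    then have e: "e \<subseteq> {..<n}" "card e = 2" using assms by (auto simp: complete_edges_def)
    then have "{..<n} \<inter> e = e" by auto
    then show "(\<Sum>v<n. if v \<in> e then 1 else 0) = (2::nat)" using e by (simp add: sum.If_cases)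
  qed
  finally show ?thesis by simp
qed

text \<open>Enforcer never takes more than \<open>b\<close> edges at once, so Avoider ends with at
  least a \<open>1 / (b + 1)\<close> fraction of all edges, and \<open>small\<close> makes his
  average degree exceed \<open>k - 1\<close>. Large moves of Avoider only help, so the invariant is
  an inequality.\<close>

lemma enforcer_wins_small_bias:
  assumes R: "proper_rule R" and k: "k \<ge> 1"
    and Ecard: "\<And>U. U \<subseteq> complete_edges n \<Longrightarrow> \<exists>T\<in>R b U. card T \<le> b"
    and small: "(b + 1) * (n * (k - 1)) < n * (n - 1)"
  shows "wins_star_game Enforcer R k n b"
  unfolding wins_star_game_def
proof (rule enforcer_wins_by_invariant[OF R, where J = "\<lambda>G U. n choose 2 \<le> card G * (b + 1) + card U"])
  show "n choose 2 \<le> card {} * (b + 1) + card (complete_edges n)" by (simp add: card_complete_edges)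
next
  fix G assume G: "n choose 2 \<le> card G * (b + 1) + card ({} :: nat set set)" "position (complete_edges n) G {}"
  have GX: "G \<subseteq> complete_edges n" using G(2) by (simp add: position_def)
  have "\<exists>v. k \<le> deg G v"
  proof (rule ccontr)
    assume "\<not> (\<exists>v. k \<le> deg G v)"
    then have "deg G v < k" for v by (simp add: not_le)
    then have d: "deg G v \<le> k - 1" for v by (metis Suc_pred' gr_implies_not0 less_Suc_eq_le not_gr_zero)
    have "2 * card G = (\<Sum>v<n. deg G v)" using sum_deg[OF GX] by simp
    also have "\<dots> \<le> (\<Sum>v<n. k - 1)" by (intro sum_mono d)
    finally have "2 * card G \<le> n * (k - 1)" by simp
    then have "(b + 1) * (2 * card G) \<le> (b + 1) * (n * (k - 1))" by (rule mult_le_mono2)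
    moreover have "2 * (n choose 2) = n * (n - 1)"
      unfolding choose_two by (intro dvd_mult_div_cancel) auto
    moreover have "2 * (n choose 2) \<le> (b + 1) * (2 * card G)" using G(1) by (simp add: algebra_simps)
    ultimately show False using small by linarith
  qed
  then show "\<exists>T\<in>star_copies k n. T \<subseteq> G" using contains_star_iff[OF GX k] by simp
next
  fix G U S
  assume J: "n choose 2 \<le> card G * (b + 1) + card U" and pos: "position (complete_edges n) G U"
    and ne: "U \<noteq> {}" and S: "S \<in> R 1 U"
  have fU: "finite U" and fG: "finite G"
    using pos by (auto simp: position_def intro: finite_subset[OF _ finite_complete_edges])
  have S': "S \<subseteq> U" "1 \<le> card S"
    using proper_rule_subset[OF R S] proper_rule_card[OF R S] ne fU card_gt_0_iff[of U] by auto
  obtain T where T: "T \<in> R b (U - S)" "card T \<le> b"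
    using Ecard[of "U - S"] pos by (auto simp: position_def)
  have "T \<subseteq> U - S" using T R proper_rule_subset by blast
  then have "card U = card S + card T + card (U - S - T)"
    using S'(1) fU card_mono[OF fU S'(1)] card_mono[of "U - S" T] card_Diff_subset[of S U]
      card_Diff_subset[of T "U - S"] finite_subset[of S U] finite_subset[of T "U - S"] by simp
  moreover have "card (G \<union> S) = card G + card S"
    using pos S' fU fG by (intro card_Un_disjoint) (auto simp: position_def intro: finite_subset)
  moreover have "card T \<le> card S * b" using T(2) S'(2) by (metis le_trans mult_le_mono1 mult_1)
  ultimately have "n choose 2 \<le> card (G \<union> S) * (b + 1) + card (U - S - T)"
    using J by (simp add: algebra_simps)
  then show "\<exists>T\<in>R b (U - S). n choose 2 \<le> card (G \<union> S) * (b + 1) + card (U - S - T)" using T by blast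
qed

section \<open>Endgames of the two-sided strategy\<close>

context two_sided
begin

lemma doomed_step:
  assumes "doomed G U" "position (complete_edges n) G U" "S \<subseteq> U" "S \<noteq> {}"
  shows "\<exists>v. k \<le> deg (G \<union> S) v"
proof -
  have fU: "finite U" and fG: "finite G"
    using assms(2) by (auto simp: position_def intro: finite_subset[OF _ finite_complete_edges])
  obtain e where e: "e \<in> S" using assms by auto
  then obtain v where v: "v \<in> e" "k \<le> Suc (deg G v)" using assms by (auto simp: doomed_def)
  have "e \<notin> G" using e assms by (auto simp: position_def)
  then have "deg (insert e G) v = Suc (deg G v)" using v deg_insert[OF fG] by simp
  moreover have "deg (insert e G) v \<le> deg (G \<union> S) v"
    using e fG fU finite_subset[OF assms(3)] by (intro deg_mono) auto
  ultimately show ?thesis using v(2) by (intro exI[of _ v]) simp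
qed

lemma safe_nonempty: "safe G U \<Longrightarrow> Pmin > 0 \<Longrightarrow> U \<noteq> {}"
  using safe_Pmin[of G U] by (auto simp: pot_def free_def)

text \<open>\<open>U \<noteq> {}\<close> matters since a doomed position is won only if Avoider has
  to move once more; the congruence links \<open>card U\<close> to \<open>star_rem\<close>.\<close>

definition strict_inv :: "nat set set \<Rightarrow> nat set set \<Rightarrow> bool" where
  "strict_inv G U \<longleftrightarrow> (\<exists>v. k \<le> deg G v) \<or>
     (\<exists>t. n choose 2 = t * (b + 1) + card U) \<and> U \<noteq> {} \<and> (safe G U \<or> doomed G U)"

text \<open>\<open>rem\<close> says that at least \<open>star_rem n b\<close> edges survive when the
  position becomes doomed. Then Enforcer can complete his move to exactly \<open>b\<close> edges and
  still leave one, and Avoider's next edge closes a star.\<close>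

lemma strict_reply:
  assumes n: "n \<ge> 2" and rem: "real (star_rem n b) * \<rho> ^ (k - 1) \<le> Pmin"
    and pos: "position (complete_edges n) G U" and t: "n choose 2 = t * (b + 1) + card U"
    and S: "S \<subseteq> U" "card S = 1" and T: "good_reply (G \<union> S) (U - S) b T"
  shows "\<exists>T\<in>strict_moves b (U - S). strict_inv (G \<union> S) (U - S - T)"
proof -
  have fU: "finite U" using pos by (auto simp: position_def intro: finite_subset[OF _ finite_complete_edges])
  define V where "V = U - S"
  have fV: "finite V" and cV: "card U = Suc (card V)"
    using fU S card_Diff_subset[of S U] card_mono[OF fU S(1)] finite_subset[OF S(1) fU] by (auto simp: V_def)
  have rem1: "star_rem n b \<ge> 1" using star_rem_props[OF n] by simp
  have \<rho>p: "\<rho> ^ (k - 1) > 0" using \<rho>1 by simp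
  have "0 < real (star_rem n b) * \<rho> ^ (k - 1)" using rem1 \<rho>p by simp
  then have Pp: "Pmin > 0" using rem by linarith
  have fin: "\<exists>T\<in>strict_moves b (U - S). strict_inv (G \<union> S) (U - S - T)"
    if T': "T' \<subseteq> V" "card T' = b" "V - T' \<noteq> {}" "safe (G \<union> S) (V - T') \<or> doomed (G \<union> S) (V - T')" for T'
  proof -
    have "card (V - T') + b = card V"
      using T' fV card_Diff_subset[of T' V] card_mono[OF fV T'(1)] finite_subset[OF T'(1) fV] by simp
    then have "n choose 2 = Suc t * (b + 1) + card (V - T')" using t cV by simp
    then have "strict_inv (G \<union> S) (V - T')" using T' unfolding strict_inv_def by blast
    moreover have "T' \<in> strict_moves b V" using T' card_mono[OF fV T'(1)] by (simp add: strict_moves_def)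
    ultimately show ?thesis unfolding V_def by blast
  qed
  from T have TV: "T \<subseteq> V" by (simp add: good_reply_def V_def)
  from T consider "card T = b" "safe (G \<union> S) (V - T)"
    | (d) "card T \<le> b" "doomed (G \<union> S) (V - T)" "Pmin \<le> \<rho> ^ (k - 1) * real (card (V - T))"
    unfolding good_reply_def V_def by blast
  then show ?thesis
  proof cases
    case 1
    then show ?thesis using fin[OF TV] safe_nonempty[OF _ Pp] by blast
  next
    case d
    have "real (star_rem n b) * \<rho> ^ (k - 1) \<le> real (card (V - T)) * \<rho> ^ (k - 1)"
      using d(3) rem by (simp add: mult.commute)
    then have "real (star_rem n b) \<le> real (card (V - T))" using \<rho>p by (rule mult_right_le_imp_le)
    then have ge: "star_rem n b \<le> card (V - T)" by simp
    have "card (V - T) \<le> card V" using fV by (intro card_mono) auto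
    \<comment> \<open>Otherwise Avoider has just moved from exactly \<open>star_rem n b\<close>
      edges, but at least that many are left in \<open>V - T\<close> after his move.\<close>
    have bV: "b < card V"
    proof (rule ccontr)
      assume "\<not> b < card V"
      then have "star_rem n b = card U" using t cV by (intro star_rem_eqI) auto
      then show False using ge \<open>card (V - T) \<le> card V\<close> cV by simp
    qed
    have cVT: "card (V - T) = card V - card T"
      using TV fV by (intro card_Diff_subset) (auto intro: finite_subset)
    then have "b - card T \<le> card (V - T)" using bV by simp
    then obtain T2 where T2: "T2 \<subseteq> V - T" "card T2 = b - card T"
      by (meson obtain_subset_with_card_n)
    have "card (T \<union> T2) = card T + card T2"
      using TV T2 fV by (intro card_Un_disjoint) (auto intro: finite_subset)
    then have c: "card (T \<union> T2) = b" using T2 d(1) by simp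
    have "V - (T \<union> T2) \<noteq> {}"
    proof
      assume "V - (T \<union> T2) = {}"
      then have "V \<subseteq> T \<union> T2" by auto
      then have "card V \<le> b" using c card_mono[of "T \<union> T2" V] TV T2 fV
        by (metis Diff_subset finite_UnI finite_subset subset_trans)
      then show False using bV by simp
    qed
    moreover have "doomed (G \<union> S) (V - (T \<union> T2))" using d(2) by (auto simp: doomed_def)
    ultimately show ?thesis using fin[of "T \<union> T2"] c TV T2 by blast
  qed
qed

lemma strict_inv_step:
  assumes n: "n \<ge> 2" and rem: "real (star_rem n b) * \<rho> ^ (k - 1) \<le> Pmin"
    and inv: "strict_inv G U" and pos: "position (complete_edges n) G U" and ne: "U \<noteq> {}"
    and S: "S \<in> strict_moves 1 U"
  shows "\<exists>T\<in>strict_moves b (U - S). strict_inv (G \<union> S) (U - S - T)"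
proof -
  have fU: "finite U" and fG: "finite G"
    using pos by (auto simp: position_def intro: finite_subset[OF _ finite_complete_edges])
  have "card U \<ge> 1" using fU ne by (simp add: Suc_leI card_gt_0_iff)
  then have S': "S \<subseteq> U" "card S = 1" using S by (auto simp: strict_moves_def)
  then have Sne: "S \<noteq> {}" by auto
  have any: "\<exists>T. T \<in> strict_moves b (U - S)"
    unfolding strict_moves_def using obtain_subset_with_card_n[of "min b (card (U - S))" "U - S"] by auto
  show ?thesis
  proof (cases "\<exists>v. k \<le> deg (G \<union> S) v")
    case True
    then show ?thesis using any by (auto simp: strict_inv_def)
  next
    case False
    then have dk: "deg (G \<union> S) v < k" for v by (simp add: not_le)
    have "deg G v \<le> deg (G \<union> S) v" for v
      using fG fU finite_subset[OF S'(1)] by (intro deg_mono) auto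
    then have "\<not> (\<exists>v. k \<le> deg G v)" using dk by (meson le_trans not_le)
    then obtain t where t: "n choose 2 = t * (b + 1) + card U" and sd: "safe G U \<or> doomed G U"
      using inv by (auto simp: strict_inv_def)
    have "safe G U" using sd doomed_step[OF _ pos S'(1) Sne] False by blast
    then obtain T where "good_reply (G \<union> S) (U - S) b T" using safe_reply[OF pos _ S'(1) Sne dk] by blast
    then show ?thesis using strict_reply[OF n rem pos t S'] by blast
  qed
qed

lemma strict_inv_final:
  assumes "strict_inv G {}" "position (complete_edges n) G {}"
  shows "\<exists>T\<in>star_copies k n. T \<subseteq> G"
  using assms contains_star_iff[of G n k] k by (auto simp: strict_inv_def position_def)

lemma enforcer_wins_strict:
  assumes n: "n \<ge> 2" and rem: "real (star_rem n b) * \<rho> ^ (k - 1) \<le> Pmin"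
    and init: "pre_safe {} (complete_edges n)"
  shows "wins_star_game Enforcer strict_moves k n b"
  unfolding wins_star_game_def
proof (rule enforcer_wins_by_invariant[OF proper_rule_strict, where J = strict_inv])
  have "(n choose 2) > 0" using n by simp
  then have "complete_edges n \<noteq> {}" by (metis card_complete_edges card.empty less_irrefl)
  moreover have "n choose 2 = 0 * (b + 1) + card (complete_edges n)" by (simp add: card_complete_edges)
  ultimately show "strict_inv {} (complete_edges n)"
    using init unfolding strict_inv_def safe_def by blast
qed (use strict_inv_step[OF n rem] strict_inv_final in auto)

definition monotone_inv :: "nat set set \<Rightarrow> nat set set \<Rightarrow> bool" where
  "monotone_inv G U \<longleftrightarrow> (\<exists>v. k \<le> deg G v) \<or> (doomed G U \<and> U \<noteq> {}) \<or>
     (safe G U \<and> (\<forall>e\<in>U. \<forall>v\<in>e. Suc (deg G v) < k))"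

text \<open>In the monotone game Enforcer may claim all edges but one as soon as some unclaimed edge
  meets a vertex of degree \<open>k - 1\<close>, so only states without such edges need a plan.\<close>

lemma enforcer_wins_monotone:
  assumes k3: "3 \<le> k" and big: "real (b + 1 + k * n) * \<rho> ^ (k - 2) \<le> Pmin"
    and init: "pre_safe {} (complete_edges n)"
  shows "wins_star_game Enforcer monotone_moves k n b"
proof -
  have Pp: "Pmin > 0"
  proof -
    have "0 < real (b + 1 + k * n)" by (simp only: of_nat_0_less_iff)
    then have "0 < real (b + 1 + k * n) * \<rho> ^ (k - 2)" using \<rho>1 by (intro mult_pos_pos) auto
    then show ?thesis using big by linarith
  qed
  show ?thesis
    unfolding wins_star_game_def
  proof (rule enforcer_wins_by_invariant[OF proper_rule_monotone,
        where J = monotone_inv])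
    show "monotone_inv {} (complete_edges n)"
      using init k3 by (auto simp: monotone_inv_def safe_def)
  next
    fix G assume G: "monotone_inv G {}" "position (complete_edges n) G {}"
    then have "\<exists>v. k \<le> deg G v"
      using safe_nonempty[of G "{}", OF _ Pp] by (auto simp: monotone_inv_def safe_def)
    then show "\<exists>T\<in>star_copies k n. T \<subseteq> G"
      using G(2) contains_star_iff[of G n k] k by (auto simp: position_def)
  next
    fix G U S
    assume inv: "monotone_inv G U" and pos: "position (complete_edges n) G U" and ne: "U \<noteq> {}"
      and S: "S \<in> monotone_moves 1 U"
    have fU: "finite U" and fG: "finite G"
      using pos by (auto simp: position_def intro: finite_subset[OF _ finite_complete_edges])
    have "card U \<ge> 1" using fU ne by (simp add: Suc_leI card_gt_0_iff)
    then have S': "S \<subseteq> U" "S \<noteq> {}" using S by (auto simp: monotone_moves_def)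
    have fS: "finite S" using S'(1) fU by (rule finite_subset)
    have any: "U - S \<in> monotone_moves b (U - S)" by (simp add: monotone_moves_def)
    show "\<exists>T\<in>monotone_moves b (U - S). monotone_inv (G \<union> S) (U - S - T)"
    proof (cases "\<exists>v. k \<le> deg (G \<union> S) v")
      case True
      then show ?thesis using any by (auto simp: monotone_inv_def)
    next
      case False
      then have dk: "deg (G \<union> S) v < k" for v by (simp add: not_le)
      have dG: "deg G v \<le> deg (G \<union> S) v" "deg S v \<le> deg (G \<union> S) v" for v
        using fG fS by (auto intro: deg_mono)
      then have "\<not> (\<exists>v. k \<le> deg G v)" using dk by (meson le_trans not_le)
      moreover have "\<not> doomed G U" using doomed_step[OF _ pos S'] False by blast
      ultimately have safe: "safe G U" and "\<forall>e\<in>U. \<forall>v\<in>e. Suc (deg G v) < k"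
        using inv by (auto simp: monotone_inv_def)
      then have low: "\<forall>e\<in>U. \<forall>v\<in>e. deg G v \<le> k - 2" by fastforce
      \<comment> \<open>Vertices with unclaimed edges have level at most \<open>k - 2\<close> here,
        so an edge weighs at most \<open>\<rho> ^ (k - 2)\<close>, and \<open>Pmin\<close> forces
        many unclaimed edges.\<close>
      have "pot \<rho> A (free U) (deg G) \<le> (\<Sum>v\<in>A. \<rho> ^ (k - 2) * real (free U v))"
        unfolding pot_def
      proof (intro sum_mono)
        fix v assume "v \<in> A"
        show "\<rho> ^ deg G v * real (free U v) \<le> \<rho> ^ (k - 2) * real (free U v)"
        proof (cases "free U v = 0")
          case False
          then obtain e where "e \<in> U" "e \<in> cross v" unfolding free_def by (metis IntD1 IntD2 card.empty ex_in_conv)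
          then have "deg G v \<le> k - 2" using low by (auto simp: cross_def)
          then show ?thesis using \<rho>1 by (intro mult_right_mono power_increasing) auto
        qed simp
      qed
      also have "\<dots> = \<rho> ^ (k - 2) * real (sum (free U) A)" by (simp add: sum_distrib_left)
      also have "\<dots> \<le> \<rho> ^ (k - 2) * real (card U)"
      proof (intro mult_left_mono)
        show "real (sum (free U) A) \<le> real (card U)" using sum_free_le[OF fU] by (simp only: of_nat_le_iff)
      qed (use \<rho>1 in simp)
      finally have "real (b + 1 + k * n) * \<rho> ^ (k - 2) \<le> real (card U) * \<rho> ^ (k - 2)"
        using safe_Pmin[OF safe] big by (simp add: mult.commute)
      then have "real (b + 1 + k * n) \<le> real (card U)"
        using \<rho>1 by (auto dest!: mult_right_le_imp_le)
      then have cU: "b + 1 + k * n \<le> card U" by (simp only: of_nat_le_iff)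
      \<comment> \<open>Avoider may claim many edges at once, but without a star not more than
        \<open>k * n\<close>. So at least \<open>b + 1\<close> edges remain, and leaving just one of
        them is a legal reply.\<close>
      have "2 * card S = (\<Sum>v<n. deg S v)" using S'(1) pos by (subst sum_deg) (auto simp: position_def)
      also have "\<dots> \<le> (\<Sum>v<n. k)" using dG(2) dk by (intro sum_mono) (meson le_trans less_imp_le)
      finally have "card S \<le> k * n" by (simp add: mult.commute)
      then have cV: "b + 1 \<le> card (U - S)" using cU S'(1) fS by (simp add: card_Diff_subset)
      show ?thesis
      proof (cases "\<exists>e\<in>U - S. \<exists>v\<in>e. k \<le> Suc (deg (G \<union> S) v)")
        case True
        then obtain e v where e: "e \<in> U - S" "v \<in> e" "k \<le> Suc (deg (G \<union> S) v)" by auto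
        define T where "T = U - S - {e}"
        have "card T \<ge> b" using cV e fU by (simp add: T_def)
        then have "T \<in> monotone_moves b (U - S)" by (auto simp: monotone_moves_def T_def)
        moreover have "U - S - T = {e}" using e by (auto simp: T_def)
        then have "monotone_inv (G \<union> S) (U - S - T)" using e by (auto simp: monotone_inv_def doomed_def)
        ultimately show ?thesis by blast
      next
        case low': False
        obtain T where T: "good_reply (G \<union> S) (U - S) b T" using safe_reply[OF pos safe S' dk] by blast
        \<comment> \<open>Stopping early cannot occur: a doomed set with an edge in it would contain
          an edge at level \<open>k - 1\<close>, which is the other case.\<close>
        have "\<not> (doomed (G \<union> S) (U - S - T) \<and> Pmin \<le> \<rho> ^ (k - 1) * real (card (U - S - T)))"
        proof
          assume a: "doomed (G \<union> S) (U - S - T) \<and> Pmin \<le> \<rho> ^ (k - 1) * real (card (U - S - T))"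
          then have "card (U - S - T) \<noteq> 0" using Pp by (intro notI) simp
          then have "U - S - T \<noteq> {}" by (intro notI) (simp only: card.empty)
          then obtain e where "e \<in> U - S - T" by blast
          then show False using a low' unfolding doomed_def by blast
        qed
        then have "card T = b" "safe (G \<union> S) (U - S - T)" "T \<subseteq> U - S" using T by (auto simp: good_reply_def)
        then have "T \<in> monotone_moves b (U - S)" "monotone_inv (G \<union> S) (U - S - T)"
          using low' by (auto simp: monotone_moves_def monotone_inv_def not_le)
        then show ?thesis by blast
      qed
    qed
  qed
qed

end

context two_sided
begin

text \<open>The geometric sum is at most \<open>\<rho> ^ (k - 1) / (\<rho> - 1)\<close>, and
  \<open>\<rho> - 1 = (b + 1) / \<mu>\<close>. So all passages between levels together cost only
  about \<open>c * \<mu>\<close> edges of the top weight \<open>\<rho> ^ (k - 1)\<close>.\<close>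

lemma Pmin_ge:
  assumes \<rho>: "\<rho> = 1 + real (b + 1) / real \<mu>" and \<mu>: "\<mu> > 0"
    and c: "real (b + 2 * s * m) \<le> c * real (b + 1)" "c \<ge> 0"
  shows "P0 - c * real \<mu> * \<rho> ^ (k - 1) \<le> Pmin"
proof -
  define \<Sigma> where "\<Sigma> = (\<Sum>l\<le>k - 2. \<rho> ^ l)"
  have \<Sigma>0: "\<Sigma> \<ge> 0" unfolding \<Sigma>_def using \<rho>1 by (intro sum_nonneg) auto
  have "(1 - \<rho>) * \<Sigma> = 1 - \<rho> ^ Suc (k - 2)" unfolding \<Sigma>_def by (rule sum_gp_basic)
  moreover have "Suc (k - 2) = k - 1" using k by simp
  ultimately have "(\<rho> - 1) * \<Sigma> \<le> \<rho> ^ (k - 1)" by (simp add: algebra_simps)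
  then have "real (b + 1) / real \<mu> * \<Sigma> \<le> \<rho> ^ (k - 1)" using \<rho> by simp
  then have *: "real (b + 1) * \<Sigma> \<le> real \<mu> * \<rho> ^ (k - 1)" using \<mu> by (simp add: field_simps)
  have "real (b + 2 * s * m) * \<Sigma> \<le> c * real (b + 1) * \<Sigma>" using c \<Sigma>0 by (intro mult_right_mono) auto
  also have "\<dots> \<le> c * (real \<mu> * \<rho> ^ (k - 1))"
    using * c(2) by (simp only: mult.assoc) (rule mult_left_mono)
  finally show ?thesis unfolding Pmin_def \<Sigma>_def by (simp add: mult.assoc)
qed

end

text \<open>All \<open>m ^ 2\<close> edges between two disjoint blocks are unclaimed at the start,
  which gives the initial potential. In the strict part the remainder is bounded only by
  \<open>b + 1\<close>, so every residue is covered.\<close>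

lemma enforcer_wins_two_blocks:
  fixes k n b m :: nat
  assumes k: "k \<ge> 3" and m: "8 * k \<le> m" and bm: "4 * k * m \<le> b" and mn: "2 * m \<le> n"
  shows "2 * real b * (5 * real b / real m) ^ (k - 1) \<le> real m ^ 2 \<Longrightarrow> wins_star_game Enforcer strict_moves k n b" (is "?s \<Longrightarrow> _")
    and "4 * (5 * real b / real m) ^ (k - 1) \<le> real m \<Longrightarrow> k * n \<le> b \<Longrightarrow> wins_star_game Enforcer monotone_moves k n b"
proof -
  \<comment> \<open>With \<open>\<Delta>\<close> about \<open>m / (4 * k)\<close>, the damage of
    \<open>k - 1\<close> levels uses at most half of the \<open>m\<close> edges at a vertex;
    \<open>\<mu>\<close> is the other half.\<close>
  define \<mu> where "\<mu> = m div 2"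
  define \<Delta> where "\<Delta> = m div (4 * k) + 1"
  define \<rho> where "\<rho> = 1 + real (b + 1) / real \<mu>"
  have \<mu>0: "\<mu> > 0" using m k by (simp add: \<mu>_def)
  have \<mu>2: "real \<mu> \<le> real m / 2" unfolding \<mu>_def by linarith
  have m24: "m \<ge> 24" using m k by simp
  have \<mu>3: "real m / 3 \<le> real \<mu>" unfolding \<mu>_def using m24 by linarith
  interpret two_sided n k b "{..<m}" "{m..<2 * m}" m \<Delta> "4 * k" m \<mu> \<rho> "real m ^ 2"
  proof
    show "m \<le> 4 * k * \<Delta>"
      unfolding \<Delta>_def using k mult_div_mod_eq[of "4 * k" m] mod_less_divisor[of "4 * k" m]
      by (simp only: add_mult_distrib2) linarith
    have "4 * k * (m div (4 * k)) \<le> m" by simp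
    moreover have "4 * ((k - 1) * (m div (4 * k))) \<le> 4 * k * (m div (4 * k))" by simp
    ultimately have "4 * ((k - 1) * (m div (4 * k))) \<le> m" by linarith
    moreover have "(k - 1) * (\<Delta> + 1) = (k - 1) * (m div (4 * k)) + 2 * (k - 1)" by (simp add: \<Delta>_def)
    moreover have "2 * \<mu> \<le> m" by (simp add: \<mu>_def)
    moreover have "8 * (k - 1) \<le> m" using m by simp
    ultimately show "(k - 1) * (\<Delta> + 1) + \<mu> \<le> m" by linarith
    show "1 \<le> \<rho>" by (simp add: \<rho>_def)
    show "real b + 1 \<le> (\<rho> - 1) * real \<mu>" using \<mu>0 by (simp add: \<rho>_def)
  qed (use k bm mn in auto)
  have b0: "8 * m \<le> b"
  proof -
    have "8 * m \<le> 4 * k * m" using k by (intro mult_le_mono1) simp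
    then show ?thesis using bm by (rule le_trans)
  qed
  have free: "free (complete_edges n) v = m" if "v \<in> {..<m}" for v
  proof -
    have "cross v \<subseteq> complete_edges n"
      using that mn by (auto simp: cross_def complete_edges_def)
    then have "free (complete_edges n) v = card (cross v)" by (simp add: free_def Int_absorb1)
    also have "\<dots> = card {m..<2 * m}" unfolding cross_def
      by (intro card_image) (auto simp: inj_on_def doubleton_eq_iff)
    finally show ?thesis by simp
  qed
  have init: "pre_safe {} (complete_edges n)"
    unfolding pre_safe_def using free by (simp add: sound_def pot_def power2_eq_square)
  have "real (b + 2 * (4 * k) * m) \<le> 3 * real (b + 1)"
  proof -
    have "b + 2 * (4 * k) * m \<le> 3 * (b + 1)" using bm by simp
    then have "real (b + 2 * (4 * k) * m) \<le> real (3 * (b + 1))" by (simp only: of_nat_le_iff)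
    then show ?thesis by simp
  qed
  then have "real m ^ 2 - 3 * real \<mu> * \<rho> ^ (k - 1) \<le> Pmin"
    using Pmin_ge[OF \<rho>_def \<mu>0] by simp
  moreover have "3 * real \<mu> * \<rho> ^ (k - 1) \<le> 2 * real m * \<rho> ^ (k - 1)"
    using \<mu>2 \<rho>1 by (intro mult_right_mono) auto
  ultimately have P: "real m ^ 2 - 2 * real m * \<rho> ^ (k - 1) \<le> Pmin" by linarith
  have "real (b + 1) / real \<mu> \<le> real (b + 1) / (real m / 3)"
    using \<mu>3 m24 by (intro divide_left_mono) auto
  then have "\<rho> \<le> 1 + 3 * real (b + 1) / real m"
    by (simp add: \<rho>_def mult.commute)
  also have "\<dots> = (real m + 3 * real b + 3) / real m" using m24 by (simp add: field_simps)
  also have "\<dots> \<le> 5 * real b / real m" using b0 m24 by (intro divide_right_mono) auto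
  finally have "\<rho> ^ (k - 1) \<le> (5 * real b / real m) ^ (k - 1)" using \<rho>1 by (intro power_mono) auto
  note \<rho>k = this
  have \<rho>nn: "\<rho> ^ (k - 1) \<ge> 0" using \<rho>1 by simp
  show "wins_star_game Enforcer strict_moves k n b" if ?s
  proof (rule enforcer_wins_strict[OF _ _ init])
    have "star_rem n b \<le> b + 1" using star_rem_props mn m24 by simp
    then have "real (star_rem n b) + 2 * real m \<le> 2 * real b" using b0 m24 by simp
    then have "(real (star_rem n b) + 2 * real m) * \<rho> ^ (k - 1) \<le> 2 * real b * (5 * real b / real m) ^ (k - 1)"
      using \<rho>k \<rho>nn by (intro mult_mono) auto
    then show "real (star_rem n b) * \<rho> ^ (k - 1) \<le> Pmin" using P that by (simp add: algebra_simps)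
  qed (use mn m24 in simp)
  show "wins_star_game Enforcer monotone_moves k n b"
    if a: "4 * (5 * real b / real m) ^ (k - 1) \<le> real m" and kn: "k * n \<le> b"
  proof (rule enforcer_wins_monotone[OF assms(1) _ init])
    have "real (b + 1) = (\<rho> - 1) * real \<mu>" using \<mu>0 by (simp add: \<rho>_def)
    also have "\<dots> \<le> \<rho> * (real m / 2)" using \<mu>2 \<rho>1 by (intro mult_mono) auto
    finally have "2 * real (b + 1) \<le> \<rho> * real m" by simp
    moreover have "real (b + 1 + k * n) \<le> 2 * real (b + 1)"
    proof -
      have "b + 1 + k * n \<le> 2 * (b + 1)" using kn by simp
      then have "real (b + 1 + k * n) \<le> real (2 * (b + 1))" by (simp only: of_nat_le_iff)
      then show ?thesis by simp
    qed
    ultimately have "real (b + 1 + k * n) \<le> \<rho> * real m" by linarith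
    then have "real (b + 1 + k * n) * \<rho> ^ (k - 2) \<le> \<rho> * real m * \<rho> ^ (k - 2)"
      using \<rho>1 by (intro mult_right_mono) auto
    also have "\<dots> = real m * \<rho> ^ Suc (k - 2)" by simp
    also have "Suc (k - 2) = k - 1" using k by simp
    finally have 1: "real (b + 1 + k * n) * \<rho> ^ (k - 2) \<le> real m * \<rho> ^ (k - 1)" .
    have "4 * \<rho> ^ (k - 1) \<le> real m" using a \<rho>k by linarith
    then have "real m * (4 * \<rho> ^ (k - 1)) \<le> real m * real m" by (intro mult_left_mono) auto
    then have "4 * (real m * \<rho> ^ (k - 1)) \<le> real m ^ 2" by (simp add: power2_eq_square mult.left_commute)
    moreover have "0 \<le> real m * \<rho> ^ (k - 1)" using \<rho>nn by simp
    ultimately show "real (b + 1 + k * n) * \<rho> ^ (k - 2) \<le> Pmin" using 1 P by simp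
  qed
qed

section \<open>Enforcer's opening in the strict game\<close>

text \<open>\<open>T\<close> is what Enforcer claims, \<open>D'\<close> and \<open>F'\<close> are
  the dead and fresh vertices afterwards. Either the budget is used up, or the fresh vertices run
  out, possibly in the middle of a move.\<close>

definition fresh_split ::
    "nat \<Rightarrow> nat \<Rightarrow> nat set set \<Rightarrow> nat set \<Rightarrow> nat set \<Rightarrow> nat \<Rightarrow> nat set set \<Rightarrow> nat set \<Rightarrow> nat set \<Rightarrow> bool" where
  "fresh_split c f U Dd F \<beta> T D' F' \<longleftrightarrow> T \<subseteq> U \<and> D' \<union> F' = Dd \<union> F \<and> D' \<inter> F' = {} \<and>
     (\<forall>e\<in>U - T. \<not> e \<subseteq> D') \<and> (\<forall>e\<in>T. e \<subseteq> Dd \<union> F) \<and> (\<forall>v\<in>F'. deg T v \<le> c) \<and> F' \<subseteq> F \<and>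
     (card T = \<beta> \<and> f \<le> card F' \<or> card T \<le> \<beta> \<and> card F' < f)"

text \<open>A fresh vertex dies when its unclaimed edges to the dead set are claimed. If the budget
  kills none, it is below \<open>n \<le> f * c\<close>, so it can be spread over the at least
  \<open>f\<close> fresh vertices with at most \<open>c\<close> edges at each; these edge sets are
  disjoint because each edge contains exactly one fresh vertex.\<close>

lemma kill_fresh:
  assumes "finite F" "U \<subseteq> complete_edges n" "Dd \<inter> F = {}" "\<And>e. e \<in> U \<Longrightarrow> \<not> e \<subseteq> Dd"
    and fc: "n \<le> f * c" and f: "f \<ge> 1"
  shows "\<exists>T D' F'. fresh_split c f U Dd F \<beta> T D' F'"
  using assms(1-4)
proof (induction "card F" arbitrary: F U Dd \<beta> rule: less_induct)
  case less
  have fU: "finite U" using less.prems(2) finite_complete_edges by (rule finite_subset)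
  define C where "C v = {e \<in> U. e \<subseteq> insert v Dd}" for v
  have Cv: "v \<in> e" if "e \<in> C v" for e v using that less.prems(4)[of e] by (auto simp: C_def)
  have fC: "finite (C v)" for v using fU by (simp add: C_def)
  show ?case
  proof (cases "card F < f")
    case True
    then have "fresh_split c f U Dd F \<beta> {} Dd F" unfolding fresh_split_def using less.prems by auto
    then show ?thesis by blast
  next
    case F: False
    show ?thesis
    proof (cases "\<exists>v\<in>F. card (C v) \<le> \<beta>")
      case True
      then obtain v where v: "v \<in> F" "card (C v) \<le> \<beta>" by auto
      have c: "card (F - {v}) < card F" using v less.prems(1) by (intro psubset_card_mono) auto
      have "\<exists>T D' F'. fresh_split c f (U - C v) (insert v Dd) (F - {v}) (\<beta> - card (C v)) T D' F'"
      proof (rule less.hyps[OF c])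
        show "\<not> e \<subseteq> insert v Dd" if "e \<in> U - C v" for e using that by (auto simp: C_def)
        show "finite (F - {v})" using less.prems(1) by simp
        show "U - C v \<subseteq> complete_edges n" using less.prems(2) by blast
        show "insert v Dd \<inter> (F - {v}) = {}" using less.prems(3) by blast
      qed
      then obtain T D' F' where P: "fresh_split c f (U - C v) (insert v Dd) (F - {v}) (\<beta> - card (C v)) T D' F'" by blast
      note P = P[unfolded fresh_split_def]
      have TU: "T \<subseteq> U - C v" using P by blast
      have fT: "finite T" using TU fU by (meson finite_Diff finite_subset)
      have card: "card (T \<union> C v) = card T + card (C v)"
        using TU fC fT by (intro card_Un_disjoint) auto
      have un: "insert v Dd \<union> (F - {v}) = Dd \<union> F" using v by auto
      have "deg (T \<union> C v) w \<le> c" if w: "w \<in> F'" for w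
      proof -
        have "w \<in> F - {v}" using P w by blast
        then have "{e \<in> C v. w \<in> e} = {}" using less.prems(3) by (auto simp: C_def)
        then have "{e \<in> T \<union> C v. w \<in> e} = {e \<in> T. w \<in> e}" by auto
        then show ?thesis using P w by (auto simp: deg_def)
      qed
      moreover have "U - (T \<union> C v) = U - C v - T" by auto
      moreover have "\<forall>e\<in>T \<union> C v. e \<subseteq> Dd \<union> F" using P un v by (auto simp: C_def)
      moreover have "T \<union> C v \<subseteq> U" using TU by (auto simp: C_def)
      moreover have "card (T \<union> C v) = \<beta> \<and> f \<le> card F' \<or> card (T \<union> C v) \<le> \<beta> \<and> card F' < f"
        using P card v(2) by auto
      ultimately have "fresh_split c f U Dd F \<beta> (T \<union> C v) D' F'"
        unfolding fresh_split_def using P un by auto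
      then show ?thesis by blast
    next
      case False
      then have big: "\<beta> < card (C v)" if "v \<in> F" for v using that by (auto simp: not_le)
      have "\<beta> \<le> card F * c"
      proof -
        have "card F > 0" using F f by simp
        then obtain v where v: "v \<in> F" by (metis card.empty ex_in_conv less_irrefl)
        have "card (C v) \<le> card {v} * n"
          using less.prems(2) Cv by (intro card_edges_touching) (auto simp: C_def)
        also have "\<dots> \<le> f * c" using fc by simp
        also have "\<dots> \<le> card F * c" using F by (intro mult_le_mono1) simp
        finally show ?thesis using big[OF v] by simp
      qed
      then obtain t where t: "\<forall>v\<in>F. t v \<le> c" "(\<Sum>v\<in>F. t v) = \<beta>"
        using ex_bounded_distribution[OF less.prems(1)] by blast
      have "\<exists>Tv. Tv \<subseteq> C v \<and> card Tv = t v" if v: "v \<in> F" for v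
      proof -
        have "t v \<le> (\<Sum>v\<in>F. t v)" using v less.prems(1) by (intro member_le_sum) auto
        then have "t v \<le> card (C v)" using t(2) big[OF v] by simp
        then show ?thesis by (meson obtain_subset_with_card_n)
      qed
      then obtain Tv where Tv: "\<And>v. v \<in> F \<Longrightarrow> Tv v \<subseteq> C v \<and> card (Tv v) = t v" by metis
      define T where "T = (\<Union>v\<in>F. Tv v)"
      have disj: "C v \<inter> C w = {}" if "v \<in> F" "w \<in> F" "v \<noteq> w" for v w
        using that Cv[of _ v] Cv[of _ w] less.prems(3) by (auto simp: C_def)
      have "card T = (\<Sum>v\<in>F. card (Tv v))"
        unfolding T_def
      proof (rule card_UN_disjoint[OF less.prems(1)])
        show "\<forall>i\<in>F. finite (Tv i)" using Tv fC finite_subset by metis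
        show "\<forall>i\<in>F. \<forall>j\<in>F. i \<noteq> j \<longrightarrow> Tv i \<inter> Tv j = {}" using Tv disj by blast
      qed
      also have "\<dots> = \<beta>" using Tv t(2) by simp
      finally have cT: "card T = \<beta>" .
      have TU: "T \<subseteq> U" and TDF: "\<forall>e\<in>T. e \<subseteq> Dd \<union> F"
        unfolding T_def using Tv by (auto simp: C_def)
      have "deg T v \<le> c" if v: "v \<in> F" for v
      proof -
        have "{e \<in> T. v \<in> e} \<subseteq> Tv v"
        proof
          fix e assume "e \<in> {e \<in> T. v \<in> e}"
          then obtain w where w: "w \<in> F" "e \<in> Tv w" "v \<in> e" by (auto simp: T_def)
          then have "e \<subseteq> insert w Dd" using Tv by (auto simp: C_def)
          then have "v = w" using w v less.prems(3) by auto
          then show "e \<in> Tv v" using w by simp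
        qed
        moreover have "finite (Tv v)" using Tv[OF v] fC finite_subset by blast
        ultimately have "deg T v \<le> card (Tv v)" unfolding deg_def by (intro card_mono) auto
        then show ?thesis using Tv[OF v] t(1) v by (metis le_trans)
      qed
      then have "fresh_split c f U Dd F \<beta> T Dd F"
        unfolding fresh_split_def using cT TU TDF less.prems(3,4) F by auto
      then show ?thesis by blast
    qed
  qed
qed

lemma deg_complete:
  assumes "v < n"
  shows "deg (complete_edges n) v = n - 1"
proof -
  have "{x. {v, x} \<in> complete_edges n} = {..<n} - {v}"
  proof (intro equalityI subsetI)
    fix x assume x: "x \<in> {x. {v, x} \<in> complete_edges n}"
    then show "x \<in> {..<n} - {v}" by (cases "x = v") (auto simp: complete_edges_def)
  next
    fix x assume "x \<in> {..<n} - {v}"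
    then show "x \<in> {x. {v, x} \<in> complete_edges n}" using assms by (auto simp: complete_edges_def)
  qed
  then show ?thesis using deg_eq_neighbours[of "complete_edges n" n v] assms by simp
qed

lemma card_touched_le:
  assumes "G \<subseteq> complete_edges n" "W \<subseteq> {..<n}" "\<And>v. v \<in> W \<Longrightarrow> 1 \<le> deg G v"
  shows "card W \<le> 2 * card G"
proof -
  have "card W = (\<Sum>v\<in>W. 1)" by simp
  also have "\<dots> \<le> (\<Sum>v\<in>W. deg G v)" using assms(3) by (intro sum_mono)
  also have "\<dots> \<le> (\<Sum>v<n. deg G v)" using assms(2) by (intro sum_mono2) auto
  finally show ?thesis using sum_deg[OF assms(1)] by simp
qed

lemma card_complete_edges_inside:
  assumes "finite W" "W \<subseteq> {..<n}"
  shows "card {e \<in> complete_edges n. e \<subseteq> W} = card W choose 2"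
proof -
  have "{e \<in> complete_edges n. e \<subseteq> W} = {e. e \<subseteq> W \<and> card e = 2}"
    using assms by (auto simp: complete_edges_def)
  then show ?thesis using n_subsets[OF assms(1)] by simp
qed

text \<open>In the opening Enforcer kills vertices of level 0 only. In each move the rest of his budget
  is spread over the fresh vertices \<open>F\<close>, at most \<open>c\<close> edges at each. When fewer than \<open>f\<close> fresh
  vertices are left, Avoider has claimed between \<open>qmin\<close> and \<open>qmax\<close> edges, and the two-sided
  strategy starts with the living vertices of positive level against all others.\<close>

locale opening_phase =
  fixes n k b c f qmax qmin M \<Delta> s \<mu> :: nat and \<rho> P0 :: real
  assumes k: "k \<ge> 2" and n: "n \<ge> 2" and fc: "n \<le> f * c" and f: "f \<ge> 1"
    and qmax: "n choose 2 \<le> (qmax - 1) * (b + 1)"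
    and qmin: "qmin * (b + 1) \<le> (n - 2 * qmax - f) choose 2"
    and Mq: "M + (c + 2) * qmax \<le> n" and M1: "M \<ge> 1"
    and spread: "n \<le> s * \<Delta>" and sm: "s * n \<le> b"
    and M\<mu>: "(k - 1) * (\<Delta> + 1) + \<mu> \<le> M" and \<rho>2: "\<rho> \<ge> 2" and \<rho>\<mu>: "real b + 1 \<le> (\<rho> - 1) * real \<mu>"
    and P0: "P0 = real qmin * \<rho> * real \<mu>"
    and rem: "real (star_rem n b) * \<rho> ^ (k - 1) \<le> P0 - real (b + 2 * s * n) * (\<Sum>l\<le>k - 2. \<rho> ^ l)"
begin

text \<open>\<open>complete_edges n - G - U\<close> consists of Enforcer's edges, and
  \<open>card G\<close> counts the rounds. Each edge of Avoider adds at least \<open>\<rho>\<close>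
  to the sum over the living vertices of positive level; this is the source of
  \<open>P0\<close>.\<close>

definition opening_state :: "nat set set \<Rightarrow> nat set set \<Rightarrow> nat set \<Rightarrow> nat set \<Rightarrow> bool" where
  "opening_state G U Dd F \<longleftrightarrow> Dd \<inter> F = {} \<and> Dd \<union> F \<subseteq> {..<n} \<and> (\<forall>e\<in>U. \<not> e \<subseteq> Dd) \<and>
     (\<forall>v\<in>F. deg G v = 0) \<and> (\<forall>v\<in>{..<n} - Dd - F. 1 \<le> deg G v) \<and>
     real (card G) * \<rho> \<le> (\<Sum>v\<in>{..<n} - Dd - F. \<rho> ^ deg G v) \<and>
     (\<forall>v\<in>{..<n} - Dd. deg (complete_edges n - G - U) v \<le> c * card G) \<and>
     card U + card G * (b + 1) = n choose 2 \<and> f \<le> card F"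

text \<open>The sides depend on the course of the opening, hence the quantifier over
  \<open>A\<close> and \<open>D\<close>; all numerical parameters are fixed beforehand.\<close>

definition main_state :: "nat set set \<Rightarrow> nat set set \<Rightarrow> bool" where
  "main_state G U \<longleftrightarrow> (\<exists>A D. two_sided n k b A D M \<Delta> s n \<mu> \<rho> \<and>
     two_sided.strict_inv n k b A D M \<Delta> s n \<rho> P0 G U)"

lemma main_state_win: "\<exists>v. k \<le> deg G v \<Longrightarrow> main_state G U"
proof -
  assume v: "\<exists>v. k \<le> deg G v"
  interpret two_sided n k b "{}" "{}" M \<Delta> s n \<mu> \<rho> P0
    by unfold_locales (use k spread sm M\<mu> \<rho>2 \<rho>\<mu> in auto)
  have "strict_inv G U" using v by (simp add: strict_inv_def)
  then show ?thesis unfolding main_state_def using two_sided_axioms by blast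
qed

lemma main_state_step:
  assumes "main_state G U" "position (complete_edges n) G U" "U \<noteq> {}" "S \<in> strict_moves 1 U"
  shows "\<exists>T\<in>strict_moves b (U - S). main_state (G \<union> S) (U - S - T)"
proof -
  obtain A D where ts: "two_sided n k b A D M \<Delta> s n \<mu> \<rho>"
    "two_sided.strict_inv n k b A D M \<Delta> s n \<rho> P0 G U" using assms(1) by (auto simp: main_state_def)
  interpret two_sided n k b A D M \<Delta> s n \<mu> \<rho> P0 by (rule ts)
  have "real (star_rem n b) * \<rho> ^ (k - 1) \<le> Pmin" using rem by (simp add: Pmin_def)
  from strict_inv_step[OF n this ts(2) assms(2-4)] show ?thesis
    unfolding main_state_def using ts(1) by blast
qed

lemma qmax_pos: "qmax \<ge> 1"
proof -
  have "n choose 2 > 0" using n by simp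
  then have "0 < (qmax - 1) * (b + 1)" using qmax by linarith
  then show ?thesis by auto
qed

lemma opening_q:
  assumes "opening_state G U Dd F"
  shows "card G \<le> qmax - 1"
proof -
  have "card G * (b + 1) \<le> (qmax - 1) * (b + 1)" using assms qmax by (auto simp: opening_state_def)
  then show ?thesis by (simp only: mult_le_cancel2)
qed

text \<open>The game cannot end in the opening: a fresh vertex has no edge of Avoider and has lost
  at most \<open>c\<close> edges per round to Enforcer, fewer than its \<open>n - 1\<close> in
  total.\<close>

lemma opening_nonempty:
  assumes "opening_state G U Dd F" "position (complete_edges n) G U"
  shows "U \<noteq> {}"
proof
  assume U: "U = {}"
  have GX: "G \<subseteq> complete_edges n" using assms(2) by (simp add: position_def)
  have "card F > 0" using assms(1) f by (simp add: opening_state_def)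
  then obtain v where v: "v \<in> F" by (metis card.empty ex_in_conv less_irrefl)
  then have vn: "v < n" "v \<notin> Dd" and v0: "deg G v = 0" using assms(1) by (auto simp: opening_state_def)
  have "deg (complete_edges n) v = deg G v + deg (complete_edges n - G) v"
    using deg_Un_disjoint[of G "complete_edges n - G" v] GX finite_subset[OF GX]
    by (simp add: Un_absorb1)
  also have "\<dots> \<le> c * card G" using assms(1) vn v0 U by (auto simp: opening_state_def)
  finally have "n - 1 \<le> c * card G" using deg_complete[OF vn(1)] by simp
  also have "\<dots> \<le> c * qmax" using opening_q[OF assms(1)] by (intro mult_le_mono2) simp
  finally have "n \<le> c * qmax + 1" by simp
  moreover have "qmax \<ge> 1" by (rule qmax_pos)
  moreover have "(c + 2) * qmax = c * qmax + 2 * qmax" by (simp add: algebra_simps)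
  ultimately show False using Mq by linarith
qed

text \<open>A newly touched vertex enters the sum with at least \<open>\<rho>\<close>. One that
  already has level \<open>d \<ge> 1\<close> gains at least
  \<open>\<rho> ^ (d + 1) - \<rho> ^ d \<ge> \<rho>\<close>, which is where
  \<open>\<rho> \<ge> 2\<close> is used.\<close>

lemma opening_sum_raise:
  fixes d d' :: "nat \<Rightarrow> nat"
  assumes W: "finite W'" "W \<subseteq> W'" and le: "\<And>v. d v \<le> d' v" and d1: "\<And>v. v \<in> W' \<Longrightarrow> 1 \<le> d' v"
    and v: "v \<in> W'" "v \<in> W \<Longrightarrow> 1 \<le> d v \<and> d v < d' v"
  shows "(\<Sum>v\<in>W. \<rho> ^ d v) + \<rho> \<le> (\<Sum>v\<in>W'. \<rho> ^ d' v)"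
proof -
  have \<rho>1: "\<rho> \<ge> 1" using \<rho>2 by simp
  have fW: "finite W" using W finite_subset by blast
  have mono: "(\<Sum>v\<in>Z. \<rho> ^ d v) \<le> (\<Sum>v\<in>Z. \<rho> ^ d' v)" for Z
    using le \<rho>1 by (intro sum_mono power_increasing) auto
  show ?thesis
  proof (cases "v \<in> W")
    case False
    have "\<rho> = \<rho> ^ 1" by simp
    also have "\<dots> \<le> \<rho> ^ d' v" using d1[OF v(1)] \<rho>1 by (intro power_increasing) auto
    finally have "(\<Sum>v\<in>W. \<rho> ^ d v) + \<rho> \<le> (\<Sum>v\<in>W. \<rho> ^ d' v) + \<rho> ^ d' v" using mono[of W] by linarith
    also have "\<dots> = (\<Sum>v\<in>insert v W. \<rho> ^ d' v)" using False fW by simp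
    also have "\<dots> \<le> (\<Sum>v\<in>W'. \<rho> ^ d' v)" using W v(1) \<rho>1 by (intro sum_mono2) auto
    finally show ?thesis .
  next
    case True
    have dv: "1 \<le> d v" "Suc (d v) \<le> d' v" using v(2)[OF True] by auto
    have "\<rho> ^ 1 \<le> \<rho> ^ d v" using dv \<rho>1 by (intro power_increasing) auto
    moreover have "2 * \<rho> ^ d v \<le> \<rho> * \<rho> ^ d v" using \<rho>2 by (intro mult_right_mono) auto
    moreover have "\<rho> ^ Suc (d v) \<le> \<rho> ^ d' v" using dv \<rho>1 by (intro power_increasing) auto
    ultimately have *: "\<rho> ^ d v + \<rho> \<le> \<rho> ^ d' v" by simp
    have "(\<Sum>v\<in>W. \<rho> ^ d v) + \<rho> = (\<Sum>v\<in>W - {v}. \<rho> ^ d v) + \<rho> ^ d v + \<rho>"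
      using True fW by (simp add: sum.remove)
    also have "\<dots> \<le> (\<Sum>v\<in>W - {v}. \<rho> ^ d' v) + \<rho> ^ d' v" using * mono[of "W - {v}"] by linarith
    also have "\<dots> = (\<Sum>v\<in>W. \<rho> ^ d' v)" using True fW by (simp add: sum.remove)
    also have "\<dots> \<le> (\<Sum>v\<in>W'. \<rho> ^ d' v)" using W \<rho>1 by (intro sum_mono2) auto
    finally show ?thesis .
  qed
qed

lemma opening_step:
  assumes st: "opening_state G U Dd F" and pos: "position (complete_edges n) G U"
    and S: "S \<in> strict_moves 1 U" and ne: "U \<noteq> {}"
  shows "\<exists>T\<in>strict_moves b (U - S). main_state (G \<union> S) (U - S - T) \<or>
    (\<exists>Dd F. opening_state (G \<union> S) (U - S - T) Dd F)"
proof -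
  let ?X = "complete_edges n"
  have GX: "G \<subseteq> ?X" and UX: "U \<subseteq> ?X" and GU: "G \<inter> U = {}" using pos by (auto simp: position_def)
  have fU: "finite U" and fG: "finite G" using GX UX by (auto intro: finite_subset[OF _ finite_complete_edges])
  have "card U \<ge> 1" using fU ne by (simp add: Suc_leI card_gt_0_iff)
  then have S': "S \<subseteq> U" "card S = 1" using S by (auto simp: strict_moves_def)
  then obtain e where e: "S = {e}" by (auto simp: card_1_singleton_iff)
  have eU: "e \<in> U" using S' e by simp
  have eG: "e \<notin> G" using eU GU by auto
  have eX: "e \<in> ?X" using eU UX by auto
  define G' where "G' = G \<union> S"
  define U' where "U' = U - S"
  have G'X: "G' \<subseteq> ?X" and U'X: "U' \<subseteq> ?X" and fG': "finite G'" and fU': "finite U'"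
    using GX UX S' fG fU e by (auto simp: G'_def U'_def)
  have cG': "card G' = Suc (card G)" using eG fG e by (simp add: G'_def)
  have cU': "card U = Suc (card U')" using card_Suc_Diff1[OF fU eU] e by (simp only: U'_def)
  have degG': "deg G' v = deg G v + (if v \<in> e then 1 else 0)" for v
    using deg_insert[OF fG eG] e by (simp add: G'_def)
  have H: "?X - G' - U' = ?X - G - U" using eU e by (auto simp: G'_def U'_def)
  note st' = st[unfolded opening_state_def]
  define F1 where "F1 = F - e"
  define W where "W = {..<n} - Dd - F"
  define W1 where "W1 = {..<n} - Dd - F1"
  have WW1: "W \<subseteq> W1" by (auto simp: W_def W1_def F1_def)
  have W1deg: "1 \<le> deg G' v" if "v \<in> W1" for v
    using that st' degG'[of v] by (auto simp: W1_def F1_def)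
  \<comment> \<open>No unclaimed edge joins two dead vertices, so Avoider's edge has a living end
    \<open>v0\<close>, and that vertex provides the increase of the sum.\<close>
  have "\<not> e \<subseteq> Dd" using st' eU by blast
  then obtain v0 where v0: "v0 \<in> e" "v0 \<notin> Dd" by auto
  have v0n: "v0 < n" using v0 eX by (auto simp: complete_edges_def)
  have sumW: "real (card G') * \<rho> \<le> (\<Sum>v\<in>W1. \<rho> ^ deg G' v)"
  proof -
    have "(\<Sum>v\<in>W. \<rho> ^ deg G v) + \<rho> \<le> (\<Sum>v\<in>W1. \<rho> ^ deg G' v)"
    proof (rule opening_sum_raise[of W1 W _ _ v0])
      show "v0 \<in> W1" using v0 v0n by (auto simp: W1_def F1_def)
      show "1 \<le> deg G v0 \<and> deg G v0 < deg G' v0" if "v0 \<in> W" using that st' degG'[of v0] v0 by (auto simp: W_def)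
    qed (use WW1 W1deg degG' in \<open>auto simp: W1_def\<close>)
    moreover have "real (card G) * \<rho> \<le> (\<Sum>v\<in>W. \<rho> ^ deg G v)" using st' by (simp add: W_def)
    ultimately show ?thesis unfolding cG' by (simp add: algebra_simps)
  qed
  have DF1: "Dd \<union> F1 \<subseteq> {..<n}" "Dd \<inter> F1 = {}" using st' by (auto simp: F1_def)
  have fF1: "finite F1" using DF1 by (auto intro: finite_subset[of _ "{..<n}"])
  have "\<exists>T D' F'. fresh_split c f U' Dd F1 b T D' F'"
  proof (rule kill_fresh[OF fF1 U'X DF1(2) _ fc f])
    show "\<not> e \<subseteq> Dd" if "e \<in> U'" for e using st' that by (auto simp: U'_def)
  qed
  then obtain T D' F' where "fresh_split c f U' Dd F1 b T D' F'" by blast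
  note T = this[unfolded fresh_split_def]
  have TU: "T \<subseteq> U'" and TDF: "D' \<union> F' = Dd \<union> F1" and Tout: "\<forall>e\<in>U' - T. \<not> e \<subseteq> D'"
    using T by simp_all
  have fT: "finite T" using TU fU' by (rule finite_subset)
  have W1eq: "W1 = {..<n} - D' - F'" using T by (auto simp: W1_def)
  have F'F1: "F' \<subseteq> F1" using T by blast
  define H' where "H' = ?X - G' - (U' - T)"
  have H'eq: "H' = (?X - G - U) \<union> T" using H TU U'X GU e by (auto simp: H'_def G'_def U'_def)
  have degH': "deg H' v \<le> c * card G'" if v: "v \<in> {..<n} - D'" for v
  proof -
    have "deg H' v = deg (?X - G - U) v + deg T v"
      unfolding H'eq using fT TU by (intro deg_Un_disjoint) (auto simp: U'_def)
    moreover have "deg T v \<le> c"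
    proof (cases "v \<in> F'")
      case True
      then show ?thesis using T by blast
    next
      case False
      then have "v \<notin> Dd \<union> F1" using v T by blast
      then have "{e \<in> T. v \<in> e} = {}" using T by blast
      then show ?thesis by (simp only: deg_def card.empty)
    qed
    moreover have "v \<notin> Dd"
    proof
      assume "v \<in> Dd"
      then have "v \<in> F'" using v T by blast
      then show False using F'F1 DF1(2) \<open>v \<in> Dd\<close> by blast
    qed
    then have "deg (?X - G - U) v \<le> c * card G" using v st' by blast
    ultimately show ?thesis unfolding cG' by simp
  qed
  have q': "card G' \<le> qmax"
  proof -
    have "qmax \<ge> 1" by (rule qmax_pos)
    then show ?thesis using opening_q[OF st] unfolding cG' by simp
  qed
  have tot: "card U' + card G' * (b + 1) = (n choose 2) + b" using st' cU' cG' by simp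
  show ?thesis
  proof (cases "\<exists>v. k \<le> deg G' v")
    case True
    have "\<exists>T. T \<in> strict_moves b (U - S)"
      unfolding strict_moves_def using obtain_subset_with_card_n[of "min b (card (U - S))" "U - S"] by auto
    then show ?thesis using main_state_win[OF True] by (auto simp: G'_def)
  next
    case False
    then have degk: "deg G' v < k" for v by (simp add: not_le)
    show ?thesis
    proof (cases "card T = b \<and> f \<le> card F'")
      case True
      have "card (U' - T) = card U' - b" using TU fT True by (simp add: card_Diff_subset)
      moreover have "b \<le> card U'" using card_mono[OF fU' TU] True by simp
      ultimately have "card (U' - T) + card G' * (b + 1) = n choose 2" using tot by simp
      moreover have "\<forall>v\<in>F'. deg G' v = 0" using F'F1 st' degG' by (auto simp: F1_def)
      ultimately have "opening_state G' (U' - T) D' F'"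
        unfolding opening_state_def using T True DF1 W1deg sumW degH' unfolding W1eq H'_def by auto
      moreover have "T \<in> strict_moves b (U - S)"
        using TU True card_mono[OF fU' TU] by (auto simp: strict_moves_def U'_def)
      ultimately show ?thesis unfolding G'_def U'_def by blast
    next
      case False
      then have T': "card T \<le> b" "card F' < f" using T by auto
      \<comment> \<open>The fewer than \<open>f\<close> fresh vertices still left join the dead
        side; the living side consists of the touched vertices that are not dead.\<close>
      define D where "D = {..<n} - W1"
      have W1n: "W1 \<subseteq> {..<n}" by (auto simp: W1_def)
      have cW1: "card W1 \<le> 2 * card G'" using card_touched_le[OF G'X W1n W1deg] by simp
      have fD: "finite D" by (simp add: D_def)
      have cD: "n - 2 * qmax \<le> card D"
        unfolding D_def using W1n cW1 q' by (simp add: card_Diff_subset finite_subset[OF W1n])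
      interpret two_sided n k b W1 D M \<Delta> s n \<mu> \<rho> P0
      proof
        show "card D \<le> n" unfolding D_def using card_mono[of "{..<n}" "{..<n} - W1"] by auto
      qed (use k W1n spread sm M\<mu> \<rho>2 \<rho>\<mu> in \<open>auto simp: D_def\<close>)
      have sound: "sound M \<Delta> (free (U' - T) v) (deg G' v)" if v: "v \<in> W1" for v
      proof -
        have vn: "v < n" "v \<notin> D" "v \<notin> D'" using v W1n W1eq by (auto simp: D_def)
        have crX: "cross v \<subseteq> ?X"
        proof
          fix x assume "x \<in> cross v"
          then obtain y where y: "y \<in> D" "x = {v, y}" by (auto simp: cross_def)
          moreover have "y < n" "y \<noteq> v" using y vn by (auto simp: D_def)
          ultimately show "x \<in> ?X" using vn(1) by (auto simp: complete_edges_def)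
        qed
        have "card D = card (cross v)"
          unfolding cross_def by (intro card_image[symmetric]) (auto simp: inj_on_def doubleton_eq_iff)
        also have "\<dots> \<le> card (((U' - T) \<inter> cross v) \<union> {e \<in> G'. v \<in> e} \<union> {e \<in> H'. v \<in> e})"
        proof (rule card_mono)
          show "cross v \<subseteq> ((U' - T) \<inter> cross v) \<union> {e \<in> G'. v \<in> e} \<union> {e \<in> H'. v \<in> e}"
            using crX by (auto simp: H'_def cross_def)
        qed (use fU' fG' in \<open>auto simp: H'_def\<close>)
        also have "\<dots> \<le> free (U' - T) v + deg G' v + deg H' v"
          unfolding free_def deg_def by (meson add_le_mono1 card_Un_le le_trans)
        also have "deg H' v \<le> c * qmax"
          using degH'[of v] vn q' by (meson DiffI le_trans lessThan_iff mult_le_mono2)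
        finally have "n \<le> free (U' - T) v + deg G' v + c * qmax + 2 * qmax" using cD by simp
        moreover have "(c + 2) * qmax = c * qmax + 2 * qmax" by (simp add: algebra_simps)
        moreover have "deg G' v \<le> deg G' v * (\<Delta> + 1)" by simp
        ultimately show ?thesis unfolding sound_def using Mq by linarith
      qed
      \<comment> \<open>All edges inside \<open>D'\<close> are claimed, and a round claims at most
        \<open>b + 1\<close>, so at least \<open>qmin\<close> rounds have been played.\<close>
      have q1: "qmin \<le> card G'"
      proof -
        have DFn: "D' \<union> F' \<subseteq> {..<n}" using TDF DF1(1) by simp
        then have fDF: "finite (D' \<union> F')" by (rule finite_subset) simp
        have fD': "finite D'" "D' \<subseteq> {..<n}" using DFn fDF by auto
        have "card D \<le> card (D' \<union> F')" using fDF by (intro card_mono) (auto simp: D_def W1eq)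
        also have "\<dots> \<le> card D' + card F'" by (rule card_Un_le)
        finally have "n - 2 * qmax - f \<le> card D'" using T'(2) cD by simp
        then have "(n - 2 * qmax - f) choose 2 \<le> card D' choose 2" by (rule binomial_right_mono)
        also have "\<dots> = card {e \<in> ?X. e \<subseteq> D'}" using card_complete_edges_inside[OF fD'] by simp
        also have "\<dots> \<le> card (?X - (U' - T))" using Tout by (intro card_mono) auto
        also have "\<dots> = (n choose 2) - card (U' - T)"
          using U'X fU' by (subst card_Diff_subset) (auto simp: card_complete_edges)
        also have "card (U' - T) = card U' - card T" using TU fT by (rule card_Diff_subset[rotated])
        finally have "(n - 2 * qmax - f) choose 2 \<le> card G' * (b + 1)" using T'(1) tot by simp
        then have "qmin * (b + 1) \<le> card G' * (b + 1)" using qmin by simp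
        then show ?thesis by (simp only: mult_le_cancel2)
      qed
      have pre: "pre_safe G' (U' - T)"
        unfolding pre_safe_def
      proof (intro conjI ballI impI)
        have "P0 \<le> real (card G') * \<rho> * real \<mu>"
          unfolding P0 using q1 \<rho>2 by (intro mult_right_mono) auto
        also have "\<dots> \<le> (\<Sum>v\<in>W1. \<rho> ^ deg G' v) * real \<mu>" using sumW by (intro mult_right_mono) auto
        also have "\<dots> = (\<Sum>v\<in>W1. \<rho> ^ deg G' v * real \<mu>)" by (rule sum_distrib_right)
        also have "\<dots> \<le> pot \<rho> W1 (free (U' - T)) (deg G')"
          unfolding pot_def using sound_ge[OF sound degk] \<rho>2 by (intro sum_mono mult_left_mono) auto
        finally show "P0 \<le> pot \<rho> W1 (free (U' - T)) (deg G')" .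
      qed (use sound in auto)
      have pos'': "position ?X G' (U' - T)" using G'X U'X GU e eG by (auto simp: position_def G'_def U'_def)
      \<comment> \<open>The opening may end in mid-move; the rest of the budget is already played by
        the two-sided strategy.\<close>
      obtain T2 where T2: "good_reply G' (U' - T) (b - card T) T2"
        using pre_safe_reply[OF pos'' pre degk, of "b - card T"] by auto
      have T2U: "T2 \<subseteq> U' - T" using T2 by (simp add: good_reply_def)
      have "card (T \<union> T2) = card T + card T2"
        using T2U fT fU' by (intro card_Un_disjoint) (auto intro: finite_subset)
      moreover have "U' - (T \<union> T2) = U' - T - T2" by auto
      ultimately have "good_reply (G \<union> S) (U - S) b (T \<union> T2)"
        using T2 T2U TU T'(1) unfolding G'_def[symmetric] U'_def[symmetric] good_reply_def by auto
      moreover have "n choose 2 = card G * (b + 1) + card U" using st' by simp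
      moreover have "real (star_rem n b) * \<rho> ^ (k - 1) \<le> Pmin" using rem by (simp add: Pmin_def)
      ultimately obtain T3 where "T3 \<in> strict_moves b (U - S)" "strict_inv (G \<union> S) (U - S - T3)"
        using strict_reply[OF n _ pos _ S'] by blast
      then show ?thesis unfolding main_state_def using two_sided_axioms by blast
    qed
  qed
qed

lemma enforcer_wins: "wins_star_game Enforcer strict_moves k n b"
  unfolding wins_star_game_def
proof (rule enforcer_wins_by_invariant[OF proper_rule_strict,
      where J = "\<lambda>G U. main_state G U \<or> (\<exists>Dd F. opening_state G U Dd F)"])
  \<comment> \<open>For \<open>f > n\<close> the truncated difference gives \<open>qmin = 0\<close>,
    hence \<open>P0 = 0\<close>, which contradicts \<open>rem\<close>.\<close>
  have "f \<le> n"
  proof (rule ccontr)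
    assume "\<not> f \<le> n"
    then have "n - 2 * qmax - f = 0" by simp
    then have "qmin = 0" using qmin by (simp add: binomial_eq_0)
    then have "P0 = 0" using P0 by simp
    moreover have "0 \<le> real (b + 2 * s * n) * (\<Sum>l\<le>k - 2. \<rho> ^ l)" using \<rho>2 by (intro mult_nonneg_nonneg sum_nonneg) auto
    moreover have "0 < real (star_rem n b) * \<rho> ^ (k - 1)"
      using star_rem_props(1)[OF n, of b] \<rho>2 by (intro mult_pos_pos) auto
    ultimately show False using rem by linarith
  qed
  moreover have "deg {} v = 0" for v by simp
  moreover have "\<not> e \<subseteq> {}" if "e \<in> complete_edges n" for e using that by (auto simp: complete_edges_def)
  ultimately have "opening_state {} (complete_edges n) {} {..<n}"
    by (auto simp: opening_state_def card_complete_edges)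
  then show "main_state {} (complete_edges n) \<or> (\<exists>Dd F. opening_state {} (complete_edges n) Dd F)" by blast
next
  fix G assume a: "main_state G {} \<or> (\<exists>Dd F. opening_state G {} Dd F)" and pos: "position (complete_edges n) G {}"
  then have "main_state G {}" using opening_nonempty[OF _ pos] by blast
  then obtain A D where ts: "two_sided n k b A D M \<Delta> s n \<mu> \<rho>"
    "two_sided.strict_inv n k b A D M \<Delta> s n \<rho> P0 G {}" by (auto simp: main_state_def)
  interpret two_sided n k b A D M \<Delta> s n \<mu> \<rho> P0 by (rule ts)
  show "\<exists>T\<in>star_copies k n. T \<subseteq> G" using strict_inv_final[OF ts(2) pos] .
next
  fix G U S
  assume a: "main_state G U \<or> (\<exists>Dd F. opening_state G U Dd F)" and pos: "position (complete_edges n) G U"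
    and ne: "U \<noteq> {}" and S: "S \<in> strict_moves 1 U"
  then show "\<exists>T\<in>strict_moves b (U - S). main_state (G \<union> S) (U - S - T) \<or> (\<exists>Dd F. opening_state (G \<union> S) (U - S - T) Dd F)"
    using main_state_step[OF _ pos ne S] opening_step[OF _ pos S ne] by blast
qed

end

section \<open>Choice of the parameters\<close>

lemma le_Suc_div_mult: "0 < c \<Longrightarrow> a \<le> (a div c + 1) * c" for a c :: nat
  using dividend_less_div_times[of c a] by simp

lemma real_div_le_Suc:
  assumes "c > 0"
  shows "real a / real c \<le> real (a div c) + 1"
proof -
  have "a \<le> (a div c + 1) * c"
    using assms by (rule le_Suc_div_mult)
  then have "real a \<le> (real (a div c) + 1) * real c"
    by (metis of_nat_1 of_nat_add of_nat_le_iff of_nat_mult)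
  then show ?thesis using assms by (simp add: pos_divide_le_eq)
qed

lemma real_choose_two: "real (n choose 2) = real n * (real n - 1) / 2"
proof -
  have "2 * (n choose 2) = n * (n - 1)" unfolding choose_two by (intro dvd_mult_div_cancel) auto
  then have "2 * real (n choose 2) = real n * real (n - 1)" by (metis of_nat_mult of_nat_numeral)
  then show ?thesis by (cases n) auto
qed

text \<open>The potential argument leaves about \<open>n ^ (k + 1) / (2 * b ^ (k - 1))\<close> edges, minus about \<open>n\<close>
  for the passages between levels. With \<open>x = n ^ k / (2 * b) ^ (k - 1)\<close> this is at least
  \<open>(2 * x - 1) * n\<close> up to lower order terms, which exceeds \<open>x * n\<close> because the factor \<open>0.4\<close> in
  the bound on \<open>b\<close> gives \<open>x \<ge> 25 / 16\<close>. The lower order terms are multiples of \<open>\<epsilon> = 1 / L\<close>.\<close>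

lemma enforcer_wins_small_remainder:
  fixes k n b L :: nat
  defines "L \<equiv> 100 * k"
  assumes k: "k \<ge> 3" and n: "4 * L * (L + 2) \<le> n" and bn: "L * (L + 2) * n \<le> b"
    and b2: "2 * L * b \<le> n ^ 2" and bk: "25 / 16 * (2 * real b) ^ (k - 1) \<le> real n ^ k"
    and r: "small_remainder k n b"
  shows "wins_star_game Enforcer strict_moves k n b"
proof -
  define \<epsilon> where "\<epsilon> = 1 / real L"
  have L300: "L \<ge> 300" using k by (simp add: L_def)
  then have \<epsilon>: "0 < \<epsilon>" "\<epsilon> \<le> 1 / 300" by (auto simp: \<epsilon>_def field_simps)
  have L\<epsilon>: "real L * \<epsilon> = 1" using L300 by (simp add: \<epsilon>_def)
  have k\<epsilon>: "real k * \<epsilon> = 1 / 100" using k by (simp add: \<epsilon>_def L_def)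
  \<comment> \<open>Each choice keeps one loss at a small multiple of \<open>\<epsilon> * n\<close>:
    about \<open>\<epsilon> * n\<close> fresh vertices are left over, a vertex loses at most
    \<open>(c + 2) * qmax \<le> \<epsilon> * n\<close> edges in the opening, and at most
    \<open>2 * \<epsilon> * n\<close> to the damage of \<open>k - 1\<close> levels.\<close>
  define c where "c = L"
  define f where "f = n div L + 1"
  define s where "s = k * L"
  define \<Delta> where "\<Delta> = n div s + 1"
  define qmax where "qmax = (n choose 2) div (b + 1) + 2"
  define qmin where "qmin = ((n - 2 * qmax - f) choose 2) div (b + 1)"
  define M where "M = n - (c + 2) * qmax"
  define \<mu> where "\<mu> = M - (k - 1) * (\<Delta> + 1)"
  define \<rho> where "\<rho> = 1 + real (b + 1) / real \<mu>"
  define P0 where "P0 = real qmin * \<rho> * real \<mu>"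
  have LL: "L * (L + 2) \<ge> 300" using L300 mult_le_mono[of 300 L 1 "L + 2"] by simp
  have nbig: "1200 \<le> n" using n LL by (simp add: mult.assoc)
  have nR: "4 * real L * (real L + 2) \<le> real n"
    using of_nat_mono[OF n, where 'a = real] by (simp add: algebra_simps)
  have bR: "real L * (real L + 2) * real n \<le> real b"
    using of_nat_mono[OF bn, where 'a = real] by (simp add: algebra_simps)
  have b2R: "2 * real L * real b \<le> real n ^ 2"
    using of_nat_mono[OF b2, where 'a = real] by (simp add: algebra_simps)
  have n0: "real n > 0" using nbig by simp
  have en: "1 \<le> \<epsilon> * real n"
  proof -
    have "real L * 1 \<le> 4 * real L * (real L + 2)" using L300 by (simp add: algebra_simps)
    then have "real L \<le> real n" using nR by linarith
    then have "\<epsilon> * real L \<le> \<epsilon> * real n" using \<epsilon> by (intro mult_left_mono) auto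
    then show ?thesis using L\<epsilon> by (simp add: mult.commute)
  qed
  have bpos: "real b > 0" "real n \<le> real b" "real L * real n \<le> real b"
  proof -
    have "1 * 1 \<le> real L * (real L + 2)" using L300 by (intro mult_mono) auto
    then have "1 * real n \<le> real L * (real L + 2) * real n" by (intro mult_right_mono) auto
    then show "real n \<le> real b" using bR by simp
    then show "real b > 0" using n0 by linarith
    have "real L * 1 * real n \<le> real L * (real L + 2) * real n" by (intro mult_right_mono mult_left_mono) auto
    then show "real L * real n \<le> real b" using bR by simp
  qed
  have qmaxR: "real qmax \<le> real n ^ 2 / (2 * real b) + 2"
  proof -
    have "real ((n choose 2) div (b + 1)) \<le> real (n choose 2) / real (b + 1)" by (rule of_nat_div_le_of_nat)
    also have "\<dots> \<le> (real n ^ 2 / 2) / real b"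
    proof (rule frac_le)
      have "real (n choose 2) = real n * (real n - 1) / 2"
        by (rule real_choose_two)
      then show "real (n choose 2) \<le> real n ^ 2 / 2" using n0 by (simp add: power2_eq_square field_simps)
    qed (use bpos in auto)
    finally show ?thesis by (simp add: qmax_def)
  qed
  have cq: "real ((c + 2) * qmax) \<le> \<epsilon> * real n"
  proof -
    have "(real L + 2) * (real n ^ 2 / (2 * real b)) \<le> \<epsilon> * real n / 2"
    proof -
      have "(real L + 2) * real n \<le> \<epsilon> * real b"
      proof -
        have "\<epsilon> * (real L * (real L + 2) * real n) \<le> \<epsilon> * real b" using bR \<epsilon> by (intro mult_left_mono) auto
        moreover have "\<epsilon> * (real L * (real L + 2) * real n) = (real L * \<epsilon>) * ((real L + 2) * real n)" by simp
        ultimately show ?thesis using L\<epsilon> by simp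
      qed
      then have "(real L + 2) * real n * real n \<le> \<epsilon> * real b * real n" using n0 by (intro mult_right_mono) auto
      then show ?thesis using bpos by (simp add: field_simps power2_eq_square)
    qed
    moreover have "2 * (real L + 2) \<le> \<epsilon> * real n / 2"
    proof -
      have "\<epsilon> * (4 * real L * (real L + 2)) \<le> \<epsilon> * real n" using nR \<epsilon> by (intro mult_left_mono) auto
      moreover have "\<epsilon> * (4 * real L * (real L + 2)) = 4 * (real L * \<epsilon>) * (real L + 2)" by simp
      ultimately show ?thesis using L\<epsilon> by simp
    qed
    moreover have "real ((c + 2) * qmax) \<le> (real L + 2) * (real n ^ 2 / (2 * real b) + 2)"
    proof -
      have "real ((c + 2) * qmax) = (real L + 2) * real qmax" by (simp add: c_def algebra_simps)
      then show ?thesis using qmaxR by (simp only:) (intro mult_left_mono, auto)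
    qed
    moreover have "(real L + 2) * (real n ^ 2 / (2 * real b) + 2)
        = (real L + 2) * (real n ^ 2 / (2 * real b)) + 2 * (real L + 2)" by (simp only: distrib_left mult.commute)
    ultimately show ?thesis by linarith
  qed
  have cqn: "(c + 2) * qmax \<le> n"
  proof -
    have "\<epsilon> * real n \<le> 1 * real n" using \<epsilon> n0 by (intro mult_right_mono) auto
    then have "real ((c + 2) * qmax) \<le> real n" using cq by linarith
    then show ?thesis by (simp only: of_nat_le_iff)
  qed
  have MR: "(1 - \<epsilon>) * real n \<le> real M"
    using cq cqn unfolding M_def by (simp only: of_nat_diff) (simp add: algebra_simps)
  have kD: "real ((k - 1) * (\<Delta> + 1)) \<le> 2 * \<epsilon> * real n"
  proof -
    have "real (n div s) \<le> real n / real s" by (rule of_nat_div_le_of_nat)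
    then have "real k * real (\<Delta> + 1) \<le> real k * (real n / real s + 2)"
      by (intro mult_left_mono) (auto simp: \<Delta>_def)
    also have "\<dots> = \<epsilon> * real n + 2 * real k" using k by (simp add: s_def \<epsilon>_def field_simps)
    also have "2 * real k \<le> \<epsilon> * real n"
    proof -
      have "2 * real k \<le> \<epsilon> * (4 * real L * (real L + 2))"
      proof -
        have "\<epsilon> * (4 * real L * (real L + 2)) = 4 * (real L * \<epsilon>) * (real L + 2)" by simp
        then have "\<epsilon> * (4 * real L * (real L + 2)) = 4 * (real L + 2)" using L\<epsilon> by simp
        moreover have "2 * real k \<le> 4 * (real L + 2)" by (simp add: L_def)
        ultimately show ?thesis by (simp only:)
      qed
      also have "\<dots> \<le> \<epsilon> * real n" using nR \<epsilon> by (intro mult_left_mono) auto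
      finally show ?thesis .
    qed
    finally have "real k * real (\<Delta> + 1) \<le> 2 * \<epsilon> * real n" by simp
    moreover have "real ((k - 1) * (\<Delta> + 1)) \<le> real k * real (\<Delta> + 1)"
      unfolding of_nat_mult by (intro mult_right_mono) auto
    ultimately show ?thesis by linarith
  qed
  have kDM: "(k - 1) * (\<Delta> + 1) \<le> M"
  proof -
    have "2 * \<epsilon> * real n \<le> (1 - \<epsilon>) * real n" using \<epsilon> n0 by (intro mult_right_mono) auto
    then have "real ((k - 1) * (\<Delta> + 1)) \<le> real M" using kD MR by linarith
    then show ?thesis by (simp only: of_nat_le_iff)
  qed
  have \<mu>R: "(1 - 3 * \<epsilon>) * real n \<le> real \<mu>"
    using MR kD kDM unfolding \<mu>_def by (simp only: of_nat_diff) (simp add: algebra_simps)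
  have \<mu>n: "real \<mu> \<le> real n" by (simp add: \<mu>_def M_def)
  have \<mu>0: "real \<mu> > 0"
  proof -
    have "0 < (1 - 3 * \<epsilon>) * real n" using \<epsilon> n0 by (intro mult_pos_pos) auto
    then show ?thesis using \<mu>R by linarith
  qed
  define t where "t = real b / real n"
  have t0: "t > 0" using bpos n0 by (simp add: t_def)
  have tb: "real b = t * real n" using n0 by (simp add: t_def)
  have b1: "real (b + 1) \<le> (1 + \<epsilon>) * real b"
  proof -
    have "1 \<le> \<epsilon> * real n" by (rule en)
    also have "\<dots> \<le> \<epsilon> * real b" using bpos \<epsilon> by (intro mult_left_mono) auto
    finally show ?thesis by (simp add: algebra_simps)
  qed
  have \<rho>t: "\<rho> \<le> (1 + 6 * \<epsilon>) * t"
  proof -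
    have "real (b + 1) / real \<mu> \<le> ((1 + \<epsilon>) * real b) / ((1 - 3 * \<epsilon>) * real n)"
      using b1 \<mu>R \<epsilon> n0 by (intro frac_le) auto
    also have "\<dots> = (1 + \<epsilon>) / (1 - 3 * \<epsilon>) * t" by (simp add: t_def)
    also have "\<dots> \<le> (1 + 5 * \<epsilon>) * t"
    proof (rule mult_right_mono)
      have "\<epsilon> * (15 * \<epsilon>) \<le> \<epsilon> * 1" using \<epsilon> by (intro mult_left_mono) auto
      then have "1 + \<epsilon> \<le> (1 + 5 * \<epsilon>) * (1 - 3 * \<epsilon>)" by (simp add: algebra_simps)
      then show "(1 + \<epsilon>) / (1 - 3 * \<epsilon>) \<le> 1 + 5 * \<epsilon>" using \<epsilon> by (subst pos_divide_le_eq) auto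
    qed (use t0 in simp)
    finally have 1: "real (b + 1) / real \<mu> \<le> (1 + 5 * \<epsilon>) * t" .
    have "real L \<le> t" using bpos n0 by (simp add: t_def field_simps)
    then have "\<epsilon> * real L \<le> \<epsilon> * t" using \<epsilon> by (intro mult_left_mono) auto
    then have "1 \<le> \<epsilon> * t" using L\<epsilon> by (simp add: mult.commute)
    then show ?thesis using 1 unfolding \<rho>_def by (simp add: algebra_simps)
  qed
  have \<rho>2: "\<rho> \<ge> 2" using \<mu>n \<mu>0 bpos by (simp add: \<rho>_def)
  have qminR: "(1 - 10 * \<epsilon>) * (real n / (2 * t)) \<le> real qmin"
  proof -
    define dd where "dd = n - 2 * qmax - f"
    have "real f \<le> real n / real L + 1" using of_nat_div_le_of_nat[of n L] by (simp add: f_def)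
    then have fR: "real f \<le> \<epsilon> * real n + 1" by (simp add: \<epsilon>_def)
    have "2 * real qmax \<le> real ((c + 2) * qmax)"
      unfolding of_nat_mult by (intro mult_right_mono) auto
    then have "2 * real qmax + real f \<le> 3 * \<epsilon> * real n" using cq fR en by linarith
    then have dR: "(1 - 3 * \<epsilon>) * real n \<le> real dd"
      unfolding dd_def by (simp add: algebra_simps)
    have dR1: "(1 - 4 * \<epsilon>) * real n \<le> real dd - 1" using dR en by (simp add: algebra_simps)
    have d0: "0 \<le> (1 - 4 * \<epsilon>) * real n" using \<epsilon> by simp
    have "((1 - 4 * \<epsilon>) * real n) * ((1 - 4 * \<epsilon>) * real n) \<le> real dd * (real dd - 1)"
      using dR1 d0 by (intro mult_mono) auto
    moreover have "real (dd choose 2) = real dd * (real dd - 1) / 2"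
      by (rule real_choose_two)
    ultimately have ch: "(1 - 4 * \<epsilon>) ^ 2 * real n ^ 2 / 2 \<le> real (dd choose 2)"
      by (simp add: power2_eq_square mult_ac)
    have "(1 - 8 * \<epsilon>) * real n ^ 2 / 2 \<le> (1 - 4 * \<epsilon>) ^ 2 * real n ^ 2 / 2"
      by (intro divide_right_mono mult_right_mono) (auto simp: power2_eq_square algebra_simps)
    then have "(1 - 8 * \<epsilon>) * real n ^ 2 / 2 \<le> real (dd choose 2)" using ch by linarith
    then have "((1 - 8 * \<epsilon>) * real n ^ 2 / 2) / ((1 + \<epsilon>) * real b) \<le> real (dd choose 2) / real (b + 1)"
      using b1 \<epsilon> by (intro frac_le) auto
    moreover have "((1 - 8 * \<epsilon>) * real n ^ 2 / 2) / ((1 + \<epsilon>) * real b) = (1 - 8 * \<epsilon>) / (1 + \<epsilon>) * (real n / (2 * t))"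
      unfolding t_def using n0 by (simp add: power2_eq_square field_simps)
    moreover have "(1 - 9 * \<epsilon>) * (real n / (2 * t)) \<le> (1 - 8 * \<epsilon>) / (1 + \<epsilon>) * (real n / (2 * t))"
    proof (rule mult_right_mono)
      have "(1 - 9 * \<epsilon>) * (1 + \<epsilon>) \<le> 1 - 8 * \<epsilon>" by (simp add: algebra_simps)
      then show "1 - 9 * \<epsilon> \<le> (1 - 8 * \<epsilon>) / (1 + \<epsilon>)" using \<epsilon> by (subst pos_le_divide_eq) auto
    qed (use t0 in simp)
    ultimately have "(1 - 9 * \<epsilon>) * (real n / (2 * t)) \<le> real (dd choose 2) / real (b + 1)" by linarith
    also have "\<dots> \<le> real qmin + 1"
      unfolding qmin_def dd_def[symmetric] by (rule real_div_le_Suc) simp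
    finally have 1: "(1 - 9 * \<epsilon>) * (real n / (2 * t)) \<le> real qmin + 1" .
    have "real L \<le> real n / (2 * t)"
      using b2R n0 bpos unfolding t_def by (simp add: field_simps power2_eq_square)
    then have "\<epsilon> * real L \<le> \<epsilon> * (real n / (2 * t))" using \<epsilon> by (intro mult_left_mono) auto
    then have "1 \<le> \<epsilon> * (real n / (2 * t))" using L\<epsilon> by (simp add: mult.commute)
    then show ?thesis using 1 by (simp add: algebra_simps)
  qed
  define x where "x = real n ^ k / (2 * real b) ^ (k - 1)"
  have x: "x \<ge> 25 / 16" unfolding x_def using bk bpos by (subst pos_le_divide_eq) auto
  have rx: "real (star_rem n b) \<le> real n * x"
    using r unfolding small_remainder_def x_def by simp
  have C: "real (b + 2 * s * n) \<le> 51 / 50 * real (b + 1)"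
  proof -
    have "2 * real s * real n = 2 * real k * (real L * real n)" by (simp add: s_def)
    also have "\<dots> \<le> 1 / 50 * (real L * (real L * real n))" by (simp add: L_def)
    also have "\<dots> \<le> 1 / 50 * (real L * (real L + 2) * real n)"
      by (simp add: algebra_simps)
    also have "\<dots> \<le> 1 / 50 * real b" using bR by simp
    finally show ?thesis by simp
  qed
  \<comment> \<open>This is the required inequality after cancelling \<open>\<rho>\<close>. Since
    \<open>x \<ge> 25 / 16\<close>, the term \<open>51 / 50\<close> is at most
    \<open>653 / 1000 * x\<close>; \<open>100 / 94\<close> compensates the error in
    \<open>\<rho>\<close>, and \<open>2 ^ (k - 1) \<ge> 4\<close>. The result,
    \<open>1653 / 1880\<close>, is below \<open>1 - 13 * \<epsilon>\<close>.\<close>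
  have key: "(real n * x + 51 / 50 * real n) * \<rho> ^ (k - 2) \<le> real qmin * real \<mu>"
  proof -
    have tk: "real b ^ (k - 1) = t ^ (k - 2) * real b * real n ^ (k - 2)"
    proof -
      have "k - 1 = Suc (k - 2)" using k by simp
      then show ?thesis using tb by (simp add: power_mult_distrib)
    qed
    \<comment> \<open>Bernoulli bounds the power of \<open>1 - 6 * \<epsilon>\<close> from below,
      and the product of both powers is at most 1. As \<open>k * \<epsilon> = 1 / 100\<close>, the
      bound does not depend on \<open>k\<close>.\<close>
    have e6: "(1 + 6 * \<epsilon>) ^ (k - 2) \<le> 100 / 94"
    proof -
      have "94 / 100 \<le> 1 - real (k - 2) * (6 * \<epsilon>)"
      proof -
        have "real (k - 2) * (6 * \<epsilon>) \<le> real k * (6 * \<epsilon>)" using \<epsilon> by (intro mult_right_mono) auto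
        then show ?thesis using k\<epsilon> by (simp add: algebra_simps)
      qed
      also have "\<dots> \<le> (1 - 6 * \<epsilon>) ^ (k - 2)"
        using Bernoulli_inequality[of "- 6 * \<epsilon>" "k - 2"] \<epsilon> by simp
      finally have a: "94 / 100 \<le> (1 - 6 * \<epsilon>) ^ (k - 2)" .
      have "(1 + 6 * \<epsilon>) ^ (k - 2) * (1 - 6 * \<epsilon>) ^ (k - 2) = (1 - 36 * \<epsilon> ^ 2) ^ (k - 2)"
        by (simp add: power_mult_distrib[symmetric] algebra_simps power2_eq_square)
      also have "\<dots> \<le> 1"
      proof -
        have "\<epsilon> ^ 2 \<le> (1 / 300) ^ 2" using \<epsilon> by (intro power_mono) auto
        also have "(1 / 300) ^ 2 \<le> (1 / 36 :: real)" by (simp add: power2_eq_square)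
        finally show ?thesis by (intro power_le_one) auto
      qed
      finally have b: "(1 + 6 * \<epsilon>) ^ (k - 2) * (1 - 6 * \<epsilon>) ^ (k - 2) \<le> 1" .
      have "(1 + 6 * \<epsilon>) ^ (k - 2) * (94 / 100) \<le> (1 + 6 * \<epsilon>) ^ (k - 2) * (1 - 6 * \<epsilon>) ^ (k - 2)"
        using a \<epsilon> by (intro mult_left_mono) auto
      then show ?thesis using b by linarith
    qed
    have "\<rho> ^ (k - 2) \<le> ((1 + 6 * \<epsilon>) * t) ^ (k - 2)" using \<rho>t \<rho>2 by (intro power_mono) auto
    also have "\<dots> = (1 + 6 * \<epsilon>) ^ (k - 2) * t ^ (k - 2)" by (rule power_mult_distrib)
    also have "\<dots> \<le> 100 / 94 * t ^ (k - 2)" using e6 t0 by (intro mult_right_mono) auto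
    finally have rk: "\<rho> ^ (k - 2) \<le> 100 / 94 * t ^ (k - 2)" .
    have "real n * x + 51 / 50 * real n \<le> 1653 / 1000 * (real n * x)"
    proof -
      have "51 / 50 \<le> 653 / 1000 * x" using x by simp
      then have "real n * (51 / 50) \<le> real n * (653 / 1000 * x)" using n0 by (intro mult_left_mono) auto
      then show ?thesis by (simp add: mult_ac)
    qed
    then have "(real n * x + 51 / 50 * real n) * \<rho> ^ (k - 2) \<le> 1653 / 1000 * (real n * x) * (100 / 94 * t ^ (k - 2))"
      using rk n0 x \<rho>2 by (intro mult_mono) auto
    also have "\<dots> = 1653 / 940 * (real n * (x * t ^ (k - 2)))" by simp
    also have "x * t ^ (k - 2) = real n ^ 2 / (2 ^ (k - 1) * real b)"
    proof -
      have "k = 2 + (k - 2)" using k by simp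
      then have "real n ^ k = real n ^ 2 * real n ^ (k - 2)" by (metis power_add)
      then have "x = real n ^ 2 * real n ^ (k - 2) / (2 ^ (k - 1) * (t ^ (k - 2) * real b * real n ^ (k - 2)))"
        unfolding x_def power_mult_distrib tk by simp
      then show ?thesis using n0 t0 by (simp add: field_simps)
    qed
    also have "real n ^ 2 / (2 ^ (k - 1) * real b) \<le> real n ^ 2 / (4 * real b)"
    proof -
      have "(2::real) ^ 2 \<le> 2 ^ (k - 1)" using k by (intro power_increasing) auto
      then show ?thesis using bpos by (intro divide_left_mono mult_right_mono mult_pos_pos) auto
    qed
    also have "1653 / 940 * (real n * (real n ^ 2 / (4 * real b))) = 1653 / 1880 * (real n / (2 * t) * real n)"
      unfolding t_def using n0 bpos by (simp add: field_simps power2_eq_square)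
    also have "\<dots> \<le> (1 - 10 * \<epsilon>) * (1 - 3 * \<epsilon>) * (real n / (2 * t) * real n)"
    proof (rule mult_right_mono)
      have "1 - 13 * \<epsilon> \<le> (1 - 10 * \<epsilon>) * (1 - 3 * \<epsilon>)" by (simp add: algebra_simps)
      then show "1653 / 1880 \<le> (1 - 10 * \<epsilon>) * (1 - 3 * \<epsilon>)" using \<epsilon> by linarith
    qed (use n0 t0 in simp)
    also have "\<dots> = ((1 - 10 * \<epsilon>) * (real n / (2 * t))) * ((1 - 3 * \<epsilon>) * real n)" by simp
    also have "\<dots> \<le> real qmin * real \<mu>" using qminR \<mu>R \<epsilon> n0 t0 by (intro mult_mono) auto
    finally show ?thesis using n0 by simp
  qed
  \<comment> \<open>Empty sides are enough to apply \<open>Pmin_ge\<close>, a purely numerical fact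
    that is needed before the opening has produced the real sides.\<close>
  have tsided: "two_sided n k b {} {} M \<Delta> s n \<mu> \<rho>"
  proof
    show "n \<le> s * \<Delta>"
      using le_Suc_div_mult[of s n] k L300 by (simp add: \<Delta>_def s_def mult.commute)
    have "real (s * n) \<le> real b"
    proof -
      have "real k * (real L * real n) \<le> (real L + 2) * (real L * real n)"
        by (intro mult_right_mono) (auto simp: L_def)
      then show ?thesis using bR by (simp add: s_def mult_ac)
    qed
    then show "s * n \<le> b" by (simp only: of_nat_le_iff)
    show "(k - 1) * (\<Delta> + 1) + \<mu> \<le> M" using kDM by (simp add: \<mu>_def)
    show "real b + 1 \<le> (\<rho> - 1) * real \<mu>" using \<mu>0 by (simp add: \<rho>_def)
  qed (use k \<rho>2 in auto)
  interpret ts: two_sided n k b "{}" "{}" M \<Delta> s n \<mu> \<rho> P0 by (rule tsided)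
  have rem: "real (star_rem n b) * \<rho> ^ (k - 1) \<le> P0 - real (b + 2 * s * n) * (\<Sum>l\<le>k - 2. \<rho> ^ l)"
  proof -
    have "P0 - 51 / 50 * real \<mu> * \<rho> ^ (k - 1) \<le> ts.Pmin"
      using ts.Pmin_ge[OF \<rho>_def _ C] \<mu>0 by simp
    moreover have "(real (star_rem n b) + 51 / 50 * real \<mu>) * \<rho> ^ (k - 1) \<le> P0"
    proof -
      have "\<rho> ^ (k - 1) = \<rho> ^ (k - 2) * \<rho>"
      proof -
        have "k - 1 = Suc (k - 2)" using k by simp
        then show ?thesis by simp
      qed
      then have "(real (star_rem n b) + 51 / 50 * real \<mu>) * \<rho> ^ (k - 1)
          = (real (star_rem n b) + 51 / 50 * real \<mu>) * \<rho> ^ (k - 2) * \<rho>" by simp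
      also have "\<dots> \<le> (real n * x + 51 / 50 * real n) * \<rho> ^ (k - 2) * \<rho>"
        using rx \<mu>n \<rho>2 by (intro mult_right_mono) auto
      also have "\<dots> \<le> real qmin * real \<mu> * \<rho>" using key \<rho>2 by (intro mult_right_mono) auto
      finally show ?thesis by (simp add: P0_def mult_ac)
    qed
    ultimately show ?thesis unfolding ts.Pmin_def by (simp add: algebra_simps)
  qed
  interpret opening_phase n k b c f qmax qmin M \<Delta> s \<mu> \<rho> P0
  proof
    show "n \<le> f * c"
      using le_Suc_div_mult[of L n] L300 by (simp add: f_def c_def)
    show "n choose 2 \<le> (qmax - 1) * (b + 1)"
      using le_Suc_div_mult[of "b + 1" "n choose 2"] by (simp add: qmax_def)
    show "qmin * (b + 1) \<le> (n - 2 * qmax - f) choose 2" unfolding qmin_def by (rule div_times_less_eq_dividend)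
    show "M + (c + 2) * qmax \<le> n" using cqn by (simp add: M_def)
    show "1 \<le> M" using \<mu>0 by (simp add: \<mu>_def)
  qed (use k nbig \<rho>2 P0_def rem ts.spread ts.sm ts.M ts.\<rho>\<mu> in \<open>auto simp: f_def\<close>)
  show ?thesis by (rule enforcer_wins)
qed

section \<open>Threshold biases\<close>

lemma eventually_linear_le_powr:
  fixes a C :: real
  assumes "a > 1"
  shows "\<forall>\<^sub>F n in sequentially. C * real n \<le> real n powr a"
proof -
  have "filterlim (\<lambda>n. real n powr (a - 1)) at_top sequentially"
    using assms by real_asymp
  then have "\<forall>\<^sub>F n in sequentially. C \<le> real n powr (a - 1)" by (simp add: filterlim_at_top)
  then show ?thesis
    using eventually_gt_at_top[of "0::nat"]
  proof eventually_elim
    case (elim n)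
    have "C * real n \<le> real n powr (a - 1) * real n" using elim by (intro mult_right_mono) auto
    also have "\<dots> = real n powr a" using elim powr_add[of "real n" "a - 1" 1] by simp
    finally show ?case .
  qed
qed

lemma powr_ratio_power:
  assumes "q > 0" "n > 0"
  shows "(real n powr (real p / real q)) ^ q = real n ^ p"
proof -
  have "(real n powr (real p / real q)) ^ q = real n powr (real p / real q * real q)"
    using assms powr_realpow[of "real n powr (real p / real q)" q] by (simp add: powr_powr)
  then show ?thesis using assms by (simp add: powr_realpow)
qed

text \<open>Both orders of magnitude are established along all \<open>n\<close>, so the identity
  serves as the enumeration.\<close>

lemma theta_infinitely_oftenI: "f \<in> \<Theta>(f') \<Longrightarrow> theta_infinitely_often f f'"
  unfolding theta_infinitely_often_def by (intro exI[of _ "\<lambda>i. i"]) (auto simp: strict_mono_def)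

section \<open>Estimates on the two scales for fixed \<open>k\<close>\<close>

context
  fixes k :: nat
  assumes k: "k \<ge> 3"
begin

definition upper_scale :: "nat \<Rightarrow> real" where "upper_scale n = real n powr (real k / (real k - 1))"
definition lower_scale :: "nat \<Rightarrow> real" where "lower_scale n = real n powr ((real k + 1) / real k)"

lemma upper_scale_power: "n > 0 \<Longrightarrow> upper_scale n ^ (k - 1) = real n ^ k"
  using powr_ratio_power[of "k - 1" n k] k by (simp add: upper_scale_def of_nat_diff)

lemma lower_scale_power: "n > 0 \<Longrightarrow> lower_scale n ^ k = real n ^ (k + 1)"
  using powr_ratio_power[of k n "k + 1"] k by (simp add: lower_scale_def add.commute)

lemma upper_scale_nonneg: "upper_scale n \<ge> 0" and lower_scale_nonneg: "lower_scale n \<ge> 0" by (simp_all add: upper_scale_def lower_scale_def)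

lemma lower_scale_le_upper_scale: "lower_scale n \<le> upper_scale n"
proof (cases "n = 0")
  case False
  have "(real k + 1) / real k \<le> real k / (real k - 1)" using k by (simp add: field_simps)
  then show ?thesis unfolding upper_scale_def lower_scale_def using False by (intro powr_mono) auto
qed (simp add: upper_scale_def lower_scale_def)

lemma upper_scale_le: "n > 0 \<Longrightarrow> upper_scale n \<le> real n powr (3 / 2)"
  unfolding upper_scale_def using k by (intro powr_mono) (auto simp: field_simps)

lemma eventually_linear_le_upper_scale: "\<forall>\<^sub>F n in sequentially. C * real n \<le> upper_scale n"
  unfolding upper_scale_def using k by (intro eventually_linear_le_powr) (simp add: field_simps)

lemma eventually_linear_le_lower_scale: "\<forall>\<^sub>F n in sequentially. C * real n \<le> lower_scale n"
  unfolding lower_scale_def using k by (intro eventually_linear_le_powr) (simp add: field_simps)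

lemma eventually_upper_scale_le_square: "\<forall>\<^sub>F n in sequentially. C * upper_scale n \<le> real n ^ 2"
proof -
  have "\<forall>\<^sub>F n in sequentially. \<bar>C\<bar> * real n powr (3 / 2) \<le> real n ^ 2" by real_asymp
  then show ?thesis using eventually_gt_at_top[of "0::nat"]
  proof eventually_elim
    case (elim n)
    have "C * upper_scale n \<le> \<bar>C\<bar> * upper_scale n" using upper_scale_nonneg by (intro mult_right_mono) auto
    also have "\<dots> \<le> \<bar>C\<bar> * real n powr (3 / 2)" using upper_scale_le elim by (intro mult_left_mono) auto
    finally show ?case using elim by linarith
  qed
qed

lemma eventually_const_le: "\<forall>\<^sub>F n in sequentially. C \<le> real n"
  using filterlim_real_sequentially by (simp add: filterlim_at_top)

text \<open>Multiplied by \<open>(b + 1) ^ (k - 2)\<close>, the condition of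
  \<open>avoider_wins_large_bias\<close> reads
  \<open>2 ^ (k - 1) * n ^ k \<le> (b + 1) ^ (k - 1)\<close>; its root is the stated bound.\<close>

lemma avoider_wins_above:
  assumes R: "proper_rule R" and n: "n > 0" and b: "2 * upper_scale n \<le> real (b + 1)"
  shows "wins_star_game Avoider R k n b"
proof (rule avoider_wins_large_bias[OF R])
  define B where "B = real (b + 1)"
  have B: "B > 0" by (simp add: B_def)
  have "(2 * upper_scale n) ^ (k - 1) \<le> B ^ (k - 1)" using b upper_scale_nonneg by (intro power_mono) (auto simp: B_def)
  then have 1: "2 ^ (k - 1) * real n ^ k \<le> B ^ (k - 1)" using upper_scale_power[OF n] by (simp add: power_mult_distrib)
  have k1: "k - 1 = Suc (k - 2)" "k = Suc (Suc (k - 2))" using k by auto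
  have "2 * real n * (real n * (2 * real n / B) ^ (k - 2)) = 2 ^ (k - 1) * real n ^ k / B ^ (k - 2)"
  proof -
    have "(2::real) ^ (k - 1) = 2 * 2 ^ (k - 2)" using k1(1) by (metis power_Suc)
    moreover have "real n ^ k = real n * (real n * real n ^ (k - 2))" using k1(2) by (metis power_Suc)
    ultimately show ?thesis by (simp add: power_divide power_mult_distrib)
  qed
  also have "\<dots> \<le> B ^ (k - 1) / B ^ (k - 2)" using 1 B by (intro divide_right_mono) auto
  also have "\<dots> = B" using B unfolding k1(1) by simp
  finally show "2 * real n * (real n * (2 * real n / real (b + 1)) ^ (k - 2)) \<le> real (b + 1)"
    by (simp add: B_def)
qed (use k in simp)

lemma not_both_star:
  assumes "proper_rule R" "b \<ge> 1" "wins_star_game Avoider R k n b" "wins_star_game Enforcer R k n b"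
  shows False
  using not_both_win[OF assms(1) finite_complete_edges assms(2)] assms(3,4) by (simp add: wins_star_game_def)

lemma enforcer_wins_imp_le:
  assumes "proper_rule R" "n > 0" "b \<ge> 1" "wins_star_game Enforcer R k n b"
  shows "real b \<le> 2 * upper_scale n"
  using avoider_wins_above[OF assms(1,2)] not_both_star[OF assms(1,3)] assms(4)
  by (cases "2 * upper_scale n \<le> real (b + 1)") auto

text \<open>Three ranges of \<open>b\<close>: counting edges for very small biases, two blocks of
  linear size while \<open>b\<close> is of order \<open>n\<close>, and the opening above that. In
  the middle range \<open>b / m\<close> is bounded, so a constant times \<open>b\<close> has to be
  compared with \<open>m ^ 2\<close>.\<close>

lemma eventually_enforcer_strict:
  "\<forall>\<^sub>F n in sequentially. \<forall>b. 1 \<le> b \<and> real b \<le> 0.4 * upper_scale n \<and> small_remainder k n b \<longrightarrow>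
     wins_star_game Enforcer strict_moves k n b"
proof -
  define L where "L = 100 * k"
  define C1 where "C1 = L * (L + 2)"
  define K where "K = 8 * k\<^sup>2"
  define C2 where "C2 = 2 * real C1 * (5 * real C1 * real K) ^ (k - 1) * real K ^ 2"
  have "\<forall>\<^sub>F n in sequentially. real (4 * L * (L + 2)) \<le> real n" by (rule eventually_const_le)
  moreover have "\<forall>\<^sub>F n in sequentially. real (8 * k * K) \<le> real n" by (rule eventually_const_le)
  moreover have "\<forall>\<^sub>F n in sequentially. C2 \<le> real n" by (rule eventually_const_le)
  moreover have "\<forall>\<^sub>F n in sequentially. 2 * real L * upper_scale n \<le> real n ^ 2" by (rule eventually_upper_scale_le_square)
  ultimately show ?thesis
  proof eventually_elim
    case (elim n)
    have n1: "4 * L * (L + 2) \<le> n" and n2: "8 * k * K \<le> n" using elim(1,2) by (simp_all only: of_nat_le_iff)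
    have nk: "64 * k ^ 3 \<le> n" using n2 by (simp add: K_def power3_eq_cube power2_eq_square mult_ac)
    have k2: "k ^ 2 \<le> k ^ 3" using k by (intro power_increasing) auto
    have kk: "3 * k \<le> k ^ 2" using k by (simp add: power2_eq_square)
    have n0: "n > 0" using nk k2 kk k by linarith
    show ?case
    proof (intro allI impI, elim conjE)
      fix b assume b: "1 \<le> b" "real b \<le> 0.4 * upper_scale n" "small_remainder k n b"
      consider (small) "(b + 1) * (n * (k - 1)) < n * (n - 1)"
        | (mid) "n * (n - 1) \<le> (b + 1) * (n * (k - 1))" "b < C1 * n" | (large) "C1 * n \<le> b" by linarith
      then show "wins_star_game Enforcer strict_moves k n b"
      proof cases
        case small
        show ?thesis
        proof (rule enforcer_wins_small_bias[OF proper_rule_strict _ _ small])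
          fix U :: "nat set set"
          obtain T where "T \<subseteq> U" "card T = min b (card U)"
            using obtain_subset_with_card_n[of "min b (card U)" U] by auto
          then show "\<exists>T\<in>strict_moves b U. card T \<le> b" by (auto simp: strict_moves_def)
        qed (use k in simp)
      next
        case mid
        \<comment> \<open>Failure of the first case gives \<open>n \<le> b * k\<close>, so this
          \<open>m\<close> satisfies \<open>4 * k * m \<le> b\<close>.\<close>
        define m where "m = n div (4 * k\<^sup>2)"
        have "n * (n - 1) \<le> n * ((b + 1) * (k - 1))" using mid(1) by (simp only: mult.left_commute)
        then have "n - 1 \<le> (b + 1) * (k - 1)" using n0 by (simp only: mult_le_cancel1)
        also have "\<dots> = b * (k - 1) + (k - 1)" by simp
        finally have nb: "n \<le> b * (k - 1) + k" using k by simp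
        have "n \<le> b * k"
        proof -
          have "k \<le> b"
          proof (rule ccontr)
            assume "\<not> k \<le> b"
            then have "b * (k - 1) \<le> k * k" by (intro mult_le_mono) auto
            then show False using nb nk k2 kk k unfolding power2_eq_square by linarith
          qed
          moreover have "b * k = b * (k - 1) + b" using k by (cases k) auto
          ultimately show ?thesis using nb by simp
        qed
        have "4 * k\<^sup>2 * m \<le> n" by (simp add: m_def)
        moreover have "4 * k * m * k = 4 * k\<^sup>2 * m" by (simp add: power2_eq_square)
        ultimately have "4 * k * m * k \<le> b * k" using \<open>n \<le> b * k\<close> by linarith
        then have 1: "4 * k * m \<le> b" using k by simp
        have mge: "n \<le> K * m"
        proof -
          have "n \<le> (m + 1) * (4 * k\<^sup>2)" unfolding m_def using k by (intro le_Suc_div_mult) simp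
          moreover have "4 * k\<^sup>2 \<le> n" using nk k2 by linarith
          then have "m \<ge> 1" unfolding m_def using k by (simp add: div_greater_zero_iff Suc_le_eq)
          ultimately have "n \<le> (2 * m) * (4 * k\<^sup>2)"
            by (elim le_trans) (intro mult_le_mono1, simp)
          then show ?thesis by (simp add: K_def mult_ac)
        qed
        have "8 * k * K \<le> K * m" using n2 mge by linarith
        then have "K * (8 * k) \<le> K * m" by (simp only: mult.commute[of K "8 * k"])
        then have 2: "8 * k \<le> m" using k by (simp add: K_def)
        have 3: "2 * m \<le> n"
        proof -
          have "2 * m \<le> 4 * k\<^sup>2 * m" using k by (intro mult_le_mono1) (simp add: power2_eq_square)
          then show ?thesis using \<open>4 * k\<^sup>2 * m \<le> n\<close> by (rule le_trans)
        qed
        have m0: "real m > 0" using 2 k by simp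
        have mR: "real n \<le> real K * real m" using of_nat_mono[OF mge, where 'a = real] by simp
        have bR: "real b \<le> real C1 * real n" using mid(2) of_nat_mono[of b "C1 * n", where 'a = real] by simp
        have "5 * real b \<le> 5 * real C1 * real K * real m"
        proof -
          have "real C1 * real n \<le> real C1 * (real K * real m)" using mR by (intro mult_left_mono) auto
          then show ?thesis using bR by simp
        qed
        then have "5 * real b / real m \<le> 5 * real C1 * real K" using m0 by (simp add: pos_divide_le_eq)
        then have "(5 * real b / real m) ^ (k - 1) \<le> (5 * real C1 * real K) ^ (k - 1)"
          by (intro power_mono) auto
        then have "2 * real b * (5 * real b / real m) ^ (k - 1)
            \<le> 2 * (real C1 * real n) * (5 * real C1 * real K) ^ (k - 1)"
          using bR by (intro mult_mono) auto
        also have "\<dots> * real K ^ 2 = C2 * real n" by (simp add: C2_def)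
        finally have "2 * real b * (5 * real b / real m) ^ (k - 1) * real K ^ 2 \<le> C2 * real n"
          by (simp add: mult_right_mono)
        also have "\<dots> \<le> real n * real n" using elim(3) by (intro mult_right_mono) auto
        also have "\<dots> \<le> (real K * real m) * (real K * real m)" using mR by (intro mult_mono) auto
        also have "\<dots> = real m ^ 2 * real K ^ 2" by (simp add: power2_eq_square)
        finally have "2 * real b * (5 * real b / real m) ^ (k - 1) \<le> real m ^ 2"
          using k by (simp add: K_def)
        then show ?thesis using enforcer_wins_two_blocks(1)[OF k 2 1 3] by simp
      next
        case large
        show ?thesis
        proof (rule enforcer_wins_small_remainder[OF k _ _ _ _ b(3)])
          show "4 * (100 * k) * (100 * k + 2) \<le> n" using n1 by (simp add: L_def)
          show "100 * k * (100 * k + 2) * n \<le> b" using large by (simp add: C1_def L_def)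
          have "2 * real L * real b \<le> 2 * real L * upper_scale n" using b(2) upper_scale_nonneg[of n] by (intro mult_left_mono) auto
          then have "real (2 * L * b) \<le> real (n ^ 2)" using elim(4) by simp
          then show "2 * (100 * k) * b \<le> n ^ 2" by (simp only: of_nat_le_iff L_def)
          \<comment> \<open>Here the factor 0.4 is used: \<open>0.8 ^ 2 = 16 / 25\<close>, and the
            exponent \<open>k - 1\<close> is at least 2.\<close>
          have "(2 * real b) ^ (k - 1) \<le> (0.8 * upper_scale n) ^ (k - 1)" using b(2) by (intro power_mono) auto
          also have "\<dots> = 0.8 ^ (k - 1) * real n ^ k" unfolding upper_scale_power[OF n0, symmetric] by (rule power_mult_distrib)
          also have "(0.8::real) ^ (k - 1) \<le> 0.8 ^ 2" using k by (intro power_decreasing) auto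
          finally have "(2 * real b) ^ (k - 1) \<le> 0.8 ^ 2 * real n ^ k" by (simp add: mult_right_mono)
          then show "25 / 16 * (2 * real b) ^ (k - 1) \<le> real n ^ k" by (simp add: power2_eq_square)
        qed
      qed
    qed
  qed
qed

text \<open>The constant is \<open>180 = 5 * 3 * 12\<close>: with \<open>m \<ge> n / 3\<close> the
  ratio \<open>5 * b / m\<close> is at most \<open>upper_scale n / (12 * n)\<close>, whose power
  with exponent \<open>k - 1\<close> is at most \<open>n / 12\<close>, and four times that is at
  most \<open>m\<close>.\<close>

lemma eventually_enforcer_monotone:
  "\<forall>\<^sub>F n in sequentially. wins_star_game Enforcer monotone_moves k n (nat \<lfloor>upper_scale n / 180\<rfloor>)"
proof -
  have "\<forall>\<^sub>F n in sequentially. real (24 * k) \<le> real n" by (rule eventually_const_le)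
  moreover have "\<forall>\<^sub>F n in sequentially. (180 * (2 * real k + 1)) * real n \<le> upper_scale n" by (rule eventually_linear_le_upper_scale)
  ultimately show ?thesis
  proof eventually_elim
    case (elim n)
    define b where "b = nat \<lfloor>upper_scale n / 180\<rfloor>"
    define m where "m = n div 2"
    have nk: "24 * k \<le> n" using elim(1) by (simp only: of_nat_le_iff)
    then have n0: "n > 0" using k by simp
    have b1: "real b \<le> upper_scale n / 180" unfolding b_def using upper_scale_nonneg[of n] by (intro of_nat_floor) simp
    have "upper_scale n / 180 - 1 < real b" unfolding b_def by linarith
    moreover have "2 * real k * real n + real n \<le> upper_scale n / 180" using elim(2) by (simp add: algebra_simps)
    ultimately have "2 * real k * real n \<le> real b" using n0 by linarith
    then have "real (2 * k * n) \<le> real b" by simp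
    then have b2: "2 * k * n \<le> b" by (simp only: of_nat_le_iff)
    have m1: "2 * m \<le> n" "n \<le> 3 * m" using nk k by (auto simp: m_def)
    have "wins_star_game Enforcer monotone_moves k n b"
    proof (rule enforcer_wins_two_blocks(2)[OF k])
      show "8 * k \<le> m" using nk m1 by simp
      show "2 * m \<le> n" by (rule m1)
      have "2 * k * (2 * m) \<le> 2 * k * n" using m1 by (intro mult_le_mono2)
      moreover have "4 * k * m = 2 * k * (2 * m)" by simp
      ultimately show "4 * k * m \<le> b" using b2 by linarith
      show "k * n \<le> b" using b2 by simp
      have m0: "real m > 0" using m1 n0 by simp
      have "5 * real b / real m \<le> upper_scale n / (12 * real n)"
      proof -
        have "5 * real b / real m \<le> (5 * (upper_scale n / 180)) / (real n / 3)"
          using b1 m1 n0 upper_scale_nonneg[of n] by (intro frac_le) auto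
        then show ?thesis by simp
      qed
      then have "(5 * real b / real m) ^ (k - 1) \<le> (upper_scale n / (12 * real n)) ^ (k - 1)" by (intro power_mono) auto
      also have "\<dots> = real n ^ k / (12 ^ (k - 1) * real n ^ (k - 1))"
        using upper_scale_power[OF n0] by (simp add: power_divide power_mult_distrib)
      also have "real n ^ k = real n * real n ^ (k - 1)" using k by (cases k) auto
      also have "real n * real n ^ (k - 1) / (12 ^ (k - 1) * real n ^ (k - 1)) = real n / 12 ^ (k - 1)"
        using n0 by simp
      also have "\<dots> \<le> real n / 12 ^ 1" using k by (intro divide_left_mono power_increasing) auto
      finally have "4 * (5 * real b / real m) ^ (k - 1) \<le> real n / 3" by simp
      also have "\<dots> \<le> real m" using m1 by simp
      finally show "4 * (5 * real b / real m) ^ (k - 1) \<le> real m" .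
    qed
    then show ?case by (simp add: b_def)
  qed
qed

text \<open>The winning biases form a bounded initial segment, by
  \<open>enforcer_monotone_bias_mono\<close> and Avoider's win above
  \<open>2 * upper_scale n\<close>; so the \<open>GREATEST\<close> in \<open>f_mon\<close> is
  attained.\<close>

lemma f_mon_spec:
  assumes n: "n > 0"
  shows "\<forall>b\<ge>1. wins_star_game Enforcer monotone_moves k n b \<longleftrightarrow> b \<le> f_mon k n"
proof -
  define W where "W = {b. 1 \<le> b \<and> wins_star_game Enforcer monotone_moves k n b}"
  have "W \<subseteq> {..nat \<lfloor>2 * upper_scale n\<rfloor>}"
    using enforcer_wins_imp_le[OF proper_rule_monotone n] by (auto simp: W_def le_nat_floor)
  then have fW: "finite W" by (rule finite_subset) simp
  define f where "f = Max (insert 0 W)"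
  have f: "wins_star_game Enforcer monotone_moves k n b \<longleftrightarrow> b \<le> f" if "b \<ge> 1" for b
  proof
    assume "wins_star_game Enforcer monotone_moves k n b"
    then show "b \<le> f" using that fW by (auto simp: f_def W_def)
  next
    assume "b \<le> f"
    then have "f \<noteq> 0" using that by simp
    moreover have "f \<in> insert 0 W" unfolding f_def using fW by (intro Max_in) auto
    ultimately have "wins_star_game Enforcer monotone_moves k n f" by (auto simp: W_def)
    then show "wins_star_game Enforcer monotone_moves k n b"
      using enforcer_monotone_bias_mono \<open>b \<le> f\<close> unfolding wins_star_game_def by blast
  qed
  have "f_mon k n = f"
    unfolding f_mon_def
  proof (rule Greatest_equality)
    show "\<forall>b\<ge>1. wins_star_game Enforcer monotone_moves k n b \<longleftrightarrow> b \<le> f" using f by blast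
    fix y assume y: "\<forall>b\<ge>1. wins_star_game Enforcer monotone_moves k n b \<longleftrightarrow> b \<le> y"
    show "y \<le> f" using y f[of y] by (cases "y \<ge> 1") auto
  qed
  then show ?thesis using f by blast
qed

lemma f_mon_theta: "(\<lambda>n. real (f_mon k n)) \<in> \<Theta>(upper_scale)"
proof (rule bigthetaI)
  have "\<forall>\<^sub>F n in sequentially. norm (real (f_mon k n)) \<le> 2 * norm (upper_scale n)"
    using eventually_gt_at_top[of "0::nat"]
  proof eventually_elim
    case (elim n)
    have "real (f_mon k n) \<le> 2 * upper_scale n"
    proof (cases "f_mon k n \<ge> 1")
      case True
      then show ?thesis using f_mon_spec[OF elim] enforcer_wins_imp_le[OF proper_rule_monotone elim True] by blast
    next
      case False
      then have "f_mon k n = 0" by simp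
      then show ?thesis using upper_scale_nonneg by simp
    qed
    then show ?case using upper_scale_nonneg by simp
  qed
  then show "(\<lambda>n. real (f_mon k n)) \<in> O(upper_scale)" by (rule bigoI)
  have "\<forall>\<^sub>F n in sequentially. norm (real (f_mon k n)) \<ge> (1 / 360) * norm (upper_scale n)"
    using eventually_gt_at_top[of "0::nat"] eventually_enforcer_monotone eventually_linear_le_upper_scale[of 360]
  proof eventually_elim
    case (elim n)
    define b where "b = nat \<lfloor>upper_scale n / 180\<rfloor>"
    have "upper_scale n \<ge> 360" using elim(1,3) by linarith
    then have "b \<ge> 1" "upper_scale n / 180 - 1 < real b" unfolding b_def by linarith+
    then have "b \<le> f_mon k n" using f_mon_spec[OF elim(1)] elim(2) by (auto simp: b_def)
    then have "real b \<le> real (f_mon k n)" by simp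
    then show ?case using \<open>upper_scale n / 180 - 1 < real b\<close> \<open>upper_scale n \<ge> 360\<close> by simp
  qed
  then show "(\<lambda>n. real (f_mon k n)) \<in> \<Omega>(upper_scale)" by (intro landau_omega.bigI[of "1 / 360"]) auto
qed

lemma f_plus_bounds:
  assumes n: "n > 0"
  shows "real (f_plus k n) \<le> 2 * upper_scale n"
    and "\<And>b. b \<ge> 1 \<Longrightarrow> wins_star_game Enforcer strict_moves k n b \<Longrightarrow> b \<le> f_plus k n"
proof -
  define f where "f = nat \<lfloor>2 * upper_scale n\<rfloor>"
  have P: "\<forall>b>f. wins_star_game Avoider strict_moves k n b"
  proof (intro allI impI)
    fix b assume "f < b"
    then have "2 * upper_scale n \<le> real (b + 1)" unfolding f_def by linarith
    then show "wins_star_game Avoider strict_moves k n b" by (rule avoider_wins_above[OF proper_rule_strict n])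
  qed
  have "f_plus k n \<le> f" unfolding f_plus_def by (rule Least_le[of _ f]) (rule P)
  then have "real (f_plus k n) \<le> real f" by simp
  also have "\<dots> \<le> 2 * upper_scale n" unfolding f_def using upper_scale_nonneg[of n] by simp
  finally show "real (f_plus k n) \<le> 2 * upper_scale n" .
  have Q: "\<forall>b>f_plus k n. wins_star_game Avoider strict_moves k n b"
    unfolding f_plus_def by (rule LeastI[of _ f]) (rule P)
  fix b assume "b \<ge> 1" "wins_star_game Enforcer strict_moves k n b"
  then show "b \<le> f_plus k n" using Q not_both_star[OF proper_rule_strict] by (meson not_le)
qed

lemma f_minus_bounds:
  assumes n: "n > 0"
  shows "\<And>b. 1 \<le> b \<Longrightarrow> b \<le> f_minus k n \<Longrightarrow> wins_star_game Enforcer strict_moves k n b"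
    and "\<And>f. (\<And>b. 1 \<le> b \<Longrightarrow> b \<le> f \<Longrightarrow> wins_star_game Enforcer strict_moves k n b) \<Longrightarrow> f \<le> f_minus k n"
proof -
  let ?P = "\<lambda>f. \<forall>b\<ge>1. b \<le> f \<longrightarrow> wins_star_game Enforcer strict_moves k n b"
  have bound: "\<forall>f. ?P f \<longrightarrow> f \<le> nat \<lfloor>2 * upper_scale n\<rfloor>"
  proof (intro allI impI)
    fix f assume f: "?P f"
    show "f \<le> nat \<lfloor>2 * upper_scale n\<rfloor>"
    proof (cases "f \<ge> 1")
      case True
      then show ?thesis using f enforcer_wins_imp_le[OF proper_rule_strict n True] by (simp add: le_nat_floor)
    qed simp
  qed
  have "?P (f_minus k n)" unfolding f_minus_def
  proof (rule GreatestI_nat[of ?P 0])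
    show "f \<le> nat \<lfloor>2 * upper_scale n\<rfloor>" if "?P f" for f using bound that by blast
  qed simp
  then show "\<And>b. 1 \<le> b \<Longrightarrow> b \<le> f_minus k n \<Longrightarrow> wins_star_game Enforcer strict_moves k n b" by blast
  fix f assume "\<And>b. 1 \<le> b \<Longrightarrow> b \<le> f \<Longrightarrow> wins_star_game Enforcer strict_moves k n b"
  then have f: "?P f" by blast
  show "f \<le> f_minus k n" unfolding f_minus_def
  proof (rule Greatest_le_nat[of ?P, OF f])
    show "f' \<le> nat \<lfloor>2 * upper_scale n\<rfloor>" if "?P f'" for f' using bound that by blast
  qed
qed

section \<open>Biases with small and with large remainder\<close>

lemma finite_below_upper_scale: "finite {b. 1 \<le> b \<and> real b \<le> 0.4 * upper_scale n \<and> P b}"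
  by (rule finite_subset[of _ "{..nat \<lfloor>0.4 * upper_scale n\<rfloor>}"]) (auto simp: le_nat_floor)

text \<open>For \<open>b = 1\<close> the remainder is at most 2, so the set defining
  \<open>e_plus\<close> is nonempty and its maximum is a bias at which Enforcer wins.\<close>

lemma e_plus_le_f_plus: "\<forall>\<^sub>F n in sequentially. e_plus k n \<le> f_plus k n"
  using eventually_enforcer_strict eventually_linear_le_upper_scale[of 3] eventually_ge_at_top[of "3::nat"]
proof eventually_elim
  case (elim n)
  define E where "E = {b. 1 \<le> b \<and> real b \<le> 0.4 * upper_scale n \<and> small_remainder k n b}"
  have eE: "e_plus k n = Max E" by (simp add: e_plus_def E_def upper_scale_def)
  have "(2::real) ^ (k - 1) * 2 < real n ^ (k + 1)"
  proof -
    have "(2::real) ^ (k - 1) * 2 = 2 ^ k" using k by (cases k) auto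
    also have "\<dots> \<le> 2 ^ (k + 1)" by simp
    also have "\<dots> < real n ^ (k + 1)" using elim(3) by (intro power_strict_mono) auto
    finally show ?thesis .
  qed
  moreover have "star_rem n 1 \<le> 2" using star_rem_props(2)[of n 1] elim(3) by simp
  then have "real (star_rem n 1) \<le> 2" by simp
  ultimately have "small_remainder k n 1"
    unfolding small_remainder_def
  proof (subst pos_less_divide_eq)
    assume a: "2 ^ (k - 1) * 2 < real n ^ (k + 1)" and r: "real (star_rem n 1) \<le> 2"
    have e: "(2 * real 1) ^ (k - 1) = (2::real) ^ (k - 1)" by simp
    have "real (star_rem n 1) * 2 ^ (k - 1) \<le> 2 * 2 ^ (k - 1)" using r by (intro mult_right_mono) auto
    then show "real (star_rem n 1) * (2 * real 1) ^ (k - 1) < real n ^ (k + 1)" unfolding e using a by linarith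
  qed simp
  then have "1 \<in> E" using elim(2,3) by (simp add: E_def)
  then have "E \<noteq> {}" by blast
  moreover have "finite E" unfolding E_def by (rule finite_below_upper_scale)
  ultimately have "Max E \<in> E" by (intro Max_in)
  then have "1 \<le> Max E" "wins_star_game Enforcer strict_moves k n (Max E)" using elim(1) by (auto simp: E_def)
  then show ?case using f_plus_bounds(2)[of n "Max E"] elim(3) eE by simp
qed

text \<open>Write \<open>N = mm * q + r\<close> with \<open>1 \<le> r \<le> mm < n\<close> and
  \<open>q\<close> between \<open>Q\<close> and \<open>2 * Q\<close>. For \<open>b + 1 = q\<close>
  the remainder is below \<open>n\<close>, and \<open>2 * b \<le> upper_scale n\<close> makes the
  allowed bound at least \<open>n\<close>.\<close>

lemma eventually_small_remainder:
  "\<forall>\<^sub>F n in sequentially. \<exists>b\<ge>1. upper_scale n / 20 \<le> real b \<and> real b \<le> 0.4 * upper_scale n \<and> small_remainder k n b"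
  using eventually_linear_le_upper_scale[of 100] eventually_upper_scale_le_square[of 4] eventually_ge_at_top[of "5::nat"]
proof eventually_elim
  case (elim n)
  have gn: "100 * real n \<le> upper_scale n" by (rule elim)
  have n5: "real n \<ge> 5" using elim(3) by simp
  define N where "N = n choose 2"
  define Q where "Q = nat \<lceil>upper_scale n / 10\<rceil>"
  have Q1: "upper_scale n / 10 \<le> real Q" "real Q \<le> upper_scale n / 10 + 1" unfolding Q_def using gn by linarith+
  have NR: "real N = real n * (real n - 1) / 2" unfolding N_def by (rule real_choose_two)
  have N2: "real N \<le> real n ^ 2 / 2" unfolding NR by (simp add: power2_eq_square algebra_simps)
  have "upper_scale n / 10 + 2 \<le> real N"
  proof -
    have "real n ^ 2 / 4 \<le> real N" unfolding NR using n5 by (simp add: power2_eq_square field_simps)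
    then have "upper_scale n \<le> real N" using elim(2) by linarith
    then show ?thesis using gn n5 by linarith
  qed
  then have QN: "Q \<le> N - 1" "N \<ge> 1" using Q1 by linarith+
  have Q0: "Q > 0" using Q1 gn n5 by linarith
  \<comment> \<open>Dividing \<open>N - 1\<close> instead of \<open>N\<close> puts \<open>r\<close>
    between 1 and \<open>mm\<close>, in agreement with \<open>star_rem\<close>, which is never
    0.\<close>
  define mm where "mm = (N - 1) div Q"
  have mm0: "mm > 0" unfolding mm_def using QN Q0 by (simp add: div_greater_zero_iff)
  define q where "q = (N - 1) div mm"
  have "mm * Q \<le> N - 1" by (simp add: mm_def)
  then have qQ: "Q \<le> q" unfolding q_def using mm0 by (simp add: less_eq_div_iff_mult_less_eq mult.commute)
  have q2: "q \<le> 2 * Q"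
  proof -
    have "N - 1 < (mm + 1) * Q" unfolding mm_def using dividend_less_div_times[OF Q0, of "N - 1"] by simp
    also have "\<dots> \<le> (2 * mm) * Q" using mm0 by (intro mult_le_mono1) simp
    finally have "N - 1 < 2 * Q * mm" by (simp add: mult_ac)
    then have "q < 2 * Q" unfolding q_def using mm0 by (simp add: div_less_iff_less_mult)
    then show ?thesis by simp
  qed
  have mmn: "mm < n"
  proof -
    have "real mm \<le> real (N - 1) / real Q" unfolding mm_def by (rule of_nat_div_le_of_nat)
    also have "\<dots> \<le> (real n ^ 2 / 2) / (upper_scale n / 10)" using N2 Q1 gn n5 QN by (intro frac_le) auto
    also have "\<dots> \<le> (real n ^ 2 / 2) / (100 * real n / 10)" using gn n5 by (intro divide_left_mono) auto
    also have "\<dots> < real n" using n5 by (simp add: power2_eq_square)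
    finally show ?thesis by simp
  qed
  define r where "r = (N - 1) mod mm + 1"
  have rmm: "r \<le> mm" unfolding r_def using mod_less_divisor[OF mm0, of "N - 1"] by simp
  have Nr: "N = mm * q + r" unfolding r_def q_def using QN(2) mult_div_mod_eq[of mm "N - 1"] by simp
  have "real n \<le> real Q" using Q1 gn n5 by linarith
  then have "n \<le> q" using qQ by simp
  define b where "b = q - 1"
  have bq: "b + 1 = q" using \<open>n \<le> q\<close> elim(3) by (simp add: b_def)
  have "star_rem n b = r"
  proof (rule star_rem_eqI)
    show "1 \<le> r" by (simp add: r_def)
    show "r \<le> b + 1" using rmm mmn \<open>n \<le> q\<close> bq by simp
    show "n choose 2 = mm * (b + 1) + r" using Nr bq by (simp add: N_def)
  qed
  then have rn: "real (star_rem n b) < real n" using rmm mmn by simp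
  have bR: "real b = real q - 1" using bq by linarith
  have "real q \<le> 2 * real Q" using of_nat_mono[OF q2, where 'a = real] by simp
  then have b4: "real b \<le> 0.4 * upper_scale n" using bR Q1 gn n5 by simp
  have b20: "upper_scale n / 20 \<le> real b" using bR qQ Q1 gn n5 by (simp add: field_simps)
  have b1: "b \<ge> 1" using \<open>n \<le> q\<close> elim(3) bq by simp
  have "small_remainder k n b"
  proof -
    have "(2 * real b) ^ (k - 1) \<le> upper_scale n ^ (k - 1)" using b4 upper_scale_nonneg[of n] by (intro power_mono) auto
    then have "(2 * real b) ^ (k - 1) \<le> real n ^ k" using upper_scale_power elim(3) by simp
    then have "real n * (2 * real b) ^ (k - 1) \<le> real n * real n ^ k" by (intro mult_left_mono) auto
    then have "real n \<le> real n ^ (k + 1) / (2 * real b) ^ (k - 1)" using b1 by (subst pos_le_divide_eq) auto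
    then show ?thesis unfolding small_remainder_def using rn by linarith
  qed
  then show ?case using b1 b4 b20 by blast
qed

lemma f_plus_bigo: "(\<lambda>n. real (f_plus k n)) \<in> O(upper_scale)"
proof -
  have "\<forall>\<^sub>F n in sequentially. norm (real (f_plus k n)) \<le> 2 * norm (upper_scale n)"
    using eventually_gt_at_top[of "0::nat"]
    by eventually_elim (use f_plus_bounds(1) upper_scale_nonneg in simp)
  then show ?thesis by (rule bigoI)
qed

lemma f_plus_bigomega: "(\<lambda>n. real (f_plus k n)) \<in> \<Omega>(upper_scale)"
proof -
  have "\<forall>\<^sub>F n in sequentially. norm (real (f_plus k n)) \<ge> (1 / 20) * norm (upper_scale n)"
    using eventually_gt_at_top[of "0::nat"] eventually_enforcer_strict eventually_small_remainder
  proof eventually_elim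
    case (elim n)
    then obtain b where b: "b \<ge> 1" "upper_scale n / 20 \<le> real b" "wins_star_game Enforcer strict_moves k n b" by blast
    have "b \<le> f_plus k n" using f_plus_bounds(2)[OF elim(1) b(1,3)] .
    then have "real b \<le> real (f_plus k n)" by simp
    then show ?case using b(2) upper_scale_nonneg by simp
  qed
  then show ?thesis by (intro landau_omega.bigI[of "1 / 20"]) auto
qed

text \<open>Up to \<open>0.4 * lower_scale n\<close> every bias qualifies: the remainder is at most
  \<open>b' + 1 \<le> 2 * b'\<close>, and \<open>(2 * b') ^ k < n ^ (k + 1)\<close> is then exactly
  what is needed.\<close>

lemma e_minus_ge: "n > 0 \<Longrightarrow> 1 \<le> 0.4 * lower_scale n \<Longrightarrow> 0.4 * lower_scale n - 1 \<le> real (e_minus k n)"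
  and e_minus_le_f_minus: "\<forall>\<^sub>F n in sequentially. e_minus k n \<le> f_minus k n"
proof -
  define E where "E n = {b. 1 \<le> b \<and> real b \<le> 0.4 * upper_scale n \<and> (\<forall>b'. 1 \<le> b' \<and> b' \<le> b \<longrightarrow> small_remainder k n b')}" for n
  have eE: "e_minus k n = Max (E n)" for n by (simp add: e_minus_def E_def upper_scale_def)
  have fE: "finite (E n)" for n unfolding E_def by (rule finite_below_upper_scale)
  have mem: "nat \<lfloor>0.4 * lower_scale n\<rfloor> \<in> E n" if n: "n > 0" and h1: "1 \<le> 0.4 * lower_scale n" for n
  proof -
    define b where "b = nat \<lfloor>0.4 * lower_scale n\<rfloor>"
    have b1: "b \<ge> 1" unfolding b_def using h1 by linarith
    have bh: "real b \<le> 0.4 * lower_scale n" unfolding b_def using lower_scale_nonneg[of n] by (intro of_nat_floor) simp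
    have n2: "n \<ge> 2"
    proof (rule ccontr)
      assume "\<not> n \<ge> 2"
      then have "n = 1" using n by simp
      then show False using h1 by (simp add: lower_scale_def)
    qed
    have "small_remainder k n b'" if b': "1 \<le> b'" "b' \<le> b" for b'
    proof -
      have "star_rem n b' \<le> 2 * b'" using star_rem_props(2)[OF n2, of b'] b' by simp
      then have "real (star_rem n b') \<le> 2 * real b'" by simp
      then have "real (star_rem n b') * (2 * real b') ^ (k - 1) \<le> 2 * real b' * (2 * real b') ^ (k - 1)"
        by (intro mult_right_mono) auto
      also have "\<dots> = (2 * real b') ^ k" using k by (cases k) auto
      also have "\<dots> < lower_scale n ^ k" using b' bh h1 k by (intro power_strict_mono) auto
      also have "\<dots> = real n ^ (k + 1)" by (rule lower_scale_power[OF n])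
      finally show ?thesis unfolding small_remainder_def using b' by (subst pos_less_divide_eq) auto
    qed
    moreover have "real b \<le> 0.4 * upper_scale n" using bh lower_scale_le_upper_scale[of n] by simp
    ultimately show ?thesis using b1 unfolding E_def b_def by blast
  qed
  show "n > 0 \<Longrightarrow> 1 \<le> 0.4 * lower_scale n \<Longrightarrow> 0.4 * lower_scale n - 1 \<le> real (e_minus k n)" for n
  proof -
    assume "n > 0" "1 \<le> 0.4 * lower_scale n"
    then have "nat \<lfloor>0.4 * lower_scale n\<rfloor> \<le> e_minus k n" unfolding eE using fE mem by (intro Max_ge) auto
    then show ?thesis by linarith
  qed
  show "\<forall>\<^sub>F n in sequentially. e_minus k n \<le> f_minus k n"
    using eventually_enforcer_strict eventually_linear_le_lower_scale[of 3] eventually_gt_at_top[of "0::nat"]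
  proof eventually_elim
    case (elim n)
    have "1 \<le> 0.4 * lower_scale n" using elim(2,3) by simp
    then have "Max (E n) \<in> E n" using mem[OF elim(3)] fE[of n] by (intro Max_in) auto
    then have m: "real (Max (E n)) \<le> 0.4 * upper_scale n" "\<forall>b'. 1 \<le> b' \<and> b' \<le> Max (E n) \<longrightarrow> small_remainder k n b'"
      unfolding E_def by blast+
    show ?case
    proof (rule f_minus_bounds(2)[OF elim(3)])
      fix b assume b: "1 \<le> b" "b \<le> e_minus k n"
      then have "real b \<le> 0.4 * upper_scale n" "small_remainder k n b" using m eE[of n] by auto
      then show "wins_star_game Enforcer strict_moves k n b" using elim(1) b(1) by blast
    qed
  qed
qed

lemma e_minus_bigomega: "(\<lambda>n. real (e_minus k n)) \<in> \<Omega>(lower_scale)"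
proof -
  have "\<forall>\<^sub>F n in sequentially. norm (real (e_minus k n)) \<ge> (1 / 5) * norm (lower_scale n)"
    using eventually_gt_at_top[of "0::nat"] eventually_linear_le_lower_scale[of 5]
  proof eventually_elim
    case (elim n)
    have "lower_scale n \<ge> 5" using elim by linarith
    then show ?case using e_minus_ge[OF elim(1)] lower_scale_nonneg[of n] by simp
  qed
  then show ?thesis by (intro landau_omega.bigI[of "1 / 5"]) auto
qed

text \<open>Rounding \<open>N / mm\<close> up to \<open>q\<close> makes \<open>N\<close> fall short
  of \<open>mm * q\<close> by at most \<open>mm \<le> q / 2\<close>, so the remainder modulo
  \<open>q = b + 1\<close> is at least \<open>q / 2\<close>. Avoider's condition then reduces to
  \<open>q\<close> exceeding \<open>2 * lower_scale n\<close>.\<close>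

lemma eventually_large_remainder:
  "\<forall>\<^sub>F n in sequentially. \<exists>b\<ge>1. real b \<le> 6 * lower_scale n \<and> wins_star_game Avoider strict_moves k n b"
  using eventually_linear_le_lower_scale[of 4] eventually_upper_scale_le_square[of 20] eventually_ge_at_top[of "5::nat"]
proof eventually_elim
  case (elim n)
  have hn: "4 * real n \<le> lower_scale n" by (rule elim)
  have n5: "real n \<ge> 5" using elim(3) by simp
  have n0: "n > 0" using elim(3) by simp
  define N where "N = n choose 2"
  define Q where "Q = nat \<lceil>2 * lower_scale n\<rceil>"
  have Q1: "2 * lower_scale n \<le> real Q" "real Q \<le> 2 * lower_scale n + 1" unfolding Q_def using hn by linarith+
  have NR: "real N = real n * (real n - 1) / 2" unfolding N_def by (rule real_choose_two)
  have N2: "real N \<le> real n ^ 2 / 2" unfolding NR by (simp add: power2_eq_square algebra_simps)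
  have QN: "Q \<le> N"
  proof -
    have "real n ^ 2 / 4 \<le> real N" unfolding NR using n5 by (simp add: power2_eq_square field_simps)
    moreover have "20 * lower_scale n \<le> real n ^ 2" using elim(2) lower_scale_le_upper_scale[of n] by linarith
    ultimately have "real Q \<le> real N" using Q1 hn n5 by linarith
    then show ?thesis by simp
  qed
  have Q0: "Q > 0" using Q1 hn n5 by linarith
  define mm where "mm = N div Q"
  have mm0: "mm > 0" unfolding mm_def using QN Q0 by (simp add: div_greater_zero_iff)
  define q where "q = N div mm + 1"
  have qlow: "N < mm * q" unfolding q_def using dividend_less_div_times[OF mm0, of N] by (simp add: mult.commute)
  have qup: "mm * (q - 1) \<le> N" by (simp add: q_def)
  have "mm * Q \<le> N" by (simp add: mm_def)
  then have qQ: "Q < q" unfolding q_def using mm0 by (simp add: less_eq_div_iff_mult_less_eq mult.commute less_Suc_eq_le)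
  have q2: "q \<le> 2 * Q + 1"
  proof -
    have "N < (mm + 1) * Q" unfolding mm_def using dividend_less_div_times[OF Q0, of N] by simp
    also have "\<dots> \<le> (2 * mm) * Q" using mm0 by (intro mult_le_mono1) simp
    finally have "N < 2 * Q * mm" by (simp add: mult_ac)
    then have "N div mm < 2 * Q" using mm0 by (simp add: div_less_iff_less_mult)
    then show ?thesis by (simp add: q_def)
  qed
  have mmq: "2 * mm \<le> q"
  proof -
    have "real mm \<le> real N / real Q" unfolding mm_def by (rule of_nat_div_le_of_nat)
    also have "\<dots> \<le> (real n ^ 2 / 2) / (2 * lower_scale n)" using N2 Q1 hn n5 by (intro frac_le) auto
    also have "\<dots> \<le> (real n ^ 2 / 2) / (2 * (4 * real n))" using hn n5 by (intro divide_left_mono) auto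
    also have "\<dots> \<le> real n" using n5 by (simp add: power2_eq_square)
    finally have "2 * real mm \<le> real Q" using Q1 hn n5 by linarith
    then show ?thesis using qQ by linarith
  qed
  define b where "b = q - 1"
  have bq: "b + 1 = q" using qQ by (simp add: b_def)
  define r where "r = N - (mm - 1) * q"
  have mq: "(mm - 1) * q + q = mm * q" using mm0 by (cases mm) auto
  have mq': "mm * (q - 1) + mm = mm * q" using qQ by (cases q) auto
  have rge: "q \<le> r + mm" "(mm - 1) * q + r = N" "r < q"
    unfolding r_def using mq mq' qlow qup mmq by linarith+
  have rem: "star_rem n b = r"
  proof (rule star_rem_eqI)
    show "1 \<le> r" using rge mmq mm0 by linarith
    show "r \<le> b + 1" using rge bq by simp
    show "n choose 2 = (mm - 1) * (b + 1) + r" using rge(2) bq by (simp add: N_def)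
  qed
  have r2: "real q / 2 \<le> real r" using rge(1) mmq by linarith
  have "wins_star_game Avoider strict_moves k n b"
  proof (rule avoider_wins_strict_remainder)
    have q0: "real q > 0" using qQ by simp
    have "2 * lower_scale n < real q" using Q1 qQ by linarith
    then have "(2 * lower_scale n) ^ k < real q ^ k" using lower_scale_nonneg[of n] k by (intro power_strict_mono) auto
    then have 1: "2 ^ k * real n ^ (k + 1) < real q ^ k" using lower_scale_power[OF n0] by (simp add: power_mult_distrib)
    have k1: "k = Suc (k - 1)" using k by simp
    have "real n * (real n * (2 * real n / real q) ^ (k - 1)) = 2 ^ k * real n ^ (k + 1) / (2 * real q ^ (k - 1))"
    proof -
      have "(2::real) ^ k = 2 * 2 ^ (k - 1)" "real n ^ (k + 1) = real n * (real n * real n ^ (k - 1))"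
        using k1 by (metis power_Suc) (metis k1 power_Suc Suc_eq_plus1)
      then show ?thesis by (auto simp: power_divide power_mult_distrib)
    qed
    also have "\<dots> < real q ^ k / (2 * real q ^ (k - 1))" using 1 q0 by (intro divide_strict_right_mono) auto
    also have "real q ^ k = real q * real q ^ (k - 1)" using k1 by (metis power_Suc)
    also have "real q * real q ^ (k - 1) / (2 * real q ^ (k - 1)) = real q / 2" using q0 by simp
    finally show "real n * (real n * (2 * real n / real (b + 1)) ^ (k - 1)) < real (star_rem n b)"
      unfolding bq rem using r2 by linarith
  qed (use k elim(3) in auto)
  moreover have "real b \<le> 6 * lower_scale n" using q2 bq Q1 hn n5 by linarith
  moreover have "b \<ge> 1" using qQ Q0 bq by linarith
  ultimately show ?case by blast
qed

text \<open>A single bias at which Avoider wins bounds \<open>f_minus\<close> from above; there is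
  one of order \<open>lower_scale n\<close> for every large \<open>n\<close>, which gives the bound
  without a logarithm.\<close>

lemma f_minus_bigo: "(\<lambda>n. real (f_minus k n)) \<in> O(lower_scale)"
proof -
  have "\<forall>\<^sub>F n in sequentially. norm (real (f_minus k n)) \<le> 6 * norm (lower_scale n)"
    using eventually_gt_at_top[of "0::nat"] eventually_large_remainder
  proof eventually_elim
    case (elim n)
    then obtain b where b: "b \<ge> 1" "real b \<le> 6 * lower_scale n" "wins_star_game Avoider strict_moves k n b" by blast
    have "f_minus k n \<le> b"
      using f_minus_bounds(1)[OF elim(1) b(1)] not_both_star[OF proper_rule_strict b(1,3)] by (meson nat_le_linear)
    then have "real (f_minus k n) \<le> real b" by simp
    then show ?case using b(2) lower_scale_nonneg by simp
  qed
  then show ?thesis by (rule bigoI)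
qed

lemma f_minus_bigomega: "(\<lambda>n. real (f_minus k n)) \<in> \<Omega>(lower_scale)"
proof -
  have "\<forall>\<^sub>F n in sequentially. norm (real (f_minus k n)) \<ge> (1 / 5) * norm (lower_scale n)"
    using eventually_gt_at_top[of "0::nat"] eventually_linear_le_lower_scale[of 5] e_minus_le_f_minus
  proof eventually_elim
    case (elim n)
    have "lower_scale n \<ge> 5" using elim by linarith
    moreover have "real (e_minus k n) \<le> real (f_minus k n)" using elim(3) by simp
    ultimately show ?case using e_minus_ge[OF elim(1)] lower_scale_nonneg[of n] by simp
  qed
  then show ?thesis by (intro landau_omega.bigI[of "1 / 5"]) auto
qed

lemma lower_scale_bigo_log: "lower_scale \<in> O(\<lambda>n. lower_scale n * ln (real n))"
proof -
  have "\<forall>\<^sub>F n in sequentially. 1 \<le> ln (real n)" by real_asymp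
  then have "\<forall>\<^sub>F n in sequentially. norm (lower_scale n) \<le> 1 * norm (lower_scale n * ln (real n))"
  proof eventually_elim
    case (elim n)
    have "lower_scale n * 1 \<le> lower_scale n * ln (real n)" using elim lower_scale_nonneg by (intro mult_left_mono) auto
    then show ?case using lower_scale_nonneg[of n] elim by simp
  qed
  then show ?thesis by (rule bigoI)
qed

lemmas star_bounds = f_mon_theta e_plus_le_f_plus f_plus_bigo bigthetaI[OF f_plus_bigo f_plus_bigomega]
  e_minus_bigomega e_minus_le_f_minus landau_o.big_trans[OF f_minus_bigo lower_scale_bigo_log]
  bigthetaI[OF f_minus_bigo f_minus_bigomega]

end

theorem theorem1:
  fixes k :: nat
  assumes "k \<ge> 3"
  shows
    "(\<lambda>n. real (f_mon k n)) \<in> \<Theta>(\<lambda>n. real n powr (real k / (real k - 1)))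
     \<and>
     ((\<forall>\<^sub>F n in sequentially. e_plus k n \<le> f_plus k n)
      \<and> (\<lambda>n. real (f_plus k n)) \<in> O(\<lambda>n. real n powr (real k / (real k - 1)))
      \<and> theta_infinitely_often (\<lambda>n. real (f_plus k n)) (\<lambda>n. real n powr (real k / (real k - 1))))
     \<and>
     ((\<lambda>n. real (e_minus k n)) \<in> \<Omega>(\<lambda>n. real n powr ((real k + 1) / real k))
      \<and> (\<forall>\<^sub>F n in sequentially. e_minus k n \<le> f_minus k n)
      \<and> (\<lambda>n. real (f_minus k n)) \<in> O(\<lambda>n. real n powr ((real k + 1) / real k) * ln (real n))
      \<and> theta_infinitely_often (\<lambda>n. real (f_minus k n)) (\<lambda>n. real n powr ((real k + 1) / real k)))"
  using star_bounds[OF assms] unfolding upper_scale_def[OF assms, abs_def] lower_scale_def[OF assms, abs_def]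
  by (auto intro: theta_infinitely_oftenI)

end
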